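(* Fix convention E ($\varepsilon=0$) or N ($\varepsilon=1$). (1) If a randomized learner has worst-instance expected number of mistakes $m_T$ and worst-instance expected number of oracle calls $q_T$, then $$q_T\ \ge\ \frac{\ln(T+1-\varepsilon)-\ln(2m_T+1)}{7\ln 2}.$$ For $m_T=O((\log T)^d)$ with $d$ fixed, this gives $q_T=\Omega(\log T)$. (2) The randomized ERM query complexity of $O(\log T)$ mistakes is $\Theta(\log T)$: there is a (family of) randomized learner(s) with worst-instance expected mistakes $O(\log T)$ and worst-instance expected calls $O(\log T)$, valid for every legal selection rule, and every randomized learner with worst-instance expected mistakes $O(\log T)$ has worst-instance expected calls $\Omega(\log T)$. (3) The deterministic ERM query complexity of $O(\log T)$ mistakes is $\Theta(T)$, both under each pre-declared extremal rule ($\mathcal O_{\min}$, $\mathcal O_{\max}$, or a rule choosing between these two according to a function of the sample alone) and against worst-case legal memoryless oracles: there is a deterministic learner making $O(\log T)$ mistakes and $O(T)$ calls on every instance, and every deterministic learner guaranteeing $O(\log T)$ mistakes on every instance makes $\Omega(T)$ calls on some instance.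
   Context: Domain and conventions. $T$ distinct instances are announced in advance as a sequence $x_1,\dots,x_T$. Convention E: $X=\{s,x_1,\dots,x_T\}$ and only total orders on $X$ in which the sentinel $s$ is the minimum are admissible; $\varepsilon=0$. Convention N: $X=\{x_1,\dots,x_T\}$, all total orders on $X$ are admissible; $\varepsilon=1$. For a total order $\preceq$ on $X$ and $z\in X$ let $c_z(x)=\mathbf 1[x\preceq z]$ and $C_\preceq=\{c_z:z\in X\}$. Oracles. A legal (consistency-type ERM) memoryless oracle for $\preceq$ is a function of the sample $S\subseteq X\times\{0,1\}$ that returns some concept in $C_\preceq$ consistent with $S$ (as a full label vector on $X$), or $\bot$ if no concept of $C_\preceq$ is consistent with $S$. A selection rule $\mathcal R(S,\preceq)$ is a function that is such an oracle for every admissible $\preceq$. $\mathcal O_{\min}$ (resp. $\mathcal O_{\max}$) returns the smallest (resp. largest) consistent prefix. Protocol. The learner knows the convention, $X$, $T$ and the sequence, but not $\preceq$ or $z$. In round $t$ it predicts $\hat y_t\in\{0,1\}$ and then sees $y_t=c_z(x_t)$; at any time it may call the oracle on any adaptively chosen sample, each call costing one. An instance consists of the order, target, sequence and selection rule/oracle, fixed before the learner's private randomness. "Worst-instance expected" means the supremum over instances of the expectation over the learner's private randomness. Asymptotics are as $T\to\infty$. *)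

theory Defs
  imports "HOL-Probability.Probability"
begin

text \<open>Conventions E (with its sentinel) and N.\<close>

datatype 'a convention = Conv_E 'a | Conv_N

fun eps :: "'a convention \<Rightarrow> real" where
  "eps (Conv_E s) = 0"
| "eps Conv_N = 1"

fun dom_of :: "'a convention \<Rightarrow> 'a list \<Rightarrow> 'a set" where
  "dom_of (Conv_E s) xs = insert s (set xs)"
| "dom_of Conv_N xs = set xs"

definition announceable :: "'a convention \<Rightarrow> nat \<Rightarrow> 'a list \<Rightarrow> bool" where
  "announceable cv T xs \<longleftrightarrow>
     length xs = T \<and> distinct xs \<and> (\<forall>s. cv = Conv_E s \<longrightarrow> s \<notin> set xs)"

text \<open>
  A total order is a relation \<open>r\<close> with \<open>linear_order_on X r\<close>, and \<open>(x, z) \<in> r\<close> means that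
  \<open>x\<close> is below or equal to \<open>z\<close>. Since \<open>r \<subseteq> X \<times> X\<close>, the set \<open>X\<close> is \<open>Field r\<close>.
\<close>

type_synonym 'a ord_rel = "('a \<times> 'a) set"
type_synonym 'a sample = "('a \<times> bool) set"
type_synonym 'a answer = "('a \<Rightarrow> bool) option"
type_synonym 'a sel_rule = "'a sample \<Rightarrow> 'a ord_rel \<Rightarrow> 'a answer"

definition admissible :: "'a convention \<Rightarrow> 'a list \<Rightarrow> 'a ord_rel \<Rightarrow> bool" where
  "admissible cv xs r \<longleftrightarrow>
     linear_order_on (dom_of cv xs) r \<and>
     (\<forall>s. cv = Conv_E s \<longrightarrow> (\<forall>x\<in>dom_of cv xs. (s, x) \<in> r))"

text \<open>Label vectors on \<open>X\<close> are functions that are \<open>False\<close> outside \<open>X\<close>.\<close>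

definition concept :: "'a ord_rel \<Rightarrow> 'a \<Rightarrow> 'a \<Rightarrow> bool" where
  "concept r z = (\<lambda>x. (x, z) \<in> r)"

definition concepts :: "'a ord_rel \<Rightarrow> ('a \<Rightarrow> bool) set" where
  "concepts r = concept r ` Field r"

definition consistent :: "('a \<Rightarrow> bool) \<Rightarrow> 'a sample \<Rightarrow> bool" where
  "consistent c S \<longleftrightarrow> (\<forall>(x, b)\<in>S. c x = b)"

definition legal_oracle :: "'a ord_rel \<Rightarrow> ('a sample \<Rightarrow> 'a answer) \<Rightarrow> bool" where
  "legal_oracle r Or \<longleftrightarrow> (\<forall>S. S \<subseteq> Field r \<times> UNIV \<longrightarrow>
     (case Or S of
        Some c \<Rightarrow> c \<in> concepts r \<and> consistent c S
      | None \<Rightarrow> \<not> (\<exists>c\<in>concepts r. consistent c S)))"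

definition legal_rule :: "'a convention \<Rightarrow> 'a list \<Rightarrow> 'a sel_rule \<Rightarrow> bool" where
  "legal_rule cv xs R \<longleftrightarrow> (\<forall>r. admissible cv xs r \<longrightarrow> legal_oracle r (\<lambda>S. R S r))"

text \<open>\<open>LEAST\<close> and \<open>GREATEST\<close> refer to the pointwise order on label vectors, that is, to
  inclusion of prefixes.\<close>

definition min_rule :: "'a sel_rule" where
  "min_rule S r =
     (if \<exists>c\<in>concepts r. consistent c S
      then Some (LEAST c. c \<in> concepts r \<and> consistent c S) else None)"

definition max_rule :: "'a sel_rule" where
  "max_rule S r =
     (if \<exists>c\<in>concepts r. consistent c S
      then Some (GREATEST c. c \<in> concepts r \<and> consistent c S) else None)"

definition mixed_rule :: "('a sample \<Rightarrow> bool) \<Rightarrow> 'a sel_rule" where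
  "mixed_rule g S r = (if g S then min_rule S r else max_rule S r)"

definition extremal_rules :: "'a sel_rule set" where
  "extremal_rules = {min_rule, max_rule} \<union> range mixed_rule"

text \<open>
  A deterministic strategy maps the history so far (oracle calls with their answers, predictions
  with the revealed labels) to the next action. A run ends once \<open>length xs\<close> predictions have been
  made. A strategy may keep calling the oracle forever, so calls are counted in \<open>ennreal\<close>.
\<close>

datatype 'a action = Query "'a sample" | Predict bool
datatype 'a event = Answered "'a sample" "'a answer" | Labelled bool bool

type_synonym 'a strategy = "'a event list \<Rightarrow> 'a action"

text \<open>A learner turns the announced sequence (which determines \<open>T\<close> and \<open>X\<close>) into a strategy.\<close>
type_synonym 'a learner = "'a list \<Rightarrow> 'a strategy"

fun is_label :: "'a event \<Rightarrow> bool" where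
  "is_label (Labelled p y) = True"
| "is_label (Answered S a) = False"

fun is_mistake :: "'a event \<Rightarrow> bool" where
  "is_mistake (Labelled p y) = (p \<noteq> y)"
| "is_mistake (Answered S a) = False"

definition rounds :: "'a event list \<Rightarrow> nat" where
  "rounds h = length (filter is_label h)"

primrec hist :: "'a list \<Rightarrow> ('a \<Rightarrow> bool) \<Rightarrow> ('a sample \<Rightarrow> 'a answer) \<Rightarrow> 'a strategy
    \<Rightarrow> nat \<Rightarrow> 'a event list" where
  "hist xs c Or \<sigma> 0 = []"
| "hist xs c Or \<sigma> (Suc n) =
     (let h = hist xs c Or \<sigma> n in
      if rounds h = length xs then h
      else (case \<sigma> h of
              Query S \<Rightarrow> h @ [Answered S (Or S)]
            | Predict p \<Rightarrow> h @ [Labelled p (c (xs ! rounds h))]))"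

text \<open>An instance is \<open>(xs, r, z, R)\<close>: sequence, order, target and selection rule.\<close>
type_synonym 'a inst = "'a list \<times> 'a ord_rel \<times> 'a \<times> 'a sel_rule"

fun mistakes :: "'a learner \<Rightarrow> 'a inst \<Rightarrow> ennreal" where
  "mistakes L (xs, r, z, R) =
     (SUP n. of_nat (length (filter is_mistake
        (hist xs (concept r z) (\<lambda>S. R S r) (L xs) n))))"

fun calls :: "'a learner \<Rightarrow> 'a inst \<Rightarrow> ennreal" where
  "calls L (xs, r, z, R) =
     (SUP n. of_nat (length (filter (\<lambda>e. \<not> is_label e)
        (hist xs (concept r z) (\<lambda>S. R S r) (L xs) n))))"

text \<open>
  \<open>Rs xs\<close> restricts the rules the learner may face on \<open>xs\<close>: a singleton is a pre-declared rule,
  and \<open>\<lambda>_. UNIV\<close> leaves every legal rule possible. The latter is the same as an arbitrary legal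
  oracle for the order \<open>r\<close> of the instance (lemma \<open>legal_oracle_extends\<close> below).
\<close>

definition instances ::
    "'a convention \<Rightarrow> ('a list \<Rightarrow> 'a sel_rule set) \<Rightarrow> nat \<Rightarrow> 'a inst set" where
  "instances cv Rs T = {(xs, r, z, R).
     announceable cv T xs \<and> admissible cv xs r \<and> z \<in> dom_of cv xs \<and>
     legal_rule cv xs R \<and> R \<in> Rs xs}"

abbreviation all_instances :: "'a convention \<Rightarrow> nat \<Rightarrow> 'a inst set" where
  "all_instances cv \<equiv> instances cv (\<lambda>_. UNIV)"

definition det_learner :: "'a convention \<Rightarrow> nat \<Rightarrow> 'a learner \<Rightarrow> bool" where
  "det_learner cv T L \<longleftrightarrow>
     (\<forall>xs h S. announceable cv T xs \<longrightarrow> L xs h = Query S \<longrightarrow> S \<subseteq> dom_of cv xs \<times> UNIV)"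

text \<open>A randomized learner draws a seed from a probability space \<open>M\<close> and then plays a
  deterministic learner; the seed is not available to the instance.\<close>

definition rand_learner ::
    "'a convention \<Rightarrow> nat \<Rightarrow> 'r measure \<Rightarrow> ('r \<Rightarrow> 'a learner) \<Rightarrow> bool" where
  "rand_learner cv T M L \<longleftrightarrow>
     prob_space M \<and> (\<forall>\<omega>\<in>space M. det_learner cv T (L \<omega>)) \<and>
     (\<forall>xs h. announceable cv T xs \<longrightarrow> (\<lambda>\<omega>. L \<omega> xs h) \<in> measurable M (count_space UNIV))"

definition worst_mistakes ::
    "'a convention \<Rightarrow> nat \<Rightarrow> 'r measure \<Rightarrow> ('r \<Rightarrow> 'a learner) \<Rightarrow> ennreal" where
  "worst_mistakes cv T M L = (SUP i\<in>all_instances cv T. \<integral>\<^sup>+ \<omega>. mistakes (L \<omega>) i \<partial>M)"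

definition worst_calls ::
    "'a convention \<Rightarrow> nat \<Rightarrow> 'r measure \<Rightarrow> ('r \<Rightarrow> 'a learner) \<Rightarrow> ennreal" where
  "worst_calls cv T M L = (SUP i\<in>all_instances cv T. \<integral>\<^sup>+ \<omega>. calls (L \<omega>) i \<partial>M)"

text \<open>Landau symbols for \<open>ennreal\<close>-valued functions, since call counts may be infinite.\<close>

definition ebigo :: "(nat \<Rightarrow> ennreal) \<Rightarrow> (nat \<Rightarrow> real) \<Rightarrow> bool" where
  "ebigo f g \<longleftrightarrow> (\<exists>C. \<forall>\<^sub>F T in sequentially. f T \<le> ennreal (C * g T))"

definition ebigomega :: "(nat \<Rightarrow> ennreal) \<Rightarrow> (nat \<Rightarrow> real) \<Rightarrow> bool" where
  "ebigomega f g \<longleftrightarrow> (\<exists>c>0. \<forall>\<^sub>F T in sequentially. ennreal (c * g T) \<le> f T)"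

lemma finite_dom_of [simp]: "finite (dom_of cv xs)"
  by (cases cv) auto

lemma admissible_finite_Field:
  assumes "admissible cv xs r"
  shows "Field r = dom_of cv xs" "finite (Field r)" "Linear_order r"
proof -
  have lin: "linear_order_on (dom_of cv xs) r" using assms by (simp add: admissible_def)
  then show F: "Field r = dom_of cv xs"
    by (auto simp: linear_order_on_def partial_order_on_def preorder_on_def refl_on_def Field_def)
  show "finite (Field r)" by (simp add: F)
  show "Linear_order r" using lin by (simp add: F)
qed

lemma concepts_chain:
  assumes "Linear_order r" "c \<in> concepts r" "d \<in> concepts r"
  shows "c \<le> d \<or> d \<le> c"
proof -
  obtain y z where yz: "y \<in> Field r" "z \<in> Field r" "c = concept r y" "d = concept r z"
    using assms by (auto simp: concepts_def)
  have "(y, z) \<in> r \<or> (z, y) \<in> r"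
    using assms(1) yz(1,2)
    unfolding linear_order_on_def total_on_def partial_order_on_def preorder_on_def refl_on_def
    by metis
  moreover have "trans r"
    using assms(1) by (simp add: linear_order_on_def partial_order_on_def preorder_on_def)
  ultimately show ?thesis
    unfolding yz concept_def le_fun_def le_bool_def by (meson transD)
qed

lemma finite_chain_least_greatest:
  fixes A :: "'b :: order set"
  assumes "finite A" "A \<noteq> {}" "\<And>x y. x \<in> A \<Longrightarrow> y \<in> A \<Longrightarrow> x \<le> y \<or> y \<le> x"
  shows "(LEAST x. x \<in> A) \<in> A" "(GREATEST x. x \<in> A) \<in> A"
proof -
  obtain l where l: "l \<in> A" "\<And>y. y \<in> A \<Longrightarrow> y \<le> l \<Longrightarrow> y = l"
    using finite_has_minimal[OF assms(1,2)] by metis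
  have "(LEAST x. x \<in> A) = l" by (rule Least_equality) (use l assms(3) in metis)+
  with l show "(LEAST x. x \<in> A) \<in> A" by simp
  obtain g where g: "g \<in> A" "\<And>y. y \<in> A \<Longrightarrow> g \<le> y \<Longrightarrow> y = g"
    using finite_has_maximal[OF assms(1,2)] by metis
  have "(GREATEST x. x \<in> A) = g" by (rule Greatest_equality) (use g assms(3) in metis)+
  with g show "(GREATEST x. x \<in> A) \<in> A" by simp
qed

lemma extremal_rules_legal:
  assumes "R \<in> extremal_rules"
  shows "legal_rule cv xs R"
proof -
  have mm: "legal_oracle r (\<lambda>S. min_rule S r)" "legal_oracle r (\<lambda>S. max_rule S r)"
    if a: "admissible cv xs r" for r
  proof -
    have lg: "(LEAST c. c \<in> concepts r \<and> consistent c S) \<in> concepts r \<and>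
              consistent (LEAST c. c \<in> concepts r \<and> consistent c S) S \<and>
              (GREATEST c. c \<in> concepts r \<and> consistent c S) \<in> concepts r \<and>
              consistent (GREATEST c. c \<in> concepts r \<and> consistent c S) S"
      if "\<exists>c\<in>concepts r. consistent c S" for S
    proof -
      let ?A = "{c. c \<in> concepts r \<and> consistent c S}"
      have "finite (concepts r)"
        using admissible_finite_Field[OF a] by (simp add: concepts_def)
      then have "finite ?A" by simp
      moreover have "?A \<noteq> {}" using that by auto
      ultimately show ?thesis
        using finite_chain_least_greatest[of ?A] concepts_chain[OF admissible_finite_Field(3)[OF a]]
        by auto
    qed
    show "legal_oracle r (\<lambda>S. min_rule S r)" "legal_oracle r (\<lambda>S. max_rule S r)"
      using lg by (auto simp: legal_oracle_def min_rule_def max_rule_def)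
  qed
  show ?thesis
    using assms mm
    by (auto simp: extremal_rules_def legal_rule_def mixed_rule_def legal_oracle_def)
qed

lemma legal_oracle_extends:
  assumes "legal_oracle r Or"
  shows "\<exists>R. legal_rule cv xs R \<and> (\<forall>S. R S r = Or S)"
proof (intro exI conjI allI)
  let ?R = "\<lambda>S r'. if r' = r then Or S else min_rule S r'"
  have "legal_rule cv xs min_rule" by (rule extremal_rules_legal) (simp add: extremal_rules_def)
  then have "legal_oracle r' (\<lambda>S. ?R S r')" if "admissible cv xs r'" for r'
    using assms that by (cases "r' = r") (simp_all add: legal_rule_def)
  then show "legal_rule cv xs ?R" by (simp only: legal_rule_def) blast
qed simp

end

(*
  Lower bounds. All orders are given by real keys, the target lying between the negative and the
  positive keys, and an oracle that returns extremal concepts sees only how far from the target the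
  samples reach.

  Against a deterministic learner the keys are chosen lazily: each call or prediction forces at most
  one new element away from the undecided middle, and every prediction on an undecided element is a
  mistake, so (mistakes) + (calls) is at least T - 1.

  Against a randomized learner the order is nested: of a block of k elements, the next level is one
  of the last two thirds (a fair coin decides which), everything else lies outside it, and labels
  are fair coins. Following a call outside in, each level costs a factor of at most 3 in the
  number of elements whose labels are still coins, and a sampled future element stops the descent
  with probability at least 1/4. So a call lowers the logarithm of that number by at most
  4 ln 3 <= 7 ln 2 in expectation, while each coin costs half a mistake.

  Upper bounds. A query {(x, 1), (y, 0)}, or failing that {(y, 1), (x, 0)}, returns a prefix
  separating x and y. Deterministically, all pairs are separated with 2 calls per new prefix, and
  then halving is run. With randomization, a separating prefix of a random pair of undecided
  elements is used for prediction until it errs; then one of its two sides becomes decided, and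
  the number of undecided elements shrinks by a factor of at most 5/6 in expectation.
*)

theory Submission
  imports Defs "HOL-Real_Asymp.Real_Asymp"
begin

section \<open>Orders given by keys\<close>

text \<open>Against a randomized learner a mistake bound constrains only an expectation, while the
  remaining uncertainty is measured by a logarithm. The tangent inequality
  \<open>ln (v / mu) + 1 <= v / mu\<close> joins the two: each mistake gets the linear price
  \<open>2 / mu\<close>, so guessing a coin costs \<open>1 / mu\<close> on average, and
  \<open>mu = 2 * m + 1\<close> is the best point of contact for a mistake bound \<open>m\<close>.
  The sequence is announced, so play uses up positions from the front. This is why the next block is
  taken from the last two thirds of a level: until the first third has been labelled, no element of
  the next level has been seen; after that, the labelled elements account for the logarithm up to
  \<open>ln 3\<close>, and a single call pays for this difference.\<close>

definition key_order :: "'a set \<Rightarrow> ('a \<Rightarrow> nat) \<Rightarrow> ('a \<Rightarrow> real) \<Rightarrow> 'a ord_rel" where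
  "key_order X idx k =
     {(x, y). x \<in> X \<and> y \<in> X \<and> (k x < k y \<or> k x = k y \<and> idx x \<le> idx y)}"

lemma key_order_linear:
  assumes "inj_on idx X"
  shows "linear_order_on X (key_order X idx k)"
  unfolding linear_order_on_def partial_order_on_def preorder_on_def
proof (intro conjI)
  show "refl_on X (key_order X idx k)" by (auto simp: refl_on_def key_order_def)
  show "trans (key_order X idx k)" by (auto simp: trans_def key_order_def)
  show "antisym (key_order X idx k)"
    using assms by (auto simp: antisym_def key_order_def inj_on_def)
  show "total_on X (key_order X idx k)" by (auto simp: total_on_def key_order_def)
qed (auto simp: key_order_def)

lemma Field_key_order [simp]: "Field (key_order X idx k) = X"
  by (auto simp: Field_def key_order_def)

lemma key_order_max:
  assumes "finite Y" "Y \<noteq> {}" "Y \<subseteq> X"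
  shows "\<exists>m\<in>Y. \<forall>y\<in>Y. (y, m) \<in> key_order X idx k"
  using assms
proof (induction Y rule: finite_ne_induct)
    case (singleton x)
    then show ?case by (auto simp: key_order_def)
  next
    case (insert x F)
    then obtain m where m: "m \<in> F" "\<forall>y\<in>F. (y, m) \<in> key_order X idx k" by auto
    show ?case
    proof (cases "(x, m) \<in> key_order X idx k")
      case True
      with m show ?thesis by blast
    next
      case False
      then have "(m, x) \<in> key_order X idx k" "(x, x) \<in> key_order X idx k"
        using m(1) insert.prems by (auto simp: key_order_def)
      moreover have "trans (key_order X idx k)" by (auto simp: trans_def key_order_def)
      ultimately show ?thesis using m(2) by (auto dest: transD)
    qed
qed

definition key_label :: "'a set \<Rightarrow> ('a \<Rightarrow> real) \<Rightarrow> 'a \<Rightarrow> bool" where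
  "key_label X k = (\<lambda>x. x \<in> X \<and> k x < 0)"

text \<open>The prefix of all negative keys ends at its largest element. The element
  \<open>b\<close> keeps this prefix nonempty, since the empty prefix is not a concept.\<close>

lemma key_target:
  assumes "finite X" "b \<in> X" "k b < 0"
  obtains z where "z \<in> X" "concept (key_order X idx k) z = key_label X k"
proof -
  let ?Y = "{x \<in> X. k x < 0}"
  have "finite ?Y" "?Y \<noteq> {}" "?Y \<subseteq> X" using assms by auto
  then obtain z where z: "z \<in> ?Y" "\<And>y. y \<in> ?Y \<Longrightarrow> (y, z) \<in> key_order X idx k"
    using key_order_max[of ?Y X idx k] by auto
  have "concept (key_order X idx k) z = key_label X k"
  proof
    fix x
    show "concept (key_order X idx k) z x = key_label X k x"
      using z(1) z(2)[of x] by (auto simp: concept_def key_label_def key_order_def)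
  qed
  then show thesis using that z(1) by blast
qed

section \<open>Extremal answers ignore the order close to the target\<close>

lemma chain_extrema_cong:
  fixes A B :: "'b :: order set"
  assumes "\<And>a. a \<in> A \<Longrightarrow> \<exists>d\<in>A \<inter> B. d \<le> a" "\<And>a. a \<in> A \<Longrightarrow> \<exists>e\<in>A \<inter> B. a \<le> e"
    and "\<And>b. b \<in> B \<Longrightarrow> \<exists>d\<in>A \<inter> B. d \<le> b" "\<And>b. b \<in> B \<Longrightarrow> \<exists>e\<in>A \<inter> B. b \<le> e"
    and "finite A" "A \<noteq> {}" "\<And>x y. x \<in> A \<Longrightarrow> y \<in> A \<Longrightarrow> x \<le> y \<or> y \<le> x"
  shows "(LEAST x. x \<in> A) = (LEAST x. x \<in> B)" "(GREATEST x. x \<in> A) = (GREATEST x. x \<in> B)"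
proof -
  obtain l where l: "l \<in> A" "\<And>y. y \<in> A \<Longrightarrow> y \<le> l \<Longrightarrow> y = l"
    using finite_has_minimal[OF assms(5,6)] by metis
  have lA: "l \<le> a" if "a \<in> A" for a using l that assms(7) by metis
  have lB: "l \<in> B" "\<And>b. b \<in> B \<Longrightarrow> l \<le> b"
    using assms(1)[OF l(1)] l(2) assms(3) lA by (blast, meson IntE order_trans)
  show "(LEAST x. x \<in> A) = (LEAST x. x \<in> B)"
    using Least_equality[of "\<lambda>x. x \<in> A" l] Least_equality[of "\<lambda>x. x \<in> B" l] l lA lB by simp
  obtain g where g: "g \<in> A" "\<And>y. y \<in> A \<Longrightarrow> g \<le> y \<Longrightarrow> y = g"
    using finite_has_maximal[OF assms(5,6)] by metis
  have gA: "a \<le> g" if "a \<in> A" for a using g that assms(7) by metis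
  have gB: "g \<in> B" "\<And>b. b \<in> B \<Longrightarrow> b \<le> g"
    using assms(2)[OF g(1)] g(2) assms(4) gA by (blast, meson IntE order_trans)
  show "(GREATEST x. x \<in> A) = (GREATEST x. x \<in> B)"
    using Greatest_equality[of "\<lambda>x. x \<in> A" g] Greatest_equality[of "\<lambda>x. x \<in> B" g] g gA gB by simp
qed

text \<open>\<open>M\<close> is an interval around the target in both orders, and the order inside
  it is left open. The gap at \<open>\<theta>\<close> makes comparisons across the border of
  \<open>M\<close> agree.\<close>

definition same_off :: "'a set \<Rightarrow> 'a set \<Rightarrow> real \<Rightarrow> ('a \<Rightarrow> real) \<Rightarrow> ('a \<Rightarrow> real) \<Rightarrow> bool" where
  "same_off X M \<theta> k k' \<longleftrightarrow> M \<subseteq> X \<and>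
     (\<forall>x\<in>X - M. k' x = k x \<and> \<theta> < \<bar>k x\<bar>) \<and> (\<forall>x\<in>M. \<bar>k x\<bar> \<le> \<theta> \<and> \<bar>k' x\<bar> \<le> \<theta>)"

text \<open>The second alternative is a sample point that contradicts the target: a positive key
  labelled \<open>True\<close> pulls all of \<open>M\<close> into every consistent prefix, a
  negative key labelled \<open>False\<close> pushes all of \<open>M\<close> out. In both cases no
  consistent prefix ends inside \<open>M\<close>.\<close>

definition resolved :: "'a set \<Rightarrow> 'a set \<Rightarrow> ('a \<Rightarrow> real) \<Rightarrow> 'a sample \<Rightarrow> bool" where
  "resolved X M k S \<longleftrightarrow> fst ` S \<inter> M = {} \<or>
     (\<exists>x\<in>X - M. (x, True) \<in> S \<and> 0 < k x \<or> (x, False) \<in> S \<and> k x < 0)"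

lemma same_offD:
  assumes "same_off X M \<theta> k k'"
  shows "x \<in> X \<Longrightarrow> x \<notin> M \<Longrightarrow> k' x = k x" "x \<in> X \<Longrightarrow> x \<notin> M \<Longrightarrow> \<theta> < \<bar>k x\<bar>"
    "x \<in> M \<Longrightarrow> \<bar>k x\<bar> \<le> \<theta>" "x \<in> M \<Longrightarrow> \<bar>k' x\<bar> \<le> \<theta>"
  using assms by (auto simp: same_off_def)

lemma same_off_sym: "same_off X M \<theta> k k' \<Longrightarrow> same_off X M \<theta> k' k"
  by (auto simp: same_off_def)

lemma same_off_order:
  assumes "same_off X M \<theta> k k'" "x \<notin> M \<or> y \<notin> M"
  shows "(x, y) \<in> key_order X idx k \<longleftrightarrow> (x, y) \<in> key_order X idx k'"
proof (cases "x \<in> X \<and> y \<in> X")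
  case True
  have *: "u \<in> M \<Longrightarrow> \<bar>k u\<bar> \<le> \<theta> \<and> \<bar>k' u\<bar> \<le> \<theta>" "u \<in> X \<Longrightarrow> u \<notin> M \<Longrightarrow> k' u = k u \<and> \<theta> < \<bar>k u\<bar>" for u
    using assms(1) by (auto simp: same_off_def)
  show ?thesis
    using assms(2) True *[of x] *[of y] by (cases "x \<in> M"; cases "y \<in> M") (auto simp: key_order_def)
qed (auto simp: key_order_def)

lemma inner_concept:
  assumes so: "same_off X M \<theta> k k'" and z: "z \<in> M" and x: "x \<in> X - M"
  shows "concept (key_order X idx k) z x \<longleftrightarrow> k x < 0"
proof -
  have "\<bar>k z\<bar> \<le> \<theta>" "\<theta> < \<bar>k x\<bar>" "z \<in> X" "x \<in> X" using assms by (auto simp: same_off_def)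
  then show ?thesis by (auto simp: concept_def key_order_def)
qed

text \<open>A prefix ending outside \<open>M\<close> belongs to both orders and brackets itself. One
  ending inside \<open>M\<close> can be consistent only if \<open>S\<close> avoids \<open>M\<close>,
  and then it can be shrunk or grown to the borders of \<open>M\<close> without changing a sampled
  label.\<close>

lemma consistent_concepts_bracket:
  assumes so: "same_off X M \<theta> k k'" and fin: "finite X"
    and b: "b \<in> X - M" "k b < 0" and res: "resolved X M k S"
    and a: "a \<in> concepts (key_order X idx k)" "consistent a S"
  defines "D \<equiv> {c \<in> concepts (key_order X idx k) \<inter> concepts (key_order X idx k'). consistent c S}"
  shows "\<exists>d\<in>D. d \<le> a" "\<exists>e\<in>D. a \<le> e"
proof -
  let ?r = "key_order X idx k" and ?r' = "key_order X idx k'"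
  obtain z where z: "z \<in> X" "a = concept ?r z" using a(1) by (auto simp: concepts_def)
  have "(\<exists>d\<in>D. d \<le> a) \<and> (\<exists>e\<in>D. a \<le> e)"
  proof (cases "z \<in> M")
    case False
    then have "a = concept ?r' z" using z(2) same_off_order[OF so] by (auto simp: concept_def)
    then have "a \<in> D" using a z by (auto simp: D_def concepts_def)
    then show ?thesis by blast
  next
    case True
    have off: "a x \<longleftrightarrow> k x < 0" if "x \<in> X - M" for x
      using inner_concept[OF so True that] z(2) by simp
    have "fst ` S \<inter> M = {}"
      using res a(2) off by (fastforce simp: resolved_def consistent_def)
    then have cons: "consistent c S" if "\<And>x. x \<notin> M \<Longrightarrow> c x = a x" for c
      using a(2) that by (force simp: consistent_def)
    have aX: "\<not> a x" if "x \<notin> X" for x using that by (simp add: z concept_def key_order_def)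
    have MX: "M \<subseteq> X" using so by (simp add: same_off_def)
    have both: "concept (key_order X idx l) m = c"
      if m: "m \<in> Y" "\<And>y. y \<in> Y \<Longrightarrow> (y, m) \<in> key_order X idx l"
        and Y: "Y = {x \<in> X. c x}" and down: "\<And>x. x \<in> X \<Longrightarrow> \<not> c x \<Longrightarrow> l m < l x"
        and cX: "\<And>x. x \<notin> X \<Longrightarrow> \<not> c x" for l m c Y
    proof
      fix x
      show "concept (key_order X idx l) m x = c x"
        using m down cX unfolding Y concept_def by (fastforce simp: key_order_def)
    qed
    \<comment> \<open>The prefixes ending just before and just after \<open>M\<close>; neither
      depends on the order inside \<open>M\<close>. The element \<open>b\<close> makes
      \<open>d\<close> nonempty.\<close>
    define d where "d = (\<lambda>x. x \<in> X - M \<and> k x < 0)"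
    define e where "e = (\<lambda>x. x \<in> X \<and> (x \<in> M \<or> k x < 0))"
    have dcon: "d \<in> concepts (key_order X idx l)" if "same_off X M \<theta> l l'" "l = k \<or> l = k'" for l l'
    proof -
      let ?Y = "{x \<in> X. d x}"
      obtain m where m: "m \<in> ?Y" "\<And>y. y \<in> ?Y \<Longrightarrow> (y, m) \<in> key_order X idx l"
        using key_order_max[of ?Y X idx l] fin b by (auto simp: d_def)
      have m': "m \<in> X" "m \<notin> M" "k m < 0" using m(1) by (auto simp: d_def)
      have "\<theta> < \<bar>k m\<bar>" by (rule same_offD(2)[OF so m'(1,2)])
      moreover have lmk: "l m = k m" using same_offD(1)[OF so m'(1,2)] that(2) by auto
      ultimately have lm: "l m < - \<theta>" using m'(3) by simp
      have "l m < l x" if x: "x \<in> X" "\<not> d x" for x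
      proof (cases "x \<in> M")
        case True
        then have "\<bar>l x\<bar> \<le> \<theta>" using so \<open>l = k \<or> l = k'\<close> by (auto simp: same_off_def)
        then show ?thesis using lm by linarith
      next
        case False
        then have "k x \<ge> 0" "l x = k x"
          using same_offD(1)[OF so] \<open>l = k \<or> l = k'\<close> x by (auto simp: d_def not_less)
        then show ?thesis using m'(3) lmk by linarith
      qed
      then have "concept (key_order X idx l) m = d"
        by (intro both[OF m refl]) (auto simp: d_def)
      then show ?thesis using m(1) by (auto simp: concepts_def)
    qed
    have econ: "e \<in> concepts (key_order X idx l)" if "same_off X M \<theta> l l'" "l = k \<or> l = k'" for l l'
    proof -
      obtain m where m: "m \<in> M" "\<And>y. y \<in> M \<Longrightarrow> (y, m) \<in> key_order X idx l"
        using key_order_max[of M X idx l] True MX finite_subset[OF MX fin] by blast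
      have lm: "\<bar>l m\<bar> \<le> \<theta>" using so m(1) that(2) by (auto simp: same_off_def)
      have l: "(l x < 0 \<longleftrightarrow> k x < 0) \<and> \<theta> < \<bar>l x\<bar>" if "x \<in> X - M" for x
        using so that \<open>l = k \<or> l = k'\<close> by (auto simp: same_off_def)
      have "concept (key_order X idx l) m = e"
      proof (rule both[OF _ _ refl])
        show "m \<in> {x \<in> X. e x}" using m(1) MX by (auto simp: e_def)
        show "(y, m) \<in> key_order X idx l" if "y \<in> {x \<in> X. e x}" for y
          using m that lm l[of y] MX by (cases "y \<in> M") (auto simp: e_def key_order_def)
        show "l m < l x" if "x \<in> X" "\<not> e x" for x
          using l[of x] lm that by (auto simp: e_def)
      qed (simp add: e_def)
      then show ?thesis using m(1) MX by (auto simp: concepts_def)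
    qed
    have "d \<in> D" unfolding D_def
      using dcon[OF so] dcon[OF same_off_sym[OF so]] off aX
      by (auto intro!: cons simp: d_def)
    moreover have "e \<in> D" unfolding D_def
      using econ[OF so] econ[OF same_off_sym[OF so]] off aX
      by (auto intro!: cons simp: e_def)
    moreover have "d \<le> a" using off by (auto simp: d_def le_fun_def)
    moreover have "a \<le> e" using off aX by (auto simp: e_def le_fun_def)
    ultimately show ?thesis by blast
  qed
  then show "\<exists>d\<in>D. d \<le> a" "\<exists>e\<in>D. a \<le> e" by auto
qed

text \<open>The consistent prefixes of the two orders may differ, but by bracketing their least and
  greatest members lie in the common part. \<open>mixed_rule\<close> decides between these two by
  \<open>S\<close> alone, hence alike for both orders.\<close>

lemma extremal_rule_cong:
  assumes so: "same_off X M \<theta> k k'" and fin: "finite X" and inj: "inj_on idx X"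
    and b: "b \<in> X - M" "k b < 0" and res: "resolved X M k S"
    and R: "R \<in> extremal_rules"
  shows "R S (key_order X idx k) = R S (key_order X idx k')"
proof -
  define A where "A l = {c. c \<in> concepts (key_order X idx l) \<and> consistent c S}" for l
  have so': "same_off X M \<theta> k' k" by (rule same_off_sym[OF so])
  have b': "k' b < 0" and res': "resolved X M k' S"
    using so b res by (auto simp: same_off_def resolved_def)
  have D: "\<exists>d\<in>A k \<inter> A k'. d \<le> a" "\<exists>e\<in>A k \<inter> A k'. a \<le> e" if "a \<in> A k" for a
    using consistent_concepts_bracket[OF so fin b res, of a idx] that by (auto simp: A_def)
  have D': "\<exists>d\<in>A k \<inter> A k'. d \<le> a" "\<exists>e\<in>A k \<inter> A k'. a \<le> e" if "a \<in> A k'" for a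
    using consistent_concepts_bracket[OF so' fin b(1) b' res', of a idx] that by (auto simp: A_def)
  have emp: "A k = {} \<longleftrightarrow> A k' = {}" using D D' by blast
  have Lk: "Linear_order (key_order X idx k)" using key_order_linear[OF inj, of k] by simp
  have A: "finite (A k)" "\<And>x y. x \<in> A k \<Longrightarrow> y \<in> A k \<Longrightarrow> x \<le> y \<or> y \<le> x"
    using concepts_chain[OF Lk] fin by (simp_all add: A_def concepts_def)
  have "(LEAST x. x \<in> A k) = (LEAST x. x \<in> A k')"
       "(GREATEST x. x \<in> A k) = (GREATEST x. x \<in> A k')" if "A k \<noteq> {}"
    by (rule chain_extrema_cong[OF D D' A(1) that A(2)]; assumption)+
  then have "min_rule S (key_order X idx k) = min_rule S (key_order X idx k')"
    "max_rule S (key_order X idx k) = max_rule S (key_order X idx k')"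
    using emp by (auto simp: min_rule_def max_rule_def A_def)
  then show ?thesis using R by (auto simp: extremal_rules_def mixed_rule_def)
qed

section \<open>Lower bound for deterministic learners\<close>

abbreviation n_calls :: "'a event list \<Rightarrow> nat" where
  "n_calls h \<equiv> length (filter (\<lambda>e. \<not> is_label e) h)"

abbreviation n_mistakes :: "'a event list \<Rightarrow> nat" where
  "n_mistakes h \<equiv> length (filter is_mistake h)"

lemma rounds_simps [simp]:
  "rounds [] = 0" "rounds (h @ [Labelled p y]) = Suc (rounds h)" "rounds (h @ [Answered S a]) = rounds h"
  by (simp_all add: rounds_def)

lemma rounds_plus_calls: "length h = rounds h + n_calls h"
  by (simp add: rounds_def sum_length_filter_compl)

lemma rounds_hist_le: "rounds (hist xs c Or \<sigma> n) \<le> length xs"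
  by (induction n) (auto simp: Let_def split: action.split)

lemma hist_complete_or_long:
  "rounds (hist xs c Or \<sigma> n) = length xs \<or> length (hist xs c Or \<sigma> n) = n"
  by (induction n) (auto simp: Let_def split: action.split)

lemma hist_extends:
  assumes "m \<le> n"
  shows "\<exists>ys. hist xs c Or \<sigma> n = hist xs c Or \<sigma> m @ ys"
  using assms
proof (induction n rule: dec_induct)
  case (step n)
  then show ?case by (auto simp: Let_def split: action.split)
qed simp

lemma mistakes_ge:
  "of_nat (n_mistakes (hist xs (concept r z) (\<lambda>S. R S r) (L xs) n)) \<le> mistakes L (xs, r, z, R)"
  unfolding mistakes.simps by (rule SUP_upper) simp

lemma calls_ge:
  "of_nat (n_calls (hist xs (concept r z) (\<lambda>S. R S r) (L xs) n)) \<le> calls L (xs, r, z, R)"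
  unfolding calls.simps by (rule SUP_upper) simp

lemma ex_announceable:
  fixes cv :: "'a convention"
  assumes "infinite (UNIV :: 'a set)"
  obtains xs where "announceable cv T xs"
proof -
  define N where "N = (case cv of Conv_E s \<Rightarrow> {s} | Conv_N \<Rightarrow> {})"
  have "infinite (- N)" using assms by (auto simp: N_def Compl_eq_Diff_UNIV split: convention.split)
  then obtain A where A: "A \<subseteq> - N" "finite A" "card A = T"
    using infinite_arbitrarily_large by blast
  obtain xs where "set xs = A" "distinct xs" using finite_distinct_list[OF A(2)] by blast
  then have "announceable cv T xs"
    using A by (auto simp: announceable_def N_def distinct_card)
  then show thesis by (rule that)
qed

text \<open>The keys are undecided while they are \<open>0\<close>. Deciding an element at step \<open>n\<close> gives it the
  key \<open>\<plusminus>1/(n+2)\<close>, just outside everything still undecided.\<close>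

lemma lazy_adversary:
  fixes X :: "'a set" and idx :: "'a \<Rightarrow> nat" and xs :: "'a list" and \<sigma> :: "'a strategy"
  assumes fin: "finite X" and inj: "inj_on idx X" and R: "R \<in> extremal_rules"
    and s: "s \<in> X" and xs: "set xs \<subseteq> X"
  defines "H \<equiv> \<lambda>k. hist xs (key_label X k) (\<lambda>S. R S (key_order X idx k)) \<sigma>"
  shows "\<exists>k. k s = -2 \<and> (\<forall>x\<in>X - {s}. \<bar>k x\<bar> \<le> 1) \<and>
    (\<forall>x\<in>X. k x \<noteq> 0 \<longrightarrow> 1 / (real n + 1) \<le> \<bar>k x\<bar>) \<and>
    card {x\<in>X. k x \<noteq> 0} \<le> 1 + n_mistakes (H k n) + n_calls (H k n) \<and>
    (\<forall>i<rounds (H k n). k (xs ! i) \<noteq> 0) \<and>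
    (\<forall>k'. (\<forall>x\<in>X. if k x = 0 then \<bar>k' x\<bar> \<le> 1 / (real n + 2) else k' x = k x) \<longrightarrow> H k' n = H k n)"
proof (induction n)
  case 0
  have "{x \<in> X. (if x = s then -2 else 0::real) \<noteq> 0} = {s}" using s by auto
  then show ?case
    by (intro exI[of _ "\<lambda>x. if x = s then -2 else 0"]) (auto simp: H_def)
next
  case (Suc n)
  then obtain k where ks: "k s = -2" and k1: "\<And>x. x \<in> X - {s} \<Longrightarrow> \<bar>k x\<bar> \<le> 1"
    and kn: "\<And>x. x \<in> X \<Longrightarrow> k x \<noteq> 0 \<Longrightarrow> 1 / (real n + 1) \<le> \<bar>k x\<bar>"
    and kc: "card {x\<in>X. k x \<noteq> 0} \<le> 1 + n_mistakes (H k n) + n_calls (H k n)"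
    and kr: "\<And>i. i < rounds (H k n) \<Longrightarrow> k (xs ! i) \<noteq> 0"
    and kH: "\<And>k'. (\<forall>x\<in>X. if k x = 0 then \<bar>k' x\<bar> \<le> 1 / (real n + 2) else k' x = k x)
       \<Longrightarrow> H k' n = H k n" by blast
  define h where "h = H k n"
  \<comment> \<open>The keys still possible after this step. New keys have size
    \<open>1 / (n + 2)\<close>, so everything left undecided is confined to the smaller radius
    \<open>1 / (n + 3)\<close>.\<close>
  define ext where "ext l k' \<longleftrightarrow>
      (\<forall>x\<in>X. if l x = 0 then \<bar>k' x\<bar> \<le> 1 / (real n + 3) else k' x = l x)" for l k' :: "'a \<Rightarrow> real"
  have step: "1 / (real n + 3) < 1 / (real n + 2)" "1 / (real n + 2) < 1 / (real n + 1)"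
    by (simp_all add: frac_less2)
  have ext_self: "ext l l" for l by (simp add: ext_def)
  \<comment> \<open>Shared by all kinds of step: at most one element \<open>p\<close> is decided,
    \<open>e\<close> charges it to a new call or mistake, and \<open>st\<close> says that the new
    event is the same for every key still possible.\<close>
  have good: ?case
    if l: "l = k \<or> (\<exists>p\<in>X. k p = 0 \<and> (\<exists>b. \<bar>b\<bar> = 1 / (real n + 2) \<and> l = k(p := b)))"
      and e: "l \<noteq> k \<Longrightarrow> 1 + n_mistakes h + n_calls h \<le> n_mistakes (H l (Suc n)) + n_calls (H l (Suc n))"
      and r: "\<And>i. i < rounds (H l (Suc n)) \<Longrightarrow> l (xs ! i) \<noteq> 0"
      and st: "\<And>k'. ext l k' \<Longrightarrow> H k' n = h \<Longrightarrow> H k' (Suc n) = H l (Suc n)" for l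
  proof (intro exI[of _ l] conjI allI impI ballI)
    show "l s = -2" using l ks by auto
    have "1 / (real n + 2) \<le> 1" by simp
    then show "\<bar>l x\<bar> \<le> 1" if "x \<in> X - {s}" for x using l k1[OF that] by auto
    show "1 / (real (Suc n) + 1) \<le> \<bar>l x\<bar>" if "x \<in> X" "l x \<noteq> 0" for x
    proof (cases "l x = k x")
      case True
      with kn[of x] that have "1 / (real n + 1) \<le> \<bar>l x\<bar>" by simp
      then show ?thesis using step by (simp add: add.commute)
    next
      case False
      then show ?thesis using l by (auto simp: fun_upd_def add.commute split: if_splits)
    qed
    have Hl: "H k' n = h" if "ext l k'" for k'
      unfolding h_def
    proof (intro kH ballI)
      fix x assume "x \<in> X"
      then show "if k x = 0 then \<bar>k' x\<bar> \<le> 1 / (real n + 2) else k' x = k x"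
        using that l step by (auto simp: ext_def fun_upd_def split: if_splits)
    qed
    have mono: "n_mistakes h + n_calls h \<le> n_mistakes (H l (Suc n)) + n_calls (H l (Suc n))"
    proof -
      have "\<exists>ys. H l (Suc n) = H l n @ ys" unfolding H_def by (rule hist_extends) simp
      then show ?thesis using Hl[OF ext_self] by auto
    qed
    show "card {x \<in> X. l x \<noteq> 0} \<le> 1 + n_mistakes (H l (Suc n)) + n_calls (H l (Suc n))"
    proof (cases "l = k")
      case True
      then show ?thesis using kc mono by (simp add: h_def)
    next
      case False
      then obtain p b where p: "p \<in> X" "k p = 0" "\<bar>b\<bar> = 1 / (real n + 2)" "l = k(p := b)"
        using l by auto
      then have "b \<noteq> 0" by auto
      with p have "{x \<in> X. l x \<noteq> 0} = insert p {x \<in> X. k x \<noteq> 0}" by auto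
      then have "card {x \<in> X. l x \<noteq> 0} = Suc (card {x \<in> X. k x \<noteq> 0})"
        using p fin by simp
      then show ?thesis using kc e[OF False] by (simp add: h_def)
    qed
    show "l (xs ! i) \<noteq> 0" if "i < rounds (H l (Suc n))" for i by (rule r[OF that])
    show "H k' (Suc n) = H l (Suc n)"
      if "\<forall>x\<in>X. if l x = 0 then \<bar>k' x\<bar> \<le> 1 / (real (Suc n) + 2) else k' x = l x" for k'
    proof -
      have "real (Suc n) + 2 = real n + 3" by simp
      then have "ext l k'" using that by (simp only: ext_def)
      then show ?thesis using st Hl by blast
    qed
  qed
  have Hn: "H k' n = h" if "ext l k'" "l = k \<or> (\<exists>p\<in>X. k p = 0 \<and> (\<exists>b. \<bar>b\<bar> = 1 / (real n + 2) \<and> l = k(p := b)))" for l k'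
    unfolding h_def
  proof (intro kH ballI)
    fix x assume "x \<in> X"
    then show "if k x = 0 then \<bar>k' x\<bar> \<le> 1 / (real n + 2) else k' x = k x"
      using that step by (auto simp: ext_def fun_upd_def split: if_splits)
  qed
  show ?case
  proof (cases "rounds h = length xs")
    case True
    then show ?thesis using kr h_def
      by (intro good[of k]) (auto simp: H_def)
  next
    case run: False
    then have len: "rounds h < length xs"
      using rounds_hist_le[of xs "key_label X k" "\<lambda>S. R S (key_order X idx k)" \<sigma> n]
      by (simp add: h_def H_def)
    show ?thesis
    proof (cases "\<sigma> h")
      case (Query S)
      have suc: "H k' (Suc n) = h @ [Answered S (R S (key_order X idx k'))]" if "H k' n = h" for k'
        using that run Query by (simp add: H_def)
      obtain l where l: "l = k \<or> (\<exists>p\<in>X. k p = 0 \<and> (\<exists>b. \<bar>b\<bar> = 1 / (real n + 2) \<and> l = k(p := b)))"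
        and res: "resolved X {x\<in>X. l x = 0} l S"
      proof (cases "\<exists>p\<in>X. k p = 0 \<and> (\<exists>y. (p, y) \<in> S)")
        case True
        then obtain p y where p: "p \<in> X" "k p = 0" "(p, y) \<in> S" by auto
        \<comment> \<open>The sign makes the target contradict the sampled label \<open>y\<close>,
          so this single decision resolves the whole sample.\<close>
        define b where "b = (if y then 1 else -1) / (real n + 2)"
        define l where "l = k(p := b)"
        have b: "\<bar>b\<bar> = 1 / (real n + 2)" by (simp add: b_def)
        have "0 < 1 / (real n + 2)" by simp
        then have "l p \<noteq> 0" "y \<Longrightarrow> 0 < l p" "\<not> y \<Longrightarrow> l p < 0" by (auto simp: l_def b_def)
        then have "p \<in> X - {x\<in>X. l x = 0} \<and> ((p, True) \<in> S \<and> 0 < l p \<or> (p, False) \<in> S \<and> l p < 0)"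
          using p by (cases y) simp_all
        then have "resolved X {x\<in>X. l x = 0} l S"
          unfolding resolved_def by blast
        then show thesis using that[of l] p b l_def by blast
      next
        case False
        then show thesis using that[of k] by (force simp: resolved_def)
      qed
      have cong: "R S (key_order X idx l) = R S (key_order X idx k')" if "ext l k'" for k'
      proof (rule extremal_rule_cong[OF _ fin inj _ _ res R])
        show "same_off X {x\<in>X. l x = 0} (1 / (real n + 3)) l k'"
          unfolding same_off_def
        proof (intro conjI ballI)
          fix x assume x: "x \<in> X - {x\<in>X. l x = 0}"
          then show "k' x = l x" using that by (auto simp: ext_def)
          show "1 / (real n + 3) < \<bar>l x\<bar>"
          proof (cases "l x = k x")
            case True
            with kn[of x] x have "1 / (real n + 1) \<le> \<bar>l x\<bar>" by simp
            then show ?thesis using step by simp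
          next
            case False
            then have "\<bar>l x\<bar> = 1 / (real n + 2)" using l by (auto simp: fun_upd_def split: if_splits)
            then show ?thesis using step by simp
          qed
        qed (use that in \<open>auto simp: ext_def\<close>)
        have "l s = -2" using l ks by auto
        then show "s \<in> X - {x\<in>X. l x = 0}" "l s < 0" using s by simp_all
      qed
      show ?thesis
      proof (rule good[OF l])
        have Hl: "H l (Suc n) = h @ [Answered S (R S (key_order X idx l))]"
          by (rule suc[OF Hn[OF ext_self l]])
        show "1 + n_mistakes h + n_calls h \<le> n_mistakes (H l (Suc n)) + n_calls (H l (Suc n))"
          by (simp add: Hl)
        show "l (xs ! i) \<noteq> 0" if "i < rounds (H l (Suc n))" for i
          using that kr[of i] l by (auto simp: Hl h_def split: if_splits)
        show "H k' (Suc n) = H l (Suc n)" if "ext l k'" "H k' n = h" for k'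
          using suc[OF that(2)] cong[OF that(1)] Hl by simp
      qed
    next
      case (Predict p)
      let ?x = "xs ! rounds h"
      have suc: "H k' (Suc n) = h @ [Labelled p (key_label X k' ?x)]" if "H k' n = h" for k'
        using that run Predict by (simp add: H_def)
      have x: "?x \<in> X" using len xs by auto
      \<comment> \<open>The sign makes the label the opposite of the prediction \<open>p\<close>; it
        takes effect only if the element is still undecided.\<close>
      define b where "b = (if p then 1 else -1) / (real n + 2)"
      have "0 < 1 / (real n + 2)" by simp
      then have b: "\<bar>b\<bar> = 1 / (real n + 2)" "b \<noteq> 0" "b < 0 \<longleftrightarrow> \<not> p"
        by (auto simp: b_def)
      define l where "l = (if k ?x = 0 then k(?x := b) else k)"
      have l: "l = k \<or> (\<exists>p\<in>X. k p = 0 \<and> (\<exists>b. \<bar>b\<bar> = 1 / (real n + 2) \<and> l = k(p := b)))"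
        using x b(1) unfolding l_def by auto
      have Hl: "H l (Suc n) = h @ [Labelled p (key_label X l ?x)]" by (rule suc[OF Hn[OF ext_self l]])
      have lx: "l ?x \<noteq> 0" using b(2) by (simp add: l_def)
      show ?thesis
      proof (rule good[OF l])
        show "1 + n_mistakes h + n_calls h \<le> n_mistakes (H l (Suc n)) + n_calls (H l (Suc n))"
          if "l \<noteq> k"
        proof -
          have "l ?x = b" using that by (auto simp: l_def)
          then show ?thesis unfolding Hl using x b(3) by (auto simp: key_label_def)
        qed
        show "l (xs ! i) \<noteq> 0" if "i < rounds (H l (Suc n))" for i
          using that kr[of i] lx l by (cases "i = rounds h") (auto simp: Hl h_def split: if_splits)
        show "H k' (Suc n) = H l (Suc n)" if "ext l k'" "H k' n = h" for k'
        proof -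
          have "k' ?x = l ?x" using that(1) x lx by (auto simp: ext_def)
          then show ?thesis using suc[OF that(2)] Hl by (simp add: key_label_def)
        qed
      qed
    qed
  qed
qed

text \<open>A sentinel key below -1, with all other keys between -1 and 1, makes \<open>s\<close>
  the minimum, as convention E demands.\<close>

lemma key_instance:
  assumes fin: "finite X" and inj: "inj_on idx X" and X: "X = dom_of cv xs" and s: "s \<in> X"
    and sE: "\<And>s'. cv = Conv_E s' \<Longrightarrow> s' = s"
    and ann: "announceable cv T xs" and k: "k s < -1" "\<And>x. x \<in> X - {s} \<Longrightarrow> \<bar>k x\<bar> \<le> 1"
    and R: "R \<in> extremal_rules" "R \<in> Rs xs"
  obtains z where "(xs, key_order X idx k, z, R) \<in> instances cv Rs T"
    "concept (key_order X idx k) z = key_label X k"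
proof -
  obtain z where z: "z \<in> X" "concept (key_order X idx k) z = key_label X k"
    using key_target[OF fin s, of k idx] k(1) by auto
  have "admissible cv xs (key_order X idx k)"
    unfolding admissible_def
  proof (intro conjI allI impI ballI)
    show "linear_order_on (dom_of cv xs) (key_order X idx k)"
      using key_order_linear[OF inj] X by simp
    show "(s', x) \<in> key_order X idx k" if "cv = Conv_E s'" "x \<in> dom_of cv xs" for s' x
      using sE[OF that(1)] k(1) k(2)[of x] that(2) s X by (cases "x = s") (auto simp: key_order_def)
  qed
  then have "(xs, key_order X idx k, z, R) \<in> instances cv Rs T"
    using ann z(1) X R extremal_rules_legal[OF R(1)] by (simp add: instances_def)
  then show thesis using z(2) by (rule that)
qed

text \<open>Treats both conventions alike: under N the last element of the sequence takes over the
  role of the sentinel, at the price of one element, which is \<open>eps\<close>. Since it comes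
  last, position \<open>i\<close> of \<open>es\<close> is still presented in round
  \<open>i\<close>.\<close>

lemma convention_sentinel:
  fixes cv :: "'a convention"
  assumes ann: "announceable cv T xs" and T: "T \<ge> 1"
  obtains es s where "distinct es" "s \<notin> set es" "dom_of cv xs = insert s (set es)"
    "xs = es \<or> xs = es @ [s]" "real (length es) = real T - eps cv"
    "\<forall>s'. cv = Conv_E s' \<longrightarrow> s' = s"
proof (cases cv)
  case (Conv_E s)
  with ann show thesis by (intro that[of xs s]) (auto simp: announceable_def)
next
  case Conv_N
  have "xs \<noteq> []" using ann T by (auto simp: announceable_def)
  then obtain es s where xs: "xs = es @ [s]" by (metis append_butlast_last_id)
  with ann Conv_N show thesis by (intro that[of es s]) (auto simp: announceable_def)
qed

text \<open>The assumption \<open>few\<close> bounds the length of every run, so finitely many steps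
  of the lazy adversary decide the whole sequence. The \<open>- 1\<close> is the sentinel, which is
  decided for free.\<close>

lemma det_calls_lower:
  fixes cv :: "'a convention" and L :: "'a learner"
  assumes ann: "announceable cv T xs" and T: "T \<ge> 1"
    and R: "R \<in> extremal_rules" "R \<in> Rs xs"
    and few: "\<And>i. i \<in> instances cv Rs T \<Longrightarrow> calls L i < of_nat T"
  shows "\<exists>i\<in>instances cv Rs T. of_nat (T - 1) \<le> mistakes L i + calls L i"
proof -
  obtain es s where es: "distinct es" "s \<notin> set es" "dom_of cv xs = insert s (set es)"
    "xs = es \<or> xs = es @ [s]" "\<forall>s'. cv = Conv_E s' \<longrightarrow> s' = s"
    by (rule convention_sentinel[OF ann T]) blast
  define X where "X = dom_of cv xs"
  have fin: "finite X" by (simp add: X_def)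
  then obtain idx :: "'a \<Rightarrow> nat" where inj: "inj_on idx X"
    using finite_imp_inj_to_nat_seg by blast
  have s: "s \<in> X" and xsX: "set xs \<subseteq> X" using es by (auto simp: X_def)
  have len: "length xs = T" using ann by (simp add: announceable_def)
  \<comment> \<open>Room for \<open>T\<close> predictions and fewer than \<open>T\<close>
    calls.\<close>
  define n where "n = 2 * T"
  define H where "H k = hist xs (key_label X k) (\<lambda>S. R S (key_order X idx k)) (L xs) n" for k
  obtain k where ks: "k s = -2" and k1: "\<And>x. x \<in> X - {s} \<Longrightarrow> \<bar>k x\<bar> \<le> 1"
    and kc: "card {x\<in>X. k x \<noteq> 0} \<le> 1 + n_mistakes (H k) + n_calls (H k)"
    and kr: "\<And>i. i < rounds (H k) \<Longrightarrow> k (xs ! i) \<noteq> 0"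
    using lazy_adversary[OF fin inj R(1) s xsX, of n "L xs"] unfolding H_def by blast
  obtain z where z: "(xs, key_order X idx k, z, R) \<in> instances cv Rs T"
    "concept (key_order X idx k) z = key_label X k"
    using key_instance[where Rs = Rs and k = k, OF fin inj X_def s es(5)[rule_format] ann _ k1 R] ks by auto
  let ?i = "(xs, key_order X idx k, z, R)"
  have le: "of_nat (n_mistakes (H k)) \<le> mistakes L ?i" "of_nat (n_calls (H k)) \<le> calls L ?i"
    using mistakes_ge[of xs "key_order X idx k" z R L n] calls_ge[of xs "key_order X idx k" z R L n]
    unfolding z(2) H_def by auto
  have "(of_nat (n_calls (H k)) :: ennreal) < of_nat T"
    by (rule order.strict_trans1[OF le(2) few[OF z(1)]])
  then have "n_calls (H k) < T" by simp
  moreover have "rounds (H k) \<le> T" using rounds_hist_le len unfolding H_def by metis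
  moreover have "rounds (H k) = T \<or> length (H k) = n" using hist_complete_or_long len unfolding H_def by metis
  ultimately have "rounds (H k) = T" using rounds_plus_calls[of "H k"] by (auto simp: n_def)
  then have "set xs \<subseteq> {x\<in>X. k x \<noteq> 0}"
    using kr xsX len by (force simp: in_set_conv_nth)
  then have "card (set xs) \<le> card {x\<in>X. k x \<noteq> 0}" using fin by (intro card_mono) auto
  moreover have "card (set xs) = T" using ann by (simp add: announceable_def distinct_card)
  ultimately have "T - 1 \<le> n_mistakes (H k) + n_calls (H k)" using kc by linarith
  then have "(of_nat (T - 1) :: ennreal) \<le> of_nat (n_mistakes (H k)) + of_nat (n_calls (H k))"
    by (simp flip: of_nat_add)
  also have "\<dots> \<le> mistakes L ?i + calls L ?i" using le by (rule add_mono)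
  finally show ?thesis using z(1) by blast
qed

lemma det_calls_Omega:
  fixes cv :: "'a convention" and L :: "'a learner"
  assumes inf: "infinite (UNIV :: 'a set)" and R: "\<And>xs. R xs \<in> extremal_rules" "\<And>xs. R xs \<in> Rs xs"
    and m: "\<forall>\<^sub>F T in sequentially. \<forall>i\<in>instances cv Rs T. mistakes L i \<le> ennreal (C * ln (real T))"
  shows "\<forall>\<^sub>F T in sequentially. \<exists>i\<in>instances cv Rs T. ennreal (1/4 * real T) \<le> calls L i"
proof -
  have "\<forall>\<^sub>F T in sequentially. C * ln (real T) < 1/4 * real T" by real_asymp
  moreover have "\<forall>\<^sub>F T in sequentially. (T::nat) \<ge> 3" by (rule eventually_ge_at_top)
  ultimately show ?thesis using m
  proof eventually_elim
    case (elim T)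
    show ?case
    proof (rule ccontr)
      assume "\<not> ?thesis"
      then have few: "calls L i < ennreal (1/4 * real T)" if "i \<in> instances cv Rs T" for i
        using that by (meson linorder_not_le)
      obtain xs where ann: "announceable cv T xs" by (rule ex_announceable[OF inf])
      have "calls L i < of_nat T" if "i \<in> instances cv Rs T" for i
        using few[OF that] by (rule order.strict_trans2)
          (simp add: ennreal_of_nat_eq_real_of_nat ennreal_leI)
      moreover have "T \<ge> 1" using elim(2) by simp
      ultimately have "\<exists>i\<in>instances cv Rs T. of_nat (T - 1) \<le> mistakes L i + calls L i"
        by (intro det_calls_lower[OF ann _ R]) auto
      then obtain i where i: "i \<in> instances cv Rs T" "of_nat (T - 1) \<le> mistakes L i + calls L i"
        by blast
      have "mistakes L i \<le> ennreal (1/4 * real T)"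
        using elim(3) i(1) elim(1) by (meson ennreal_leI less_imp_le order_trans)
      then have "mistakes L i + calls L i \<le> ennreal (1/4 * real T) + ennreal (1/4 * real T)"
        by (rule add_mono) (rule less_imp_le[OF few[OF i(1)]])
      with i(2) have "ennreal (real (T - 1)) \<le> ennreal (1/4 * real T) + ennreal (1/4 * real T)"
        unfolding ennreal_of_nat_eq_real_of_nat by (rule order_trans)
      also have "\<dots> = ennreal (1/2 * real T)" by (simp flip: ennreal_plus)
      \<comment> \<open>False once \<open>T > 2\<close>, which explains the threshold 3.\<close>
      finally have "real (T - 1) \<le> 1/2 * real T" by simp
      then show False using elim by (simp add: of_nat_diff)
    qed
  qed
qed

section \<open>Nested random orders\<close>

definition avg :: "'c set \<Rightarrow> (('c \<Rightarrow> bool) \<Rightarrow> real) \<Rightarrow> ('c \<Rightarrow> bool) \<Rightarrow> real" where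
  "avg A F f = (\<Sum>B\<in>Pow A. F (\<lambda>c. if c \<in> A then c \<in> B else f c)) / 2 ^ card A"

lemma avg_empty [simp]: "avg {} F f = F f"
  by (simp add: avg_def)

lemma avg_insert:
  assumes "finite A" "x \<notin> A"
  shows "avg (insert x A) F f = (avg A F (f(x := True)) + avg A F (f(x := False))) / 2"
proof -
  let ?e = "\<lambda>A f B c. if c \<in> A then c \<in> B else f c"
  have disj: "Pow A \<inter> insert x ` Pow A = {}" using assms(2) by auto
  have inj: "inj_on (insert x) (Pow A)"
    by (rule inj_onI) (use assms(2) in \<open>metis PowD insert_ident subset_iff\<close>)
  have "(\<Sum>B\<in>Pow (insert x A). F (?e (insert x A) f B)) =
    (\<Sum>B\<in>Pow A. F (?e (insert x A) f B)) + (\<Sum>B\<in>Pow A. F (?e (insert x A) f (insert x B)))"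
    unfolding Pow_insert using disj inj assms(1) by (simp add: sum.union_disjoint sum.reindex)
  also have "(\<Sum>B\<in>Pow A. F (?e (insert x A) f B)) = (\<Sum>B\<in>Pow A. F (?e A (f(x := False)) B))"
    by (intro sum.cong refl arg_cong[where f = F]) (use assms(2) in auto)
  also have "(\<Sum>B\<in>Pow A. F (?e (insert x A) f (insert x B))) = (\<Sum>B\<in>Pow A. F (?e A (f(x := True)) B))"
    by (intro sum.cong refl arg_cong[where f = F]) (use assms(2) in auto)
  finally show ?thesis using assms by (simp add: avg_def field_simps)
qed

lemma avg_ge:
  assumes "finite A" "\<And>g. (\<forall>c. c \<notin> A \<longrightarrow> g c = f c) \<Longrightarrow> v \<le> F g"
  shows "v \<le> avg A F f"
proof -
  have "(\<Sum>B\<in>Pow A. v) \<le> (\<Sum>B\<in>Pow A. F (\<lambda>c. if c \<in> A then c \<in> B else f c))"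
    by (intro sum_mono assms(2)) simp
  then show ?thesis using assms(1) by (simp add: avg_def card_Pow field_simps)
qed

lemma avg_union:
  assumes "finite A" "finite B" "A \<inter> B = {}"
  shows "avg (A \<union> B) F f = avg A (avg B F) f"
  using assms
proof (induction A arbitrary: f rule: finite_induct)
  case (insert x A)
  then show ?case by (simp add: avg_insert)
qed simp

section \<open>Nested blocks of positions\<close>

fun level_size :: "nat \<Rightarrow> nat \<Rightarrow> nat" where
  "level_size K 0 = K"
| "level_size K (Suc l) = level_size K l div 3"

text \<open>Coin \<open>Inl l\<close> selects which of the last two blocks of level \<open>l\<close> is refined further;
  coin \<open>Inr p\<close> is the label of the element at position \<open>p\<close>.\<close>

type_synonym coins = "nat + nat \<Rightarrow> bool"

text \<open>What a level keeps outside both candidate blocks. As sizes are rounded down, it is at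
  least a third of the level, and it comes first in the sequence.\<close>

definition head_size :: "nat \<Rightarrow> nat \<Rightarrow> nat" where
  "head_size K l = level_size K l - 2 * level_size K (Suc l)"

fun level_start :: "nat \<Rightarrow> coins \<Rightarrow> nat \<Rightarrow> nat" where
  "level_start K f 0 = 0"
| "level_start K f (Suc l) = level_start K f l + head_size K l +
     (if f (Inl l) then 0 else level_size K (Suc l))"

definition block :: "nat \<Rightarrow> coins \<Rightarrow> nat \<Rightarrow> nat set" where
  "block K f l = {level_start K f l ..< level_start K f l + level_size K l}"

text \<open>The blocks are nested and eventually empty, so this is the number of blocks containing
  \<open>p\<close>.\<close>

definition depth :: "nat \<Rightarrow> coins \<Rightarrow> nat \<Rightarrow> nat" where
  "depth K f p = (LEAST l. p \<notin> block K f l)"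

lemma finite_block [simp]: "finite (block K f l)"
  by (simp add: block_def)

lemma card_block [simp]: "card (block K f l) = level_size K l"
  by (simp add: block_def)

lemma level_size_split: "level_size K l = head_size K l + 2 * level_size K (Suc l)"
  by (simp add: head_size_def)

lemma block_Suc_tail:
  "block K f (Suc l) \<subseteq> {level_start K f l + head_size K l ..< level_start K f l + level_size K l}"
  using level_size_split[of K l] by (auto simp: block_def)

lemma block_Suc: "block K f (Suc l) \<subseteq> block K f l"
  using block_Suc_tail[of K f l] by (auto simp: block_def)

lemma block_mono: "l \<le> l' \<Longrightarrow> block K f l' \<subseteq> block K f l"
  by (induction l' rule: dec_induct) (use block_Suc in blast)+

lemma block_subset: "block K f l \<subseteq> {..<K}"
  using block_mono[of 0 l K f] by (auto simp: block_def)

lemma level_size_le: "level_size K l \<le> K - l"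
  by (induction l) auto

lemma level_start_cong:
  "(\<And>i. i < l \<Longrightarrow> g (Inl i) = f (Inl i)) \<Longrightarrow> level_start K g l = level_start K f l"
  by (induction l) auto

lemma block_cong: "(\<And>i. i < l \<Longrightarrow> g (Inl i) = f (Inl i)) \<Longrightarrow> block K g l = block K f l"
  using level_start_cong[of l g f K] by (simp add: block_def)

lemma less_depth: "l < depth K f p \<longleftrightarrow> p \<in> block K f l"
proof -
  have "p \<notin> block K f K" using level_size_le[of K K] by (auto simp: block_def)
  then have "p \<notin> block K f (depth K f p)" unfolding depth_def by (rule LeastI)
  then show ?thesis
    using block_mono[of "depth K f p" l K f] not_less_Least[of l "\<lambda>l. p \<notin> block K f l"]
    by (fastforce simp: depth_def not_less)
qed

lemma depth_pos: "p < K \<Longrightarrow> 0 < depth K f p"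
  by (simp add: less_depth block_def)

lemma depth_cong:
  assumes "\<And>i. i < l \<Longrightarrow> g (Inl i) = f (Inl i)" "p \<notin> block K f l"
  shows "depth K g p = depth K f p"
proof -
  have eq: "block K g i = block K f i" if "i \<le> l" for i
    by (rule block_cong) (use assms(1) that in auto)
  have "i < depth K g p \<longleftrightarrow> i < depth K f p" for i
  proof (cases "i \<le> l")
    case False
    then show ?thesis
      using assms(2) eq[of l] block_mono[of l i] by (auto simp: less_depth)
  qed (simp add: less_depth eq)
  then show ?thesis by (meson linorder_neqE_nat less_irrefl)
qed

locale nested_order =
  fixes es xs :: "'a list" and s :: 'a and idx :: "'a \<Rightarrow> nat"
  assumes es: "distinct es" "s \<notin> set es" "xs = es \<or> xs = es @ [s]"
    and idx: "\<And>p. p < length es \<Longrightarrow> idx (es ! p) = p" "idx s = length es"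
begin

abbreviation "K \<equiv> length es"
abbreviation "X \<equiv> insert s (set es)"

text \<open>\<open>1 / depth\<close> places each block nearer to the target than everything outside
  it; the label coin decides the side. All sizes stay within 1, clear of the sentinel at -2.\<close>

definition key :: "coins \<Rightarrow> 'a \<Rightarrow> real" where
  "key f x = (if x = s then -2
     else (if f (Inr (idx x)) then -1 else 1) / real (depth K f (idx x)))"

abbreviation "ordr f \<equiv> key_order X idx (key f)"

abbreviation "core f l \<equiv> (!) es ` block K f l"

lemma inj_idx: "inj_on idx X"
  by (rule inj_on_inverseI[where g = "(!) (es @ [s])"])
    (use idx in \<open>auto simp: in_set_conv_nth nth_append\<close>)

lemma es_ne_s: "p < K \<Longrightarrow> es ! p \<noteq> s"
  using es(2) by (metis nth_mem)

lemma key_es: "p < K \<Longrightarrow> key f (es ! p) = (if f (Inr p) then -1 else 1) / real (depth K f p)"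
  by (simp add: key_def es_ne_s idx)

lemma key_es_neg: "p < K \<Longrightarrow> key f (es ! p) < 0 \<longleftrightarrow> f (Inr p)"
  using depth_pos[of p K f] by (simp add: key_es divide_less_0_iff)

lemma abs_key_es: "p < K \<Longrightarrow> \<bar>key f (es ! p)\<bar> = 1 / real (depth K f p)"
  by (simp add: key_es)

lemma key_le_1: "x \<in> X - {s} \<Longrightarrow> \<bar>key f x\<bar> \<le> 1"
  using depth_pos[of _ K f] by (fastforce simp: in_set_conv_nth abs_key_es divide_le_eq Suc_le_eq)

text \<open>Depth is at most \<open>l\<close> outside the block of level \<open>l\<close> and at
  least \<open>l + 1\<close> inside, so \<open>1 / (l + 1)\<close> separates the two. The outer keys
  are determined by the block choices before level \<open>l\<close> and the outer label
  coins.\<close>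

lemma same_off_inner:
  assumes "\<And>i. i < l \<Longrightarrow> g (Inl i) = f (Inl i)"
    and "\<And>p. p < K \<Longrightarrow> p \<notin> block K f l \<Longrightarrow> g (Inr p) = f (Inr p)"
  shows "same_off X (core f l) (1 / (real l + 1)) (key f) (key g)"
  unfolding same_off_def
proof (intro conjI ballI)
  show "core f l \<subseteq> X" using block_subset[of K f l] by auto
next
  fix x assume x: "x \<in> X - core f l"
  show "key g x = key f x" "1 / (real l + 1) < \<bar>key f x\<bar>"
  proof (atomize(full), cases "x = s")
    case True
    have "1 / (real l + 1) < 2" by (simp add: field_simps)
    then show "key g x = key f x \<and> 1 / (real l + 1) < \<bar>key f x\<bar>" using True by (simp add: key_def)
  next
    case False
    then obtain p where p: "p < K" "x = es ! p" using x by (auto simp: in_set_conv_nth)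
    then have pb: "p \<notin> block K f l" using x by auto
    then have "depth K f p \<le> l" by (simp add: less_depth flip: not_less)
    then have "1 / (real l + 1) < 1 / real (depth K f p)"
      using depth_pos[OF p(1), of f] by (intro divide_strict_left_mono) auto
    then show "key g x = key f x \<and> 1 / (real l + 1) < \<bar>key f x\<bar>"
      using p assms(2)[OF p(1) pb] depth_cong[OF assms(1) pb] by (simp add: key_es abs_key_es)
  qed
next
  fix x assume "x \<in> core f l"
  then obtain p where p: "p \<in> block K f l" "x = es ! p" by auto
  have pK: "p < K" using p block_subset[of K f l] by auto
  have *: "1 / real (depth K f' p) \<le> 1 / (real l + 1)" if "p \<in> block K f' l" for f'
  proof -
    have "l < depth K f' p" using that by (simp add: less_depth)
    then show ?thesis by (intro divide_left_mono) (auto simp: mult_pos_pos)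
  qed
  have "block K g l = block K f l" by (rule block_cong) (rule assms(1))
  then show "\<bar>key f x\<bar> \<le> 1 / (real l + 1)" "\<bar>key g x\<bar> \<le> 1 / (real l + 1)"
    using p *[of f] *[of g] abs_key_es[OF pK] by simp_all
qed

lemma label_es: "p < K \<Longrightarrow> key_label X (key g) (es ! p) = g (Inr p)"
  by (simp add: key_label_def key_es_neg)

lemma label_s: "key_label X (key g) s"
  by (simp add: key_label_def key_def)

end

section \<open>The expected price of play against the nested order\<close>

locale nested_play = nested_order es xs s idx
  for es xs :: "'a list" and s :: 'a and idx :: "'a \<Rightarrow> nat" +
  fixes \<sigma> :: "'a strategy" and N :: nat and mu :: real
  assumes mu: "mu > 0"
begin

abbreviation "H f n \<equiv> hist xs (key_label X (key f)) (\<lambda>S. min_rule S (ordr f)) \<sigma> n"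

text \<open>Meant for a history that may have revealed everything outside the block of level
  \<open>l\<close>, and the labels of the first \<open>t\<close> rounds, but nothing else.\<close>

definition free :: "nat \<Rightarrow> nat \<Rightarrow> coins \<Rightarrow> (nat + nat) set" where
  "free l t f = Inl ` {l..<K} \<union> Inr ` {p \<in> block K f l. t \<le> p}"

definition unseen :: "nat \<Rightarrow> nat \<Rightarrow> coins \<Rightarrow> nat" where
  "unseen l t f = card {p \<in> block K f l. t \<le> p}"

definition seen :: "nat \<Rightarrow> nat \<Rightarrow> coins \<Rightarrow> nat" where
  "seen l t f = card {p \<in> block K f l. p < t}"

text \<open>The history is the same for all values of the free coins, so given the history they are
  still fair. The second conjunct says that the horizon \<open>N\<close> is long enough for every
  continuation.\<close>

definition state :: "nat \<Rightarrow> nat \<Rightarrow> coins \<Rightarrow> 'a event list \<Rightarrow> nat \<Rightarrow> bool" where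
  "state l t f h j \<longleftrightarrow>
     (\<forall>g. (\<forall>c. c \<notin> free l t f \<longrightarrow> g c = f c) \<longrightarrow> H g j = h \<and> rounds (H g N) = length xs)"

definition pay :: "'a event list \<Rightarrow> real" where
  "pay h = 2 / mu * n_mistakes h + 7 * ln 2 * n_calls h"

text \<open>Touches the line \<open>v / mu\<close> from below at \<open>v = mu\<close>; this
  compares a linear price for mistakes with a logarithm.\<close>

definition G :: "real \<Rightarrow> real" where
  "G v = ln (v / mu) + 1"

lemma finite_free [simp]: "finite (free l t f)"
  by (simp add: free_def)

lemma seen_plus_unseen: "seen l t f + unseen l t f = level_size K l"
proof -
  have "block K f l = {p \<in> block K f l. p < t} \<union> {p \<in> block K f l. t \<le> p}" by auto
  then have "card (block K f l) = seen l t f + unseen l t f"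
    unfolding seen_def unseen_def by (subst card_Un_disjoint[symmetric]) auto
  then show ?thesis by simp
qed

lemma not_free [simp]: "i < l \<Longrightarrow> Inl i \<notin> free l t f" "p \<notin> block K f l \<Longrightarrow> Inr p \<notin> free l t f"
  "p < t \<Longrightarrow> Inr p \<notin> free l t f"
  by (auto simp: free_def)

lemma state_sub:
  assumes "state l t f h j" "\<forall>c. c \<notin> free l t f \<longrightarrow> f' c = f c" "free l' t' f' \<subseteq> free l t f"
  shows "state l' t' f' h j"
  using assms unfolding state_def by (metis (full_types) subsetD)

lemma pay_mono:
  assumes "i \<le> j"
  shows "pay (H g i) \<le> pay (H g j)"
proof -
  obtain ys where "H g j = H g i @ ys" using hist_extends[OF assms] by blast
  then show ?thesis using mu by (simp add: pay_def distrib_left)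
qed

lemma G_le: "0 \<le> w \<Longrightarrow> G (w + 1) \<le> (w + 1) / mu"
  using ln_le_minus_one[of "(w + 1) / mu"] mu by (simp add: G_def)

lemma G_drop: "0 < a \<Longrightarrow> 0 < b \<Longrightarrow> a \<le> 3 * b \<Longrightarrow> G a \<le> G b + ln 3"
proof -
  assume "0 < a" "0 < b" "a \<le> 3 * b"
  then have "ln (a / mu) \<le> ln (3 * (b / mu))" using mu by (subst ln_le_cancel_iff) (auto simp: field_simps)
  also have "\<dots> = ln 3 + ln (b / mu)" using mu \<open>0 < b\<close> by (subst ln_mult) auto
  finally show ?thesis by (simp add: G_def)
qed

text \<open>\<open>w\<close> bounds the labelled elements of the block and is kept in a descent,
  where \<open>seen\<close> drops to 0. A coin moves one unit from \<open>unseen\<close> to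
  \<open>w\<close>: the argument of \<open>G\<close> stays, and the linear term loses
  \<open>1 / mu\<close>, exactly the expected price of the guess. At the end of play
  \<open>unseen\<close> is 0, and by \<open>G_le\<close> the remaining terms are at most 0.\<close>

definition value_bound :: "nat \<Rightarrow> bool" where
  "value_bound j \<longleftrightarrow> (\<forall>l f h w. state l (rounds h) f h j \<longrightarrow> real (seen l (rounds h) f) \<le> w \<longrightarrow>
     pay h - (w + 1) / mu + G (w + 1 + unseen l (rounds h) f)
       \<le> avg (free l (rounds h) f) (\<lambda>g. pay (H g N)) f)"

lemma seven_ln2: "4 * ln 3 \<le> 7 * ln (2::real)"
proof -
  have "4 * ln (3::real) = ln (3 ^ 4)" by (subst ln_realpow) auto
  also have "\<dots> \<le> ln (2 ^ 7)" by (subst ln_le_cancel_iff) auto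
  also have "\<dots> = 7 * ln 2" by (subst ln_realpow) auto
  finally show ?thesis .
qed

lemma step_Query:
  assumes "H g j = h" "rounds h < length xs" "\<sigma> h = Query S"
  shows "H g (Suc j) = h @ [Answered S (min_rule S (ordr g))]"
  using assms by simp

lemma step_Predict:
  assumes "H g j = h" "rounds h < length xs" "\<sigma> h = Predict p"
  shows "H g (Suc j) = h @ [Labelled p (key_label X (key g) (xs ! rounds h))]"
  using assms by simp

text \<open>One level with \<open>c = ln 3\<close>: averaging over the two choices loses
  \<open>3 * c\<close>, shrinking the block loses one more \<open>c\<close>, and the total
  \<open>4 * c\<close> is just the loss that was allowed for the next level.\<close>

lemma average_descent:
  fixes b c a a' v u x y :: real
  shows "2 * b - 6 * c \<le> a + a' \<Longrightarrow> v = (a + a') / 2 \<Longrightarrow> u \<le> y + c \<Longrightarrow> b = x + y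
    \<Longrightarrow> x + u - 4 * c \<le> v"
  by simp

text \<open>The descent stops at a sampled element that turns out to lie in the level just revealed, with
  a label contradicting the sample.\<close>

lemma query_value:
  assumes next_step: "value_bound (Suc j)"
    and st: "state l (rounds h) f h j" and run: "rounds h < length xs" and q: "\<sigma> h = Query S"
    and t: "rounds h \<le> level_start K f l + head_size K l"
    and w: "real (seen l (rounds h) f) \<le> w"
  shows "pay h + 7 * ln 2 - (w + 1) / mu + G (w + 1 + unseen l (rounds h) f)
       - (if resolved X (core f l) (key f) S then 0 else 4 * ln 3)
     \<le> avg (free l (rounds h) f) (\<lambda>g. pay (H g N)) f"
  using st t w
proof (induction "level_size K l" arbitrary: l f rule: less_induct)
  case less
  define t where "t = rounds h"
  let ?P = "\<lambda>g. pay (H g N)"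
  note st = less.prems(1)[folded t_def] and t = less.prems(2)[folded t_def]
    and w = less.prems(3)[folded t_def]
  have w0: "0 \<le> w" using w by linarith
  have stD: "H g j = h" if "\<forall>c. c \<notin> free l t f \<longrightarrow> g c = f c" for g
    using st that by (auto simp: state_def)
  show ?case unfolding t_def[symmetric]
  proof (cases "resolved X (core f l) (key f) S")
    case True
    define a where "a = min_rule S (ordr f)"
    have "state l t f (h @ [Answered S a]) (Suc j)"
      unfolding state_def
    proof (intro allI impI conjI)
      fix g assume g: "\<forall>c. c \<notin> free l t f \<longrightarrow> g c = f c"
      \<comment> \<open>The free coins change keys only inside \<open>core f l\<close>, and
        \<open>S\<close> is resolved there, so the answer reveals none of them.\<close>
      have "min_rule S (ordr f) = min_rule S (ordr g)"
      proof (rule extremal_rule_cong[OF same_off_inner _ inj_idx _ _ True])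
        show "s \<in> X - core f l" using es_ne_s block_subset[of K f l] by fastforce
      qed (use g in \<open>simp_all add: extremal_rules_def key_def\<close>)
      then show "H g (Suc j) = h @ [Answered S a]"
        unfolding step_Query[OF stD[OF g] run q] a_def by simp
      show "rounds (H g N) = length xs" using st g by (auto simp: state_def)
    qed
    then have "pay (h @ [Answered S a]) - (w + 1) / mu + G (w + 1 + unseen l t f) \<le> avg (free l t f) ?P f"
      using next_step[unfolded value_bound_def, rule_format, of l "h @ [Answered S a]" f w] w
      by (simp add: t_def)
    moreover have "pay (h @ [Answered S a]) = pay h + 7 * ln 2" by (simp add: pay_def algebra_simps)
    ultimately show "pay h + 7 * ln 2 - (w + 1) / mu + G (w + 1 + unseen l t f)
       - (if resolved X (core f l) (key f) S then 0 else 4 * ln 3) \<le> avg (free l t f) ?P f"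
      using True by simp
  next
    case False
    then have "fst ` S \<inter> core f l \<noteq> {}" by (auto simp: resolved_def)
    then have ne: "0 < level_size K l" by (cases "level_size K l") (auto simp: block_def)
    then have lK: "l < K" using level_size_le[of K l] by linarith
    \<comment> \<open>The bound one level deeper without a penalty: the new block is completely
      unseen, and \<open>w\<close> is kept.\<close>
    define base where "base = pay h + 7 * ln 2 - (w + 1) / mu + G (w + 1 + level_size K (Suc l))"
    define A where "A = Inl ` {Suc l..<K} \<union> Inr ` {p \<in> block K f l. t \<le> p}"
    have freeA: "free l t f = insert (Inl l) A" "Inl l \<notin> A" "finite A"
      using lK by (auto simp: free_def A_def)
    define F where "F b = f(Inl l := b)" for b
    define nb where "nb b = block K (F b) (Suc l)" for b
    \<comment> \<open>Label coins of the elements that the choice \<open>b\<close> discards; they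
      are revealed together with \<open>b\<close>.\<close>
    define Rv where "Rv b = (Inr ` {p \<in> block K f l - nb b. t \<le> p} :: (nat + nat) set)" for b
    have nb: "nb b = {level_start K f l + head_size K l + (if b then 0 else level_size K (Suc l)) ..<
        level_start K f l + head_size K l + (if b then 0 else level_size K (Suc l)) + level_size K (Suc l)}" for b
    proof -
      have "level_start K (F b) l = level_start K f l"
        by (rule level_start_cong) (simp add: F_def)
      then show ?thesis by (simp add: nb_def block_def F_def)
    qed
    \<comment> \<open>By hypothesis no element beyond the head of the level has been presented, so
      both candidate blocks still have free labels only.\<close>
    have nbt: "nb b \<subseteq> {p \<in> block K f l. t \<le> p}" for b
      using t level_size_split[of K l] by (auto simp: nb block_def)
    have freeS: "free (Suc l) t g = Inl ` {Suc l..<K} \<union> Inr ` nb b" "block K g (Suc l) = nb b"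
      if "\<And>i. i \<le> l \<Longrightarrow> g (Inl i) = F b (Inl i)" for g b
    proof -
      show "block K g (Suc l) = nb b" unfolding nb_def by (rule block_cong) (use that in auto)
      then show "free (Suc l) t g = Inl ` {Suc l..<K} \<union> Inr ` nb b"
        using nbt[of b] by (auto simp: free_def)
    qed
    have split: "A = Rv b \<union> (Inl ` {Suc l..<K} \<union> Inr ` nb b)"
        "Rv b \<inter> (Inl ` {Suc l..<K} \<union> Inr ` nb b) = {}" "finite (Rv b)" for b
      using nbt[of b] by (auto simp: A_def Rv_def)
    let ?in = "\<lambda>b. avg (Inl ` {Suc l..<K} \<union> Inr ` nb b) ?P"
    have avgA: "avg A ?P (F b) = avg (Rv b) (?in b) (F b)" for b
    proof -
      have "finite (nb b)" by (simp add: nb_def)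
      then show ?thesis
        unfolding split(1)[of b] by (intro avg_union split) simp
    qed
    have inner: "base - (if resolved X (core g (Suc l)) (key g) S then 0 else 4 * ln 3) \<le> ?in b g"
      if g: "\<forall>c. c \<notin> Rv b \<longrightarrow> g c = F b c" for g b
    proof -
      have gl: "g (Inl i) = F b (Inl i)" for i using g by (auto simp: Rv_def)
      have fr: "free (Suc l) t g = Inl ` {Suc l..<K} \<union> Inr ` nb b" "block K g (Suc l) = nb b"
        by (rule freeS; rule gl)+
      have "state (Suc l) t g h j"
      proof (rule state_sub[OF st])
        show "\<forall>c. c \<notin> free l t f \<longrightarrow> g c = f c"
          using g split(1)[of b] unfolding freeA(1) by (auto simp: F_def)
        show "free (Suc l) t g \<subseteq> free l t f" using split(1)[of b] unfolding fr freeA(1) by auto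
      qed
      moreover have "seen (Suc l) t g = 0" "unseen (Suc l) t g = level_size K (Suc l)"
      proof -
        have "{p \<in> block K g (Suc l). p < t} = {}" unfolding fr using nbt[of b] by auto
        then show "seen (Suc l) t g = 0" by (simp add: seen_def)
        then show "unseen (Suc l) t g = level_size K (Suc l)"
          using seen_plus_unseen[of "Suc l" t g] by simp
      qed
      moreover have "t \<le> level_start K g (Suc l) + head_size K (Suc l)"
      proof -
        have "level_start K g l = level_start K f l"
          by (rule level_start_cong) (simp add: F_def gl)
        then show ?thesis using t by simp
      qed
      moreover have "level_size K (Suc l) < level_size K l" using ne by simp
      ultimately show ?thesis
        using less.hyps[of "Suc l" g] w0 unfolding base_def t_def[symmetric] fr(1) by simp
    qed
    have inner_all: "base - 4 * ln 3 \<le> ?in b g" if "\<forall>c. c \<notin> Rv b \<longrightarrow> g c = F b c" for g b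
    proof -
      have "(if resolved X (core g (Suc l)) (key g) S then 0 else 4 * ln 3) \<le> 4 * ln (3::real)" by simp
      then show ?thesis using inner[OF that] by linarith
    qed
    have all: "base - 4 * ln 3 \<le> avg A ?P (F b)" for b
      unfolding avgA by (rule avg_ge[OF split(3)]) (rule inner_all)
    \<comment> \<open>The choice of block that contains a sampled \<open>x\<close> may lose
      \<open>4 * ln 3\<close>. The other choice leaves \<open>x\<close> outside, where its label
      coin contradicts the sample half the time, so it loses at most \<open>2 * ln 3\<close> on
      average.\<close>
    have "2 * base - 6 * ln 3 \<le> avg A ?P (F True) + avg A ?P (F False)"
    proof (cases "\<exists>b x. x \<in> nb b \<and> es ! x \<in> fst ` S")
      case False
      have "base \<le> avg A ?P (F b)" for b
        unfolding avgA
      proof (rule avg_ge[OF split(3)])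
        fix g assume g: "\<forall>c. c \<notin> Rv b \<longrightarrow> g c = F b c"
        then have blk: "block K g (Suc l) = nb b" by (intro freeS(2)) (auto simp: Rv_def)
        have "x \<notin> fst ` S" if "x \<in> core g (Suc l)" for x
          using that False unfolding blk by (elim imageE) metis
        then have "fst ` S \<inter> core g (Suc l) = {}" by (simp only: disjoint_iff) metis
        then have "resolved X (core g (Suc l)) (key g) S" unfolding resolved_def ..
        then show "base \<le> ?in b g" using inner[OF g] by simp
      qed
      from this[of True] this[of False] ln_ge_zero[of "3::real"] show ?thesis by linarith
    next
      case True
      then obtain b0 x y where x: "x \<in> nb b0" "(es ! x, y) \<in> S" by force
      define b where "b = (\<not> b0)"
      have xb: "x \<notin> nb b" using x(1) by (auto simp: b_def nb)
      have xf: "x \<in> block K f l" "t \<le> x" using x(1) nbt[of b0] by auto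
      have xK: "x < K" using xf block_subset[of K f l] by auto
      define R' where "R' = Rv b - {Inr x}"
      have R': "Rv b = insert (Inr x) R'" "Inr x \<notin> R'" "finite R'"
        using xf xb split(3)[of b] by (auto simp: R'_def Rv_def)
      have good: "base \<le> avg R' (?in b) ((F b)(Inr x := \<not> y))"
      proof (rule avg_ge[OF R'(3)])
        fix g assume g: "\<forall>c. c \<notin> R' \<longrightarrow> g c = ((F b)(Inr x := \<not> y)) c"
        have g': "\<forall>c. c \<notin> Rv b \<longrightarrow> g c = F b c" using g R' by auto
        then have blk: "block K g (Suc l) = nb b" by (intro freeS(2)) (auto simp: Rv_def)
        have gx: "g (Inr x) = (\<not> y)" using g R'(2) by simp
        have "es ! x \<notin> core g (Suc l)"
          using xb xK es(1) block_subset[of K g "Suc l"] unfolding blk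
          by (auto simp: nth_eq_iff_index_eq)
        then have off: "es ! x \<in> X - core g (Suc l)" using xK by simp
        have neg: "key g (es ! x) < 0 \<longleftrightarrow> \<not> y" using key_es_neg[OF xK, of g] gx by simp
        have "key g (es ! x) \<noteq> 0" using depth_pos[OF xK, of g] by (simp add: key_es[OF xK])
        then have "0 < key g (es ! x) \<longleftrightarrow> y" using neg by linarith
        then have "(es ! x, True) \<in> S \<and> 0 < key g (es ! x) \<or> (es ! x, False) \<in> S \<and> key g (es ! x) < 0"
          using neg x(2) by (cases y) simp_all
        then have "resolved X (core g (Suc l)) (key g) S"
          unfolding resolved_def using off by (intro disjI2) (rule bexI)
        then show "base \<le> ?in b g" using inner[OF g'] by simp
      qed
      have bad: "base - 4 * ln 3 \<le> avg R' (?in b) ((F b)(Inr x := y))"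
      proof (rule avg_ge[OF R'(3)])
        fix g assume g: "\<forall>c. c \<notin> R' \<longrightarrow> g c = ((F b)(Inr x := y)) c"
        then show "base - 4 * ln 3 \<le> ?in b g" using R' by (intro inner_all) auto
      qed
      have "avg A ?P (F b) = (avg R' (?in b) ((F b)(Inr x := True)) + avg R' (?in b) ((F b)(Inr x := False))) / 2"
        unfolding avgA R'(1) by (rule avg_insert[OF R'(3,2)])
      then have "base - 2 * ln 3 \<le> avg A ?P (F b)" using good bad by (cases y) simp_all
      moreover have "base - 4 * ln 3 \<le> avg A ?P (F b0)" by (rule all)
      ultimately show ?thesis unfolding b_def by (cases b0) simp_all
    qed
    moreover have "avg (free l t f) ?P f = (avg A ?P (F True) + avg A ?P (F False)) / 2"
      unfolding freeA(1) F_def by (rule avg_insert[OF freeA(3,2)])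
    moreover have "G (w + 1 + unseen l t f) \<le> G (w + 1 + level_size K (Suc l)) + ln 3"
    proof (rule G_drop)
      have "unseen l t f \<le> level_size K l" using seen_plus_unseen[of l t f] by simp
      \<comment> \<open>The rounding loss 2 is absorbed by the \<open>+ 1\<close> beside
        \<open>w\<close>, since \<open>w + 3 <= 3 * (w + 1)\<close>.\<close>
      also have "\<dots> \<le> 3 * level_size K (Suc l) + 2" by simp
      finally have "real (unseen l t f) \<le> real (3 * level_size K (Suc l) + 2)" by (rule of_nat_mono)
      then show "w + 1 + real (unseen l t f) \<le> 3 * (w + 1 + real (level_size K (Suc l)))"
        using w0 by simp
    qed (use w0 in auto)
    ultimately show "pay h + 7 * ln 2 - (w + 1) / mu + G (w + 1 + unseen l t f)
       - (if resolved X (core f l) (key f) S then 0 else 4 * ln 3) \<le> avg (free l t f) ?P f"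
      unfolding if_not_P[OF False] by (rule average_descent[OF _ _ _ base_def])
  qed
qed


text \<open>Here \<open>e\<close> is \<open>1 / mu\<close>: exactly one of the two labels is a
  mistake, which adds \<open>2 * e\<close> to the sum of both prices and so \<open>e\<close> to
  their mean, the amount by which the linear term grows from \<open>W'\<close> to
  \<open>W\<close>.\<close>

lemma average_coin:
  fixes a a' e g p p' q v W W' :: real
  shows "p - W + g \<le> a \<Longrightarrow> p' - W + g \<le> a' \<Longrightarrow> v = (a + a') / 2 \<Longrightarrow> p + p' = 2 * q + 2 * e
    \<Longrightarrow> W = W' + e \<Longrightarrow> q - W' + g \<le> v"
  by simp

lemma length_xs: "K \<le> length xs" "t < K \<Longrightarrow> xs ! t = es ! t" "K \<le> t \<Longrightarrow> t < length xs \<Longrightarrow> xs ! t = s"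
  using es(3) by (auto simp: nth_append)

lemma finished_value:
  assumes "state l (rounds h) f h j" "j \<le> N" "rounds h = length xs" "0 \<le> w"
  shows "pay h - (w + 1) / mu + G (w + 1 + unseen l (rounds h) f)
    \<le> avg (free l (rounds h) f) (\<lambda>g. pay (H g N)) f"
proof -
  have "{p \<in> block K f l. rounds h \<le> p} = {}"
    using block_subset[of K f l] assms(3) length_xs(1) by auto
  then have "unseen l (rounds h) f = 0" by (simp add: unseen_def)
  moreover have "pay h \<le> avg (free l (rounds h) f) (\<lambda>g. pay (H g N)) f"
    using assms(1) pay_mono[OF assms(2)] by (intro avg_ge) (auto simp: state_def)
  ultimately show ?thesis using G_le[OF assms(4)] by simp
qed

lemma value_bound_step:
  assumes IH: "value_bound (Suc j)" and j: "j < N"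
  shows "value_bound j"
  unfolding value_bound_def
proof (intro allI impI)
  fix l f h w
  assume st: "state l (rounds h) f h j" and w: "real (seen l (rounds h) f) \<le> w"
  define t where "t = rounds h"
  let ?P = "\<lambda>g. pay (H g N)"
  have w0: "0 \<le> w" using w by linarith
  have stD: "H g j = h" "rounds (H g N) = length xs" if "\<forall>c. c \<notin> free l t f \<longrightarrow> g c = f c" for g
    using st that by (auto simp: state_def t_def)
  have sub: "state l (Suc t) f' h' (Suc j)"
    if "\<forall>c. c \<notin> free l t f \<longrightarrow> f' c = f c" "free l (Suc t) f' \<subseteq> free l t f"
      "\<And>g. \<forall>c. c \<notin> free l (Suc t) f' \<longrightarrow> g c = f' c \<Longrightarrow> H g (Suc j) = h'" for f' h'
    unfolding state_def
  proof (intro allI impI conjI)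
    fix g assume g: "\<forall>c. c \<notin> free l (Suc t) f' \<longrightarrow> g c = f' c"
    show "H g (Suc j) = h'" by (rule that(3)[OF g])
    have "g c = f c" if "c \<notin> free l t f" for c
    proof -
      have "c \<notin> free l (Suc t) f'" using \<open>free l (Suc t) f' \<subseteq> free l t f\<close> that by blast
      then show ?thesis using g \<open>\<forall>c. c \<notin> free l t f \<longrightarrow> f' c = f c\<close> that by metis
    qed
    then have "\<forall>c. c \<notin> free l t f \<longrightarrow> g c = f c" by blast
    then show "rounds (H g N) = length xs" by (rule stD(2))
  qed
  show "pay h - (w + 1) / mu + G (w + 1 + unseen l (rounds h) f)
       \<le> avg (free l (rounds h) f) ?P f"
  proof (cases "rounds h = length xs")
    case True
    then show ?thesis using finished_value st j w0 by auto
  next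
    case False
    moreover have "H f j = h" by (rule stD) simp
    ultimately have run: "rounds h < length xs"
      using rounds_hist_le[of xs "key_label X (key f)" "\<lambda>S. min_rule S (ordr f)" \<sigma> j] by simp
    show ?thesis
    proof (cases "\<sigma> h")
      case (Query S)
      show ?thesis
      proof (cases "rounds h \<le> level_start K f l + head_size K l")
        case True
        have "pay h + 7 * ln 2 - (w + 1) / mu + G (w + 1 + unseen l (rounds h) f)
          - (if resolved X (core f l) (key f) S then 0 else 4 * ln 3) \<le> avg (free l (rounds h) f) ?P f"
          by (rule query_value[OF IH st run Query True w])
        moreover have "(if resolved X (core f l) (key f) S then 0 else 4 * ln 3) \<le> 4 * ln (3::real)" by simp
        ultimately show ?thesis using seven_ln2 by linarith
      next
        case False
        \<comment> \<open>The whole head has been labelled, so \<open>unseen\<close> is at most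
          twice \<open>w\<close>, and \<open>G\<close> exceeds its final value
          \<open>G (w + 1)\<close> by at most \<open>ln 3\<close>. The call being made pays for
          that, whatever happens later.\<close>
        have "pay h + 7 * ln 2 \<le> avg (free l t f) ?P f"
        proof (rule avg_ge)
          fix g assume "\<forall>c. c \<notin> free l t f \<longrightarrow> g c = f c"
          then have "H g (Suc j) = h @ [Answered S (min_rule S (ordr g))]"
            using step_Query[OF stD(1) run Query] by simp
          then have "pay h + 7 * ln 2 = pay (H g (Suc j))" by (simp add: pay_def algebra_simps)
          also have "\<dots> \<le> pay (H g N)" using j by (intro pay_mono) simp
          finally show "pay h + 7 * ln 2 \<le> pay (H g N)" .
        qed simp
        moreover have "G (w + 1 + unseen l t f) \<le> G (w + 1) + ln 3"
        proof (rule G_drop)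
          have "{level_start K f l..<level_start K f l + head_size K l} \<subseteq> {p \<in> block K f l. p < t}"
            using False level_size_split[of K l] by (auto simp: block_def t_def)
          then have "card {level_start K f l..<level_start K f l + head_size K l} \<le> seen l t f"
            unfolding seen_def by (intro card_mono) auto
          then have "head_size K l \<le> seen l t f" by simp
          moreover have "level_size K (Suc l) \<le> head_size K l" by (simp add: head_size_def)
          ultimately have "unseen l t f \<le> 2 * seen l t f"
            using seen_plus_unseen[of l t f] level_size_split[of K l] by linarith
          then have "real (unseen l t f) \<le> real (2 * seen l t f)" by (rule of_nat_mono)
          then show "w + 1 + real (unseen l t f) \<le> 3 * (w + 1)" using w by (simp add: t_def)
        qed (use w0 in auto)
        moreover have "ln 3 \<le> 7 * ln (2::real)"
          using seven_ln2 ln_ge_zero[of "3::real"] by linarith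
        ultimately show ?thesis using G_le[OF w0] unfolding t_def by linarith
      qed
    next
      case (Predict p)
      show ?thesis
      proof (cases "t \<in> block K f l")
        case True
        then have tK: "t < K" using block_subset[of K f l] by auto
        define A where "A = free l (Suc t) f"
        have free: "free l t f = insert (Inr t) A" "Inr t \<notin> A" "finite A"
          using True by (auto simp: A_def free_def)
        have fr: "free l (Suc t) (f(Inr t := b)) = A" "block K (f(Inr t := b)) l = block K f l" for b
        proof -
          show "block K (f(Inr t := b)) l = block K f l" by (rule block_cong) simp
          then show "free l (Suc t) (f(Inr t := b)) = A" by (simp add: A_def free_def)
        qed
        have "{p \<in> block K f l. t \<le> p} = insert t {p \<in> block K f l. Suc t \<le> p}"
          using True by auto
        then have un: "unseen l t f = Suc (unseen l (Suc t) (f(Inr t := b)))" for b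
          unfolding unseen_def fr by simp
        have "{p \<in> block K f l. p < Suc t} = insert t {p \<in> block K f l. p < t}"
          using True by auto
        then have se: "seen l (Suc t) (f(Inr t := b)) = Suc (seen l t f)" for b
          unfolding seen_def fr by simp
        have half: "pay (h @ [Labelled p b]) - (w + 2) / mu + G (w + 1 + unseen l t f)
            \<le> avg A ?P (f(Inr t := b))" for b
        proof -
          have "state l (Suc t) (f(Inr t := b)) (h @ [Labelled p b]) (Suc j)"
          proof (rule sub)
            fix g assume g: "\<forall>c. c \<notin> free l (Suc t) (f(Inr t := b)) \<longrightarrow> g c = (f(Inr t := b)) c"
            then have "\<forall>c. c \<notin> free l t f \<longrightarrow> g c = f c" unfolding fr free(1) by auto
            then have "H g j = h" by (rule stD)
            moreover have "key_label X (key g) (xs ! t) = b"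
              using g free(2) tK unfolding fr by (simp add: length_xs label_es)
            ultimately show "H g (Suc j) = h @ [Labelled p b]"
              using step_Predict[OF _ run Predict] by (simp add: t_def)
          qed (auto simp: fr free(1))
          then have "state l (rounds (h @ [Labelled p b])) (f(Inr t := b)) (h @ [Labelled p b]) (Suc j)"
            unfolding rounds_simps t_def[symmetric] .
          moreover have "real (seen l (rounds (h @ [Labelled p b])) (f(Inr t := b))) \<le> w + 1"
            using w unfolding rounds_simps t_def[symmetric] se by simp
          ultimately have "pay (h @ [Labelled p b]) - (w + 1 + 1) / mu
              + G (w + 1 + 1 + unseen l (rounds (h @ [Labelled p b])) (f(Inr t := b)))
            \<le> avg (free l (rounds (h @ [Labelled p b])) (f(Inr t := b))) ?P (f(Inr t := b))"
            by (rule IH[unfolded value_bound_def, rule_format])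
          then have "pay (h @ [Labelled p b]) - (w + 1 + 1) / mu
              + G (w + 1 + 1 + unseen l (Suc t) (f(Inr t := b))) \<le> avg A ?P (f(Inr t := b))"
            unfolding rounds_simps t_def[symmetric] fr .
          moreover have "w + 1 + 1 + real (unseen l (Suc t) (f(Inr t := b))) = w + 1 + unseen l t f"
            by (simp add: un[of b])
          moreover have "w + 1 + 1 = w + 2" by simp
          ultimately show ?thesis by (simp only:)
        qed
        have av: "avg (free l t f) ?P f = (avg A ?P (f(Inr t := True)) + avg A ?P (f(Inr t := False))) / 2"
          unfolding free(1) by (rule avg_insert[OF free(3,2)])
        have pp: "pay (h @ [Labelled p True]) + pay (h @ [Labelled p False]) = 2 * pay h + 2 * (1 / mu)"
          by (cases p) (simp_all add: pay_def algebra_simps add_divide_distrib)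
        have ww: "(w + 2) / mu = (w + 1) / mu + 1 / mu" by (simp add: add_divide_distrib)
        show ?thesis
          unfolding t_def[symmetric] by (rule average_coin[OF half[of True] half[of False] av pp ww])
      next
        case False
        \<comment> \<open>The element presented is the sentinel or lies outside the block, so its
          label is already fixed and the state merely moves on to the next round.\<close>
        define y where "y = key_label X (key f) (xs ! t)"
        have lab: "key_label X (key g) (xs ! t) = y" if "\<forall>c. c \<notin> free l t f \<longrightarrow> g c = f c" for g
        proof (cases "t < K")
          case True
          have "Inr t \<notin> free l t f" using False by simp
          then show ?thesis using that True by (simp add: y_def length_xs label_es)
        next
          case False
          then show ?thesis using run by (simp add: y_def length_xs label_s t_def)
        qed
        have "{p \<in> block K f l. Suc t \<le> p} = {p \<in> block K f l. t \<le> p}"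
          "{p \<in> block K f l. p < Suc t} = {p \<in> block K f l. p < t}"
          using False by (auto simp: Suc_le_eq order_le_less less_Suc_eq)
        then have eq: "free l (Suc t) f = free l t f" "unseen l (Suc t) f = unseen l t f"
          "seen l (Suc t) f = seen l t f"
          unfolding free_def unseen_def seen_def by simp_all
        have "state l (Suc t) f (h @ [Labelled p y]) (Suc j)"
        proof (rule sub)
          fix g assume "\<forall>c. c \<notin> free l (Suc t) f \<longrightarrow> g c = f c"
          then have g: "\<forall>c. c \<notin> free l t f \<longrightarrow> g c = f c" unfolding eq .
          show "H g (Suc j) = h @ [Labelled p y]"
            using step_Predict[OF stD(1)[OF g] run Predict] lab[OF g] by (simp add: t_def)
        qed (simp_all add: eq)
        then have "pay (h @ [Labelled p y]) - (w + 1) / mu + G (w + 1 + unseen l t f)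
            \<le> avg (free l t f) ?P f"
          using IH[unfolded value_bound_def, rule_format, of l "h @ [Labelled p y]" f w] w
          by (simp flip: t_def add: eq)
        moreover have "pay h \<le> pay (h @ [Labelled p y])" using mu by (simp add: pay_def divide_right_mono)
        ultimately show ?thesis unfolding t_def by linarith
      qed
    qed
  qed
qed

lemma value_bound_all: "j \<le> N \<Longrightarrow> value_bound j"
proof (induction rule: inc_induct)
  case base
  show ?case unfolding value_bound_def
  proof (intro allI impI)
    fix l f h w
    assume st: "state l (rounds h) f h N" and w: "real (seen l (rounds h) f) \<le> w"
    have "rounds h = length xs" using st by (auto simp: state_def)
    then show "pay h - (w + 1) / mu + G (w + 1 + unseen l (rounds h) f)
       \<le> avg (free l (rounds h) f) (\<lambda>g. pay (H g N)) f"
      using finished_value[OF st, of w] w by simp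
  qed
next
  case (step j)
  then show ?case using value_bound_step by blast
qed

lemma average_pay_ge:
  assumes "\<And>g. \<forall>c. c \<notin> Inl ` {..<K} \<union> Inr ` {..<K} \<longrightarrow> g c = f c \<Longrightarrow> rounds (H g N) = length xs"
  shows "G (real K + 1) - 1 / mu \<le> avg (Inl ` {..<K} \<union> Inr ` {..<K}) (\<lambda>g. pay (H g N)) f"
proof -
  have fr: "free 0 0 f = Inl ` {..<K} \<union> Inr ` {..<K}"
    by (auto simp: free_def block_def)
  have "state 0 (rounds []) f [] 0" using assms unfolding state_def rounds_simps fr by auto
  moreover have "seen 0 0 f = 0" "unseen 0 0 f = K" by (auto simp: seen_def unseen_def block_def)
  ultimately show ?thesis
    using value_bound_all[of 0, unfolded value_bound_def, rule_format, of 0 "[]" f 0] fr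
    by (simp add: pay_def add.commute)
qed

end

section \<open>Lower bound for randomized learners\<close>

lemma hist_finished_if_few_calls:
  assumes "length xs + b < n" "n_calls (hist xs c Or \<sigma> n) \<le> b"
  shows "rounds (hist xs c Or \<sigma> n) = length xs"
  using hist_complete_or_long[of xs c Or \<sigma> n] rounds_hist_le[of xs c Or \<sigma> n]
    rounds_plus_calls[of "hist xs c Or \<sigma> n"] assms by linarith

lemma ennreal_lincomb:
  "0 \<le> a \<Longrightarrow> 0 \<le> b \<Longrightarrow> 0 \<le> x \<Longrightarrow> 0 \<le> y \<Longrightarrow>
    ennreal (a * x + b * y) = ennreal a * ennreal x + ennreal b * ennreal y"
  by (simp add: ennreal_mult)

text \<open>A hard distribution: the indices \<open>B\<close> are the sets of coins that come up \<open>True\<close>.\<close>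

lemma hard_instances:
  fixes cv :: "'a convention"
  assumes ann: "announceable cv T xs" and T: "T \<ge> 1"
  shows "\<exists>(J :: (nat + nat) set set) r z. finite J \<and> J \<noteq> {} \<and> (\<forall>B\<in>J. (xs, r B, z B, min_rule) \<in> all_instances cv T) \<and>
    (\<forall>(L :: 'a learner) mu. mu > 0 \<longrightarrow>
      ennreal (real (card J) * (ln ((real T + 1 - eps cv) / mu) + 1 - 1 / mu))
      \<le> (\<Sum>B\<in>J. ennreal (2 / mu) * mistakes L (xs, r B, z B, min_rule)
            + ennreal (7 * ln 2) * calls L (xs, r B, z B, min_rule)))"
proof -
  obtain es s where dec: "distinct es" "s \<notin> set es" "dom_of cv xs = insert s (set es)"
    "xs = es \<or> xs = es @ [s]" "real (length es) = real T - eps cv"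
    "\<forall>s'. cv = Conv_E s' \<longrightarrow> s' = s"
    by (rule convention_sentinel[OF ann T])
  define idx where "idx = inv_into {..length es} ((!) (es @ [s]))"
  have inj: "inj_on ((!) (es @ [s])) {..length es}"
    using dec(1,2) by (intro inj_on_nth) auto
  have idx_nth: "idx ((es @ [s]) ! p) = p" if "p \<le> length es" for p
    unfolding idx_def by (rule inv_into_f_f[OF inj]) (use that in simp)
  interpret nested_order es xs s idx
  proof
    show "idx (es ! p) = p" if "p < length es" for p
      using idx_nth[of p] that by (simp add: nth_append)
    show "idx s = length es" using idx_nth[of "length es"] by simp
  qed (use dec in auto)
  define C where "C = (Inl ` {..<length es} \<union> Inr ` {..<length es} :: (nat + nat) set)"
  define cf where "cf B = (\<lambda>c. c \<in> B)" for B :: "(nat + nat) set"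
  have "\<exists>z. (xs, ordr (cf B), z, min_rule) \<in> all_instances cv T \<and>
      concept (ordr (cf B)) z = key_label X (key (cf B))" for B
  proof -
    have ks: "key (cf B) s < -1" by (simp add: key_def)
    show ?thesis
      by (rule key_instance[where Rs = "\<lambda>_. UNIV" and R = min_rule and k = "key (cf B)",
          OF _ inj_idx dec(3)[symmetric] _ dec(6)[rule_format] ann ks key_le_1])
        (auto simp: extremal_rules_def)
  qed
  then obtain z where z: "(xs, ordr (cf B), z B, min_rule) \<in> all_instances cv T"
    "concept (ordr (cf B)) (z B) = key_label X (key (cf B))" for B by metis
  show ?thesis
  proof (intro exI[of _ "Pow C"] exI[of _ "\<lambda>B. ordr (cf B)"] exI[of _ z] conjI ballI allI impI)
    show "finite (Pow C)" "Pow C \<noteq> {}" by (auto simp: C_def)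
    show "(xs, ordr (cf B), z B, min_rule) \<in> all_instances cv T" for B by (rule z)
    fix L :: "'a learner" and mu :: real assume mu: "mu > 0"
    let ?i = "\<lambda>B. (xs, ordr (cf B), z B, min_rule)"
    show "ennreal (real (card (Pow C)) * (ln ((real T + 1 - eps cv) / mu) + 1 - 1 / mu))
      \<le> (\<Sum>B\<in>Pow C. ennreal (2 / mu) * mistakes L (?i B) + ennreal (7 * ln 2) * calls L (?i B))"
    \<comment> \<open>Infinitely many calls on one instance make the right-hand side infinite.
      Otherwise the finitely many instances share a horizon \<open>N\<close> at which every run is
      finished.\<close>
    proof (cases "\<exists>B\<in>Pow C. calls L (?i B) = \<top>")
      case True
      then obtain B where B: "B \<in> Pow C" "calls L (?i B) = \<top>" by blast
      have "\<top> = ennreal (2 / mu) * mistakes L (?i B) + ennreal (7 * ln 2) * calls L (?i B)"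
        using B(2) by (simp add: ennreal_mult_top del: calls.simps mistakes.simps)
      also have "\<dots> \<le> (\<Sum>B\<in>Pow C. ennreal (2 / mu) * mistakes L (?i B) + ennreal (7 * ln 2) * calls L (?i B))"
        by (rule member_le_sum[OF B(1)]) (auto simp: C_def)
      finally show ?thesis by (simp add: top_unique)
    next
      case False
      have "\<exists>b. calls L (?i B) \<le> of_nat b" if "B \<in> Pow C" for B
        using False that by (metis ennreal_Ex_less_of_nat less_imp_le top.not_eq_extremum)
      then obtain b where b: "\<And>B. B \<in> Pow C \<Longrightarrow> calls L (?i B) \<le> of_nat (b B)" by metis
      define N where "N = Suc (length xs + (\<Sum>B\<in>Pow C. b B))"
      interpret nested_play es xs s idx "L xs" N mu by unfold_locales (rule mu)
      have Cfin: "finite C" by (simp add: C_def)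
      have obs: "of_nat (n_calls (H (cf B) N)) \<le> calls L (?i B)"
          "of_nat (n_mistakes (H (cf B) N)) \<le> mistakes L (?i B)" for B
        using calls_ge[of xs "ordr (cf B)" "z B" min_rule L N]
          mistakes_ge[of xs "ordr (cf B)" "z B" min_rule L N] unfolding z(2) by auto
      have fin_run: "rounds (H (cf B) N) = length xs" if "B \<in> Pow C" for B
      proof (rule hist_finished_if_few_calls)
        have "(of_nat (n_calls (H (cf B) N)) :: ennreal) \<le> of_nat (b B)"
          using obs(1) b[OF that] by (rule order_trans)
        then show "n_calls (H (cf B) N) \<le> b B" by simp
        have "b B \<le> (\<Sum>B\<in>Pow C. b B)" by (rule member_le_sum[OF that]) (use Cfin in auto)
        then show "length xs + b B < N" by (simp add: N_def)
      qed
      have "G (real (length es) + 1) - 1 / mu \<le> avg C (\<lambda>g. pay (H g N)) (\<lambda>_. False)"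
        unfolding C_def
      proof (rule average_pay_ge, fold C_def)
        fix g :: coins assume g: "\<forall>c. c \<notin> C \<longrightarrow> g c = False"
        define B where "B = {c. g c}"
        have "cf B = g" by (simp add: cf_def B_def)
        moreover have "B \<in> Pow C" using g by (auto simp: B_def)
        ultimately show "rounds (H g N) = length xs" using fin_run[of B] by simp
      qed
      also have "avg C (\<lambda>g. pay (H g N)) (\<lambda>_. False) = (\<Sum>B\<in>Pow C. pay (H (cf B) N)) / 2 ^ card C"
        unfolding avg_def
        by (intro arg_cong2[where f = "(/)"] sum.cong refl arg_cong[where f = "\<lambda>g. pay (H g N)"])
          (auto simp: cf_def)
      finally have "real (card (Pow C)) * (G (real (length es) + 1) - 1 / mu) \<le> (\<Sum>B\<in>Pow C. pay (H (cf B) N))"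
        using Cfin by (simp add: card_Pow field_simps)
      then have "ennreal (real (card (Pow C)) * (G (real (length es) + 1) - 1 / mu))
          \<le> ennreal (\<Sum>B\<in>Pow C. pay (H (cf B) N))"
        by (rule ennreal_leI)
      also have "\<dots> = (\<Sum>B\<in>Pow C. ennreal (pay (H (cf B) N)))"
        using mu by (intro sum_ennreal[symmetric]) (simp add: pay_def)
      also have "\<dots> \<le> (\<Sum>B\<in>Pow C. ennreal (2 / mu) * mistakes L (?i B) + ennreal (7 * ln 2) * calls L (?i B))"
      proof (rule sum_mono)
        fix B
        have "ennreal (pay (H (cf B) N)) =
            ennreal (2 / mu) * of_nat (n_mistakes (H (cf B) N)) + ennreal (7 * ln 2) * of_nat (n_calls (H (cf B) N))"
          unfolding pay_def ennreal_of_nat_eq_real_of_nat using mu by (intro ennreal_lincomb) auto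
        also have "\<dots> \<le> ennreal (2 / mu) * mistakes L (?i B) + ennreal (7 * ln 2) * calls L (?i B)"
          by (intro add_mono mult_left_mono obs) auto
        finally show "ennreal (pay (H (cf B) N))
          \<le> ennreal (2 / mu) * mistakes L (?i B) + ennreal (7 * ln 2) * calls L (?i B)" .
      qed
      finally show ?thesis using dec(5) by (simp add: G_def algebra_simps del: calls.simps mistakes.simps)
    qed
  qed
qed

text \<open>Legal samples form a finite set, so the history after \<open>n\<close> steps takes
  finitely many values, and the random next action can be composed with it measurably.\<close>

lemma finite_hist_range:
  assumes L: "rand_learner cv T M L" and ann: "announceable cv T xs"
  shows "\<exists>I. finite I \<and> (\<lambda>\<omega>. hist xs c Or (L \<omega> xs) n) \<in> measurable M (count_space I)"
proof (induction n)
  case 0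
  show ?case by (intro exI[of _ "{[]}"]) auto
next
  case (Suc n)
  then obtain I where I: "finite I" "(\<lambda>\<omega>. hist xs c Or (L \<omega> xs) n) \<in> measurable M (count_space I)"
    by blast
  define D where "D = dom_of cv xs \<times> (UNIV :: bool set)"
  define Act where "Act = Query ` Pow D \<union> range Predict"
  define nxt where "nxt h a = (if rounds h = length xs then h else case a of
      Query S \<Rightarrow> h @ [Answered S (Or S)] | Predict p \<Rightarrow> h @ [Labelled p (c (xs ! rounds h))])" for h a
  define I' where "I' = (\<lambda>(h, a). nxt h a) ` (I \<times> Act)"
  have fin: "finite Act" "finite I'" using I(1) by (auto simp: Act_def I'_def D_def)
  have act: "L \<omega> xs h \<in> Act" if "\<omega> \<in> space M" for \<omega> h
  proof (cases "L \<omega> xs h")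
    case (Query S)
    have "det_learner cv T (L \<omega>)" using L that by (simp add: rand_learner_def)
    then have "S \<subseteq> D" using ann Query by (auto simp: det_learner_def D_def)
    then show ?thesis using Query by (auto simp: Act_def)
  qed (simp add: Act_def)
  have Lm: "(\<lambda>\<omega>. L \<omega> xs h) \<in> measurable M (count_space UNIV)" for h
    using L ann by (simp add: rand_learner_def)
  have "(\<lambda>\<omega>. nxt h (L \<omega> xs h)) \<in> measurable M (count_space I')" if "h \<in> I" for h
  proof -
    have "(\<lambda>\<omega>. nxt h (L \<omega> xs h)) \<in> measurable M (count_space UNIV)"
      using Lm by (rule measurable_compose) simp
    then have "(\<lambda>\<omega>. nxt h (L \<omega> xs h)) -` {a} \<inter> space M \<in> sets M" for a
      by (rule measurable_sets) simp
    moreover have "nxt h (L \<omega> xs h) \<in> I'" if "\<omega> \<in> space M" for \<omega>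
      using act[OF that, of h] \<open>h \<in> I\<close> unfolding I'_def by (intro image_eqI[of _ _ "(h, L \<omega> xs h)"]) auto
    ultimately show ?thesis unfolding measurable_count_space_eq2[OF fin(2)] by blast
  qed
  then have "(\<lambda>\<omega>. nxt (hist xs c Or (L \<omega> xs) n) (L \<omega> xs (hist xs c Or (L \<omega> xs) n)))
      \<in> measurable M (count_space I')"
    by (rule measurable_compose_countable'[OF _ I(2)]) (use I(1) countable_finite in blast)+
  moreover have "hist xs c Or (L \<omega> xs) (Suc n) =
      nxt (hist xs c Or (L \<omega> xs) n) (L \<omega> xs (hist xs c Or (L \<omega> xs) n))" for \<omega>
    by (simp add: nxt_def Let_def)
  ultimately show ?case using fin(2) by auto
qed

lemma borel_measurable_counts:
  assumes L: "rand_learner cv T M L" and i: "(xs, r, z, R) \<in> instances cv Rs T"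
  shows "(\<lambda>\<omega>. mistakes (L \<omega>) (xs, r, z, R)) \<in> borel_measurable M"
    "(\<lambda>\<omega>. calls (L \<omega>) (xs, r, z, R)) \<in> borel_measurable M"
proof -
  have ann: "announceable cv T xs" using i by (simp add: instances_def)
  have "(\<lambda>\<omega>. of_nat (F (hist xs (concept r z) (\<lambda>S. R S r) (L \<omega> xs) n)) :: ennreal) \<in> borel_measurable M"
    for F n
  proof -
    obtain I where "(\<lambda>\<omega>. hist xs (concept r z) (\<lambda>S. R S r) (L \<omega> xs) n) \<in> measurable M (count_space I)"
      using finite_hist_range[OF L ann] by blast
    then show ?thesis by (rule measurable_compose) simp
  qed
  then show "(\<lambda>\<omega>. mistakes (L \<omega>) (xs, r, z, R)) \<in> borel_measurable M"
    "(\<lambda>\<omega>. calls (L \<omega>) (xs, r, z, R)) \<in> borel_measurable M"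
    unfolding mistakes.simps calls.simps by (auto intro!: borel_measurable_SUP)
qed

text \<open>The hard family depends only on the sequence, so its inequality holds for every seed and
  may be integrated; the worst-case expectations then bound each summand. This is the averaging
  principle of Yao.\<close>

lemma rand_calls_lower:
  fixes cv :: "'a convention"
  assumes inf: "infinite (UNIV :: 'a set)" and T: "T \<ge> 1" and L: "rand_learner cv T M L"
    and m: "0 \<le> m" "worst_mistakes cv T M L \<le> ennreal m"
  shows "ennreal ((ln (real T + 1 - eps cv) - ln (2 * m + 1)) / (7 * ln 2)) \<le> worst_calls cv T M L"
proof (cases "worst_calls cv T M L = \<top>")
  case False
  then obtain q where q: "0 \<le> q" "worst_calls cv T M L = ennreal q" by (metis ennreal_cases)
  obtain xs where ann: "announceable cv T xs" by (rule ex_announceable[OF inf])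
  obtain J :: "(nat + nat) set set" and r z where hard: "finite J \<and> J \<noteq> {} \<and> (\<forall>B\<in>J. (xs, r B, z B, min_rule) \<in> all_instances cv T) \<and>
    (\<forall>(L :: 'a learner) mu. mu > 0 \<longrightarrow>
      ennreal (real (card J) * (ln ((real T + 1 - eps cv) / mu) + 1 - 1 / mu))
      \<le> (\<Sum>B\<in>J. ennreal (2 / mu) * mistakes L (xs, r B, z B, min_rule)
            + ennreal (7 * ln 2) * calls L (xs, r B, z B, min_rule)))"
    using hard_instances[OF ann T] by blast
  note J = hard[THEN conjunct1] hard[THEN conjunct2, THEN conjunct1]
    and inst = hard[THEN conjunct2, THEN conjunct2, THEN conjunct1, rule_format]
    and hard = hard[THEN conjunct2, THEN conjunct2, THEN conjunct2, rule_format]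
  let ?i = "\<lambda>B. (xs, r B, z B, min_rule)"
  \<comment> \<open>Maximizes \<open>- ln mu - (2 * m + 1) / mu\<close>, the part of the bound that
    depends on \<open>mu\<close>. With this value \<open>2 / mu * m = 1 - 1 / mu\<close>, and the
    constants cancel.\<close>
  define mu where "mu = 2 * m + 1"
  have mu: "mu > 0" using m(1) by (simp add: mu_def)
  define c where "c = ln ((real T + 1 - eps cv) / mu) + 1 - 1 / mu"
  interpret prob_space M using L by (simp add: rand_learner_def)
  have "ennreal (real (card J) * c) = (\<integral>\<^sup>+ \<omega>. ennreal (real (card J) * c) \<partial>M)"
    by (simp add: emeasure_space_1)
  also have "\<dots> \<le> (\<integral>\<^sup>+ \<omega>. (\<Sum>B\<in>J. ennreal (2 / mu) * mistakes (L \<omega>) (?i B)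
            + ennreal (7 * ln 2) * calls (L \<omega>) (?i B)) \<partial>M)"
    unfolding c_def by (intro nn_integral_mono hard mu)
  also have "\<dots> = (\<Sum>B\<in>J. ennreal (2 / mu) * (\<integral>\<^sup>+ \<omega>. mistakes (L \<omega>) (?i B) \<partial>M)
            + ennreal (7 * ln 2) * (\<integral>\<^sup>+ \<omega>. calls (L \<omega>) (?i B) \<partial>M))"
  proof -
    note [measurable] = borel_measurable_counts[OF L inst]
    show ?thesis
      by (subst nn_integral_sum) (auto simp: nn_integral_add nn_integral_cmult
          simp del: mistakes.simps calls.simps intro!: sum.cong)
  qed
  also have "\<dots> \<le> (\<Sum>B\<in>J. ennreal (2 / mu) * ennreal m + ennreal (7 * ln 2) * ennreal q)"
  proof (intro sum_mono add_mono mult_left_mono)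
    fix B assume B: "B \<in> J"
    show "(\<integral>\<^sup>+ \<omega>. mistakes (L \<omega>) (?i B) \<partial>M) \<le> ennreal m"
      using m(2) unfolding worst_mistakes_def by (rule order_trans[OF SUP_upper[OF inst[OF B]]])
    show "(\<integral>\<^sup>+ \<omega>. calls (L \<omega>) (?i B) \<partial>M) \<le> ennreal q"
      unfolding q(2)[symmetric] worst_calls_def by (rule SUP_upper[OF inst[OF B]])
  qed auto
  also have "\<dots> = (\<Sum>B\<in>J. ennreal (2 / mu * m + 7 * ln 2 * q))"
    using m(1) q(1) mu by (subst ennreal_lincomb) auto
  also have "\<dots> = ennreal (real (card J) * (2 / mu * m + 7 * ln 2 * q))"
    using m(1) q(1) mu by (simp add: ennreal_mult ennreal_of_nat_eq_real_of_nat)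
  finally have "real (card J) * c \<le> real (card J) * (2 / mu * m + 7 * ln 2 * q)"
    using m(1) q(1) mu by (subst (asm) ennreal_le_iff) auto
  moreover have "0 < real (card J)" using J by (simp add: card_gt_0_iff)
  ultimately have "c \<le> 2 / mu * m + 7 * ln 2 * q" by simp
  moreover have "2 / mu * m = 1 - 1 / mu" using mu by (simp add: mu_def field_simps)
  ultimately have "ln ((real T + 1 - eps cv) / mu) \<le> 7 * ln 2 * q" by (simp add: c_def)
  moreover have "0 < real T + 1 - eps cv" using T by (cases cv) auto
  ultimately have "ln (real T + 1 - eps cv) - ln (2 * m + 1) \<le> 7 * ln 2 * q"
    using mu by (simp add: ln_div mu_def)
  then have "(ln (real T + 1 - eps cv) - ln (2 * m + 1)) / (7 * ln 2) \<le> q"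
    by (simp add: field_simps)
  then show ?thesis unfolding q(2) by (rule ennreal_leI)
qed simp

lemma rand_calls_Omega:
  fixes cv :: "'a convention"
  assumes inf: "infinite (UNIV :: 'a set)" and L: "\<And>T. T \<ge> 1 \<Longrightarrow> rand_learner cv T (M T) L"
    and m: "ebigo (\<lambda>T. worst_mistakes cv T (M T) L) (\<lambda>T. ln (real T) powr d)"
  shows "ebigomega (\<lambda>T. worst_calls cv T (M T) L) (\<lambda>T. ln (real T))"
proof -
  obtain C where C: "\<forall>\<^sub>F T in sequentially. worst_mistakes cv T (M T) L \<le> ennreal (C * ln (real T) powr d)"
    using m by (auto simp: ebigo_def)
  \<comment> \<open>Raising both constants to at least 1 makes them positive and, once
    \<open>1 <= ln (real T)\<close>, only weakens the mistake bound. The logarithm of a power of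
    \<open>ln T\<close> is eventually at most half of \<open>ln T\<close>; this half gives the 14
    below.\<close>
  define C' where "C' = max C 1"
  define d' where "d' = max d 1"
  have pos: "C' > 0" "d' > 0" by (simp_all add: C'_def d'_def)
  then have "\<forall>\<^sub>F T in sequentially. ln (2 * (C' * ln (real T) powr d') + 1) \<le> 1/2 * ln (real T)"
    by real_asymp
  moreover have "\<forall>\<^sub>F T in sequentially. 1 \<le> ln (real T)" by real_asymp
  moreover have "\<forall>\<^sub>F T in sequentially. (T::nat) \<ge> 1" by (rule eventually_ge_at_top)
  ultimately have "\<forall>\<^sub>F T in sequentially. ennreal (1 / (14 * ln 2) * ln (real T)) \<le> worst_calls cv T (M T) L"
    using C
  proof eventually_elim
    case (elim T)
    let ?m = "C' * ln (real T) powr d'"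
    have m0: "0 \<le> ?m" using pos by simp
    have "C * ln (real T) powr d \<le> C' * ln (real T) powr d" by (intro mult_right_mono) (auto simp: C'_def)
    also have "\<dots> \<le> ?m" using elim(2) pos by (intro mult_left_mono powr_mono) (auto simp: d'_def)
    finally have "C * ln (real T) powr d \<le> ?m" .
    then have "worst_mistakes cv T (M T) L \<le> ennreal ?m"
      using elim(4) ennreal_leI order_trans by blast
    then have *: "ennreal ((ln (real T + 1 - eps cv) - ln (2 * ?m + 1)) / (7 * ln 2)) \<le> worst_calls cv T (M T) L"
      by (rule rand_calls_lower[OF inf elim(3) L[OF elim(3)] m0])
    have "ln (real T) \<le> ln (real T + 1 - eps cv)" using elim(3) by (cases cv) auto
    then have "1/2 * ln (real T) \<le> ln (real T + 1 - eps cv) - ln (2 * ?m + 1)"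
      using elim(1) by linarith
    then have "(1/2 * ln (real T)) / (7 * ln 2) \<le> (ln (real T + 1 - eps cv) - ln (2 * ?m + 1)) / (7 * ln 2)"
      by (rule divide_right_mono) simp
    then have "1 / (14 * ln 2) * ln (real T) \<le> (ln (real T + 1 - eps cv) - ln (2 * ?m + 1)) / (7 * ln 2)"
      by simp
    then show ?case using * by (meson ennreal_leI order_trans)
  qed
  moreover have "1 / (14 * ln (2::real)) > 0" by simp
  ultimately show ?thesis unfolding ebigomega_def by blast
qed

section \<open>A deterministic learner\<close>

text \<open>The whole domain is a prefix of every order and comes without a call; it provides a
  known prefix containing any given element.\<close>

definition known :: "'a set \<Rightarrow> 'a event list \<Rightarrow> ('a \<Rightarrow> bool) set" where
  "known X h = insert (\<lambda>x. x \<in> X) {c. \<exists>S. Answered S (Some c) \<in> set h}"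

definition unsep :: "'a set \<Rightarrow> ('a \<Rightarrow> bool) set \<Rightarrow> 'a \<times> 'a \<Rightarrow> bool" where
  "unsep X A p \<longleftrightarrow> fst p \<in> X \<and> snd p \<in> X \<and> fst p \<noteq> snd p \<and> (\<forall>c\<in>A. c (fst p) = c (snd p))"

definition unsep_pair :: "'a set \<Rightarrow> ('a \<Rightarrow> bool) set \<Rightarrow> 'a \<times> 'a" where
  "unsep_pair X A = (SOME p. unsep X A p)"

definition sep_sample :: "'a \<times> 'a \<Rightarrow> 'a sample" where
  "sep_sample p = {(fst p, True), (snd p, False)}"

fun outcome :: "'a event \<Rightarrow> bool" where
  "outcome (Labelled p y) = y"
| "outcome (Answered S a) = False"

definition labels :: "'a event list \<Rightarrow> bool list" where
  "labels h = map outcome (filter is_label h)"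

definition versions :: "'a set \<Rightarrow> 'a list \<Rightarrow> 'a event list \<Rightarrow> ('a \<Rightarrow> bool) set" where
  "versions X xs h = {c \<in> known X h. \<forall>i<rounds h. c (xs ! i) = labels h ! i}"

text \<open>An answer \<open>None\<close> leaves \<open>known\<close> unchanged, so the same pair is
  chosen again, and the recorded failure calls for the swapped sample. All calls precede the first
  prediction.\<close>

definition sort_then_halve :: "'a convention \<Rightarrow> 'a learner" where
  "sort_then_halve cv xs h =
     (let X = dom_of cv xs; A = known X h; p = unsep_pair X A; V = versions X xs h in
      if \<exists>q. unsep X A q
      then Query (sep_sample (if Answered (sep_sample p) None \<in> set h then prod.swap p else p))
      else Predict (card V \<le> 2 * card {c \<in> V. c (xs ! rounds h)}))"

lemma unsep_pair: "\<exists>q. unsep X A q \<Longrightarrow> unsep X A (unsep_pair X A)"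
  unfolding unsep_pair_def by (rule someI_ex)

lemma det_learner_sort_then_halve: "det_learner cv T (sort_then_halve cv)"
  unfolding det_learner_def
proof (intro allI impI)
  fix xs h S
  assume S: "sort_then_halve cv xs h = Query S"
  let ?X = "dom_of cv xs" let ?p = "unsep_pair ?X (known ?X h)"
  have "\<exists>q. unsep ?X (known ?X h) q"
    using S by (auto simp: sort_then_halve_def Let_def split: if_splits)
  then have "unsep ?X (known ?X h) ?p" by (rule unsep_pair)
  then show "S \<subseteq> ?X \<times> UNIV"
    using S by (auto simp: sort_then_halve_def Let_def sep_sample_def unsep_def split: if_splits)
qed

lemma known_simps [simp]:
  "known X (h @ [Labelled p y]) = known X h"
  "known X (h @ [Answered S None]) = known X h"
  "known X (h @ [Answered S (Some c)]) = insert c (known X h)"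
  by (auto simp: known_def)

lemma labels_simps [simp]:
  "labels (h @ [Labelled p y]) = labels h @ [y]" "labels (h @ [Answered S a]) = labels h"
  by (simp_all add: labels_def)

lemma length_labels [simp]: "length (labels h) = rounds h"
  by (simp add: labels_def rounds_def)

lemma versions_Labelled:
  "versions X xs (h @ [Labelled p y]) = {c \<in> versions X xs h. c (xs ! rounds h) = y}"
  by (auto simp: versions_def nth_append less_Suc_eq)

lemma concepts_memD:
  assumes "Linear_order r" "c \<in> concepts r"
  shows "\<exists>z\<in>Field r. c = concept r z \<and> c z"
proof -
  have "Refl r" using assms(1) by (simp add: order_on_defs)
  then show ?thesis using assms(2) by (auto simp: concepts_def concept_def refl_on_def)
qed

lemma full_concept:
  assumes "Linear_order r" "finite (Field r)" "z \<in> Field r"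
  shows "(\<lambda>x. x \<in> Field r) \<in> concepts r"
proof -
  have "finite (concepts r)" "concepts r \<noteq> {}" using assms by (auto simp: concepts_def)
  then obtain c where c: "c \<in> concepts r" "\<And>d. d \<in> concepts r \<Longrightarrow> c \<le> d \<Longrightarrow> d = c"
    using finite_has_maximal by metis
  have "c x \<longleftrightarrow> x \<in> Field r" for x
  proof
    assume "c x"
    then show "x \<in> Field r" using c(1) by (auto simp: concepts_def concept_def Field_def)
  next
    assume x: "x \<in> Field r"
    then have "concept r x \<in> concepts r" by (simp add: concepts_def)
    moreover from this have "concept r x \<le> c"
      using concepts_chain[OF assms(1) c(1)] c(2) by (metis order_refl)
    moreover have "concept r x x" using assms(1) x by (auto simp: concept_def order_on_defs refl_on_def)
    ultimately show "c x" by (auto simp: le_fun_def)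
  qed
  then have "c = (\<lambda>x. x \<in> Field r)" by auto
  then show ?thesis using c(1) by simp
qed

text \<open>The least known prefix containing \<open>z\<close> ends at some \<open>w\<close>. If
  \<open>w\<close> were not \<open>z\<close>, a known prefix separating the two would contain
  \<open>z\<close> but not \<open>w\<close>, and so be smaller.\<close>

lemma separated_complete:
  assumes lin: "Linear_order r" and fin: "finite (Field r)" and A: "A \<subseteq> concepts r"
    and full: "(\<lambda>x. x \<in> Field r) \<in> A" and sep: "\<not> (\<exists>p. unsep (Field r) A p)" and z: "z \<in> Field r"
  shows "concept r z \<in> A"
proof -
  have refl: "(z, z) \<in> r" using lin z by (auto simp: order_on_defs refl_on_def)
  have anti: "antisym r" and tr: "trans r" using lin by (auto simp: order_on_defs)
  have "finite A" using A fin by (auto simp: concepts_def intro: finite_subset)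
  then have "finite {c \<in> A. c z}" "{c \<in> A. c z} \<noteq> {}" using full z by auto
  then obtain c where c: "c \<in> A" "c z" "\<And>d. d \<in> A \<Longrightarrow> d z \<Longrightarrow> d \<le> c \<Longrightarrow> d = c"
    using finite_has_minimal[of "{c \<in> A. c z}"] by auto
  obtain w where w: "w \<in> Field r" "c = concept r w" "c w" using concepts_memD[OF lin] A c(1) by blast
  have zw: "(z, w) \<in> r" using c(2) w(2) by (simp add: concept_def)
  show ?thesis
  proof (cases "z = w")
    case False
    then obtain d where d: "d \<in> A" "d z \<noteq> d w"
      using sep z w(1) unfolding unsep_def by (metis fst_conv snd_conv)
    obtain v where v: "d = concept r v" using A d(1) by (auto simp: concepts_def)
    have "d w \<Longrightarrow> d z" using zw tr by (auto simp: v concept_def dest: transD)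
    with d(2) have dz: "d z" "\<not> d w" by auto
    then have "\<not> c \<le> d" using w(3) by (auto simp: le_fun_def)
    then have "d \<le> c" using concepts_chain[OF lin, of c d] A c(1) d(1) by auto
    then show ?thesis using c(3)[OF d(1) dz(1)] dz(2) w(3) by simp
  qed (use c(1) w(2) in simp)
qed

text \<open>The order of the pair is unknown to the learner, but the prefix ending at the lower
  element separates the two, so one of the two orientations is always answered.\<close>

lemma ordered_pair_consistent:
  assumes lin: "Linear_order r" and xy: "x \<in> Field r" "y \<in> Field r" "x \<noteq> y"
    and none: "\<not> (\<exists>c\<in>concepts r. consistent c (sep_sample (x, y)))"
  shows "\<exists>c\<in>concepts r. consistent c (sep_sample (y, x))"
proof (intro bexI)
  have "refl_on (Field r) r" using lin by (simp add: order_on_defs)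
  then have "(x, x) \<in> r" "(y, y) \<in> r" using xy by (simp_all add: refl_on_def)
  have "concept r x \<in> concepts r" using xy by (simp add: concepts_def)
  then have "\<not> consistent (concept r x) (sep_sample (x, y))" using none by blast
  then have "(y, x) \<in> r"
    using \<open>(x, x) \<in> r\<close> by (simp add: consistent_def sep_sample_def concept_def)
  moreover have "antisym r" using lin by (simp add: order_on_defs)
  ultimately have "(x, y) \<notin> r" using xy(3) by (meson antisymD)
  then show "consistent (concept r y) (sep_sample (y, x))"
    using \<open>(y, y) \<in> r\<close> by (simp add: consistent_def sep_sample_def concept_def)
  show "concept r y \<in> concepts r" using xy by (simp add: concepts_def)
qed

lemma legal_oracleD:
  assumes "legal_oracle r Or" "S \<subseteq> Field r \<times> UNIV"
  shows "Or S = None \<Longrightarrow> \<not> (\<exists>c\<in>concepts r. consistent c S)"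
    "Or S = Some c \<Longrightarrow> c \<in> concepts r \<and> consistent c S"
proof -
  have "case Or S of Some c \<Rightarrow> c \<in> concepts r \<and> consistent c S
      | None \<Rightarrow> \<not> (\<exists>c\<in>concepts r. consistent c S)"
    using assms unfolding legal_oracle_def by (elim allE[of _ S]) (rule mp)
  then show "Or S = None \<Longrightarrow> \<not> (\<exists>c\<in>concepts r. consistent c S)"
    "Or S = Some c \<Longrightarrow> c \<in> concepts r \<and> consistent c S" by simp_all
qed

text \<open>One failed call still without its repetition: the only situation in which the calls may
  exceed twice the number of known prefixes.\<close>

definition awaiting_swap :: "'a set \<Rightarrow> 'a event list \<Rightarrow> bool" where
  "awaiting_swap X h \<longleftrightarrow> (\<exists>q. unsep X (known X h) q) \<and>
     Answered (sep_sample (unsep_pair X (known X h))) None \<in> set h"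

text \<open>A pair costs at most two calls, because two failures would contradict
  \<open>ordered_pair_consistent\<close>; the conjunct on \<open>None\<close> answers keeps the
  first failure for this argument. Each success adds a new prefix, which bounds the number of pairs
  treated.\<close>

lemma sort_then_halve_invariant:
  assumes inst: "(xs, r, z, R) \<in> all_instances cv T"
  defines "X \<equiv> dom_of cv xs"
  defines "H \<equiv> hist xs (concept r z) (\<lambda>S. R S r) (sort_then_halve cv xs)"
  shows "known X (H n) \<subseteq> concepts r \<and>
    (\<forall>i<rounds (H n). labels (H n) ! i = concept r z (xs ! i)) \<and>
    (\<forall>S. Answered S None \<in> set (H n) \<longrightarrow> S \<subseteq> X \<times> UNIV \<longrightarrow> \<not> (\<exists>c\<in>concepts r. consistent c S)) \<and>
    n_calls (H n) \<le> 2 * card (known X (H n)) + of_bool (awaiting_swap X (H n)) \<and>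
    (if \<exists>q. unsep X (known X (H n)) q then n_mistakes (H n) = 0
     else 2 ^ n_mistakes (H n) * card (versions X xs (H n)) \<le> card X)"
proof -
  have adm: "admissible cv xs r" and zX: "z \<in> X" and leg: "legal_oracle r (\<lambda>S. R S r)"
    using inst by (auto simp: instances_def X_def legal_rule_def)
  have F: "Field r = X" and lin: "Linear_order r" and fin: "finite X"
    using admissible_finite_Field[OF adm] by (simp_all add: X_def)
  have conc: "finite (concepts r)" "card (concepts r) \<le> card X"
    using fin F by (auto simp: concepts_def card_image_le)
  have full: "(\<lambda>x. x \<in> X) \<in> concepts r" using full_concept[OF lin] F fin zX by simp
  have vers: "card (versions X xs h) \<le> card X" if "known X h \<subseteq> concepts r" for h
  proof -
    have "versions X xs h \<subseteq> concepts r" using that by (auto simp: versions_def)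
    then show ?thesis using card_mono[OF conc(1)] conc(2) by (meson order_trans)
  qed
  show ?thesis
  proof (induction n)
    case 0
    have "H 0 = []" by (simp add: H_def)
    moreover have "known X [] = {\<lambda>x. x \<in> X}" by (simp add: known_def)
    ultimately show ?case using full vers[of "[]"] by simp
  next
    case (Suc n)
    define h where "h = H n"
    note IH = Suc[folded h_def]
    have kn: "known X h \<subseteq> concepts r" using IH by blast
    have knfin: "finite (known X h)" using kn conc(1) finite_subset by blast
    show ?case
    proof (cases "rounds h = length xs")
      case True
      then have "H (Suc n) = h" by (simp add: H_def h_def)
      then show ?thesis using IH by simp
    next
      case run: False
      define p where "p = unsep_pair X (known X h)"
      show ?thesis
      proof (cases "\<exists>q. unsep X (known X h) q")
        case True
        then have p: "unsep X (known X h) p" unfolding p_def by (rule unsep_pair)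
        define b where "b = (Answered (sep_sample p) None \<in> set h)"
        define p' where "p' = (if b then prod.swap p else p)"
        define S where "S = sep_sample p'"
        have "sort_then_halve cv xs h = Query S"
          using True by (simp add: sort_then_halve_def Let_def X_def S_def p'_def p_def b_def)
        then have step: "H (Suc n) = h @ [Answered S (R S r)]"
          using run by (simp add: H_def h_def)
        have pX: "fst p \<in> X" "snd p \<in> X" "fst p \<noteq> snd p" "\<And>c. c \<in> known X h \<Longrightarrow> c (fst p) = c (snd p)"
          using p by (auto simp: unsep_def)
        have SX: "sep_sample p \<subseteq> X \<times> UNIV" "S \<subseteq> X \<times> UNIV"
          using pX by (auto simp: sep_sample_def S_def p'_def)
        have aw: "awaiting_swap X h \<longleftrightarrow> b" using True by (simp add: awaiting_swap_def b_def p_def)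
        have mis: "n_mistakes h = 0" using IH True by simp
        show ?thesis
        proof (cases "R S r")
          case None
          have none: "\<not> (\<exists>c\<in>concepts r. consistent c S)"
            using legal_oracleD(1)[OF leg _ None] SX(2) F by simp
          have "\<not> b"
          proof
            assume b
            then have "\<not> (\<exists>c\<in>concepts r. consistent c (sep_sample p))"
              using IH SX(1) by (simp add: b_def)
            then show False
              using ordered_pair_consistent[OF lin, of "fst p" "snd p"] none pX F \<open>b\<close>
              by (simp add: S_def p'_def prod.swap_def)
          qed
          then have S: "S = sep_sample p" by (simp add: S_def p'_def)
          have step': "H (Suc n) = h @ [Answered S None]" using step None by simp
          have "awaiting_swap X (H (Suc n))"
            unfolding awaiting_swap_def step' known_simps p_def[symmetric] using True by (simp add: S)
          moreover have "\<not> (\<exists>c\<in>concepts r. consistent c S')"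
            if "Answered S' None \<in> set (H (Suc n))" "S' \<subseteq> X \<times> UNIV" for S'
            using that IH none unfolding step' by auto
          moreover have "n_calls (H (Suc n)) \<le> 2 * card (known X (H (Suc n))) + 1"
            using IH aw \<open>\<not> b\<close> unfolding step' by simp
          moreover have "known X (H (Suc n)) = known X h" "labels (H (Suc n)) = labels h"
            "rounds (H (Suc n)) = rounds h" "n_mistakes (H (Suc n)) = 0"
            using mis by (simp_all add: step')
          ultimately show ?thesis using IH True by simp
        next
          case (Some c)
          have c: "c \<in> concepts r" "consistent c S"
            using legal_oracleD(2)[OF leg _ Some] SX(2) F by simp_all
          then have "c (fst p) \<noteq> c (snd p)"
            by (auto simp: consistent_def S_def sep_sample_def p'_def split: if_splits)
          then have new: "c \<notin> known X h" using pX(4) by blast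
          have kn': "known X (H (Suc n)) = insert c (known X h)" by (simp add: step Some)
          have "n_calls (H (Suc n)) \<le> 2 * card (known X (H (Suc n)))"
          proof -
            have "n_calls h \<le> 2 * card (known X h) + of_bool b" using IH aw by simp
            moreover have "of_bool b \<le> (1::nat)" by simp
            moreover have "card (insert c (known X h)) = Suc (card (known X h))"
              using new knfin by simp
            ultimately show ?thesis unfolding kn' by (simp add: step)
          qed
          moreover have "known X (H (Suc n)) \<subseteq> concepts r" using kn c(1) by (simp add: kn')
          moreover have "n_mistakes (H (Suc n)) = 0" using mis by (simp add: step)
          moreover have "labels (H (Suc n)) = labels h" "rounds (H (Suc n)) = rounds h"
            by (simp_all add: step)
          moreover have "Answered S' None \<in> set (H (Suc n)) \<longleftrightarrow> Answered S' None \<in> set h" for S'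
            by (simp add: step Some)
          ultimately show ?thesis using IH vers[of "H (Suc n)"] by (auto simp: trans_le_add1)
        qed
      next
        case False
        define V where "V = versions X xs h"
        define x where "x = xs ! rounds h"
        define y where "y = concept r z x"
        define g where "g = (card V \<le> 2 * card {c \<in> V. c x})"
        have "sort_then_halve cv xs h = Predict g"
          using False by (simp add: sort_then_halve_def Let_def X_def V_def x_def g_def)
        then have step: "H (Suc n) = h @ [Labelled g y]"
          using run by (simp add: H_def h_def y_def x_def Let_def)
        have V': "versions X xs (H (Suc n)) = {c \<in> V. c x = y}"
          by (simp add: step versions_Labelled V_def x_def)
        have Vfin: "finite V" using knfin by (simp add: V_def versions_def)
        have bound: "2 ^ n_mistakes h * card V \<le> card X" using IH False by (simp add: V_def)
        have "2 ^ n_mistakes (H (Suc n)) * card {c \<in> V. c x = y} \<le> card X"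
        proof (cases "g = y")
          case True
          have "card {c \<in> V. c x = y} \<le> card V" using Vfin by (intro card_mono) auto
          then have "2 ^ n_mistakes h * card {c \<in> V. c x = y} \<le> 2 ^ n_mistakes h * card V"
            by (rule mult_left_mono) simp
          from order_trans[OF this bound] show ?thesis using True by (simp add: step)
        next
          case False
          have "V = {c \<in> V. c x} \<union> {c \<in> V. \<not> c x}" by auto
          then have "card V = card {c \<in> V. c x} + card {c \<in> V. \<not> c x}"
            using Vfin card_Un_disjoint[of "{c \<in> V. c x}" "{c \<in> V. \<not> c x}"] by auto
          then have "2 * card {c \<in> V. c x = y} \<le> card V"
            using False by (cases y) (auto simp: g_def)
          then have "2 ^ n_mistakes h * (2 * card {c \<in> V. c x = y}) \<le> 2 ^ n_mistakes h * card V"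
            by (rule mult_left_mono) simp
          from order_trans[OF this bound] show ?thesis
            using False by (simp add: step mult.assoc mult.left_commute)
        qed
        moreover have "labels (H (Suc n)) ! i = concept r z (xs ! i)" if "i < rounds (H (Suc n))" for i
          using IH that by (auto simp: step nth_append less_Suc_eq y_def x_def)
        moreover have "known X (H (Suc n)) = known X h" by (simp add: step)
        moreover have "n_calls (H (Suc n)) = n_calls h" by (simp add: step)
        moreover have "Answered S None \<in> set (H (Suc n)) \<longleftrightarrow> Answered S None \<in> set h" for S
          by (simp add: step)
        moreover from this have "awaiting_swap X (H (Suc n)) \<longleftrightarrow> awaiting_swap X h"
          by (simp add: awaiting_swap_def step)
        ultimately show ?thesis using IH False by (simp add: V')
      qed
    qed
  qed
qed

lemma card_dom_of: "announceable cv T xs \<Longrightarrow> card (dom_of cv xs) \<le> T + 1"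
  by (cases cv) (auto simp: announceable_def card_insert_if distinct_card)

lemma sort_then_halve_bounds:
  assumes inst: "i \<in> all_instances cv T"
  shows "mistakes (sort_then_halve cv) i \<le> ennreal (log 2 (real T + 1))"
    "calls (sort_then_halve cv) i \<le> of_nat (2 * T + 3)"
proof -
  obtain xs r z R where i: "i = (xs, r, z, R)" by (cases i)
  define X where "X = dom_of cv xs"
  define H where "H = hist xs (concept r z) (\<lambda>S. R S r) (sort_then_halve cv xs)"
  note inv = sort_then_halve_invariant[OF inst[unfolded i], folded X_def H_def]
  have adm: "admissible cv xs r" and zX: "z \<in> X" and ann: "announceable cv T xs"
    using inst by (auto simp: i instances_def X_def)
  have F: "Field r = X" and lin: "Linear_order r" and fin: "finite X"
    using admissible_finite_Field[OF adm] by (simp_all add: X_def)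
  have cX: "card X \<le> T + 1" unfolding X_def by (rule card_dom_of[OF ann])
  have conc: "finite (concepts r)" "card (concepts r) \<le> card X"
    using fin F by (auto simp: concepts_def card_image_le)
  have kc: "card (known X (H n)) \<le> T + 1" for n
    using inv[of n] card_mono[OF conc(1)] conc(2) cX by (meson order_trans)
  have "n_calls (H n) \<le> 2 * T + 3" for n
  proof -
    have "n_calls (H n) \<le> 2 * card (known X (H n)) + of_bool (awaiting_swap X (H n))"
      using inv[of n] by blast
    moreover have "of_bool (awaiting_swap X (H n)) \<le> (1::nat)" by simp
    ultimately show ?thesis using kc[of n] by linarith
  qed
  then show "calls (sort_then_halve cv) i \<le> of_nat (2 * T + 3)"
    unfolding i calls.simps H_def[symmetric] by (intro SUP_least) (simp del: of_nat_add of_nat_mult)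
  have "real (n_mistakes (H n)) \<le> log 2 (real T + 1)" for n
  proof (cases "\<exists>q. unsep X (known X (H n)) q")
    case True
    then show ?thesis using inv[of n] by simp
  next
    case False
    \<comment> \<open>Once all pairs are separated, the target is among the known prefixes and
      agrees with all labels. Hence the version space is never empty, and halving gives the
      logarithm.\<close>
    have "concept r z \<in> known X (H n)"
      using separated_complete[OF lin _ _ _ _ , of "known X (H n)" z] F fin inv[of n] False zX
      by (auto simp: known_def)
    then have "concept r z \<in> versions X xs (H n)" using inv[of n] by (simp add: versions_def)
    moreover have "versions X xs (H n) \<subseteq> concepts r"
      using inv[of n] unfolding versions_def by blast
    then have "finite (versions X xs (H n))" using conc(1) by (rule finite_subset)
    ultimately have "card (versions X xs (H n)) \<ge> 1" by (auto simp: Suc_le_eq card_gt_0_iff)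
    then have "2 ^ n_mistakes (H n) \<le> 2 ^ n_mistakes (H n) * card (versions X xs (H n))" by simp
    also have "\<dots> \<le> T + 1" using inv[of n] False cX by simp
    finally have "real (2 ^ n_mistakes (H n)) \<le> real (T + 1)" by (rule of_nat_mono)
    then have "2 ^ n_mistakes (H n) \<le> real T + 1" by simp
    then show ?thesis by (simp add: le_log_iff powr_realpow)
  qed
  then show "mistakes (sort_then_halve cv) i \<le> ennreal (log 2 (real T + 1))"
    unfolding i mistakes.simps H_def[symmetric]
    by (intro SUP_least) (simp add: ennreal_of_nat_eq_real_of_nat ennreal_leI)
qed

text \<open>Restricting the rules only shrinks the set of instances, so one learner serves every
  \<open>Rs\<close>.\<close>

lemma det_learner_exists:
  fixes cv :: "'a convention"
  shows "\<exists>L. (\<forall>T\<ge>1. det_learner cv T L) \<and>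
    (\<exists>C. \<forall>\<^sub>F T in sequentially. \<forall>i\<in>instances cv Rs T. mistakes L i \<le> ennreal (C * ln (real T))) \<and>
    (\<exists>C. \<forall>\<^sub>F T in sequentially. \<forall>i\<in>instances cv Rs T. calls L i \<le> ennreal (C * real T))"
proof (intro exI[of _ "sort_then_halve cv"] conjI exI allI impI)
  have sub: "i \<in> all_instances cv T" if "i \<in> instances cv Rs T" for i T
    using that by (auto simp: instances_def)
  show "det_learner cv T (sort_then_halve cv)" for T by (rule det_learner_sort_then_halve)
  have "\<forall>\<^sub>F T in sequentially. ln (real T + 1) \<le> 2 * ln (real T)" by real_asymp
  then have "\<forall>\<^sub>F T in sequentially. log 2 (real T + 1) \<le> 2 / ln 2 * ln (real T)"
    by eventually_elim (simp add: log_def divide_right_mono)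
  then show "\<forall>\<^sub>F T in sequentially. \<forall>i\<in>instances cv Rs T.
      mistakes (sort_then_halve cv) i \<le> ennreal (2 / ln 2 * ln (real T))"
    by eventually_elim (meson sort_then_halve_bounds(1) sub ennreal_leI order_trans)
  have "\<forall>\<^sub>F T in sequentially. (3::nat) \<le> T" by (rule eventually_ge_at_top)
  then show "\<forall>\<^sub>F T in sequentially. \<forall>i\<in>instances cv Rs T.
      calls (sort_then_halve cv) i \<le> ennreal (3 * real T)"
  proof eventually_elim
    case (elim T)
    then have "(of_nat (2 * T + 3) :: ennreal) \<le> ennreal (3 * real T)"
      unfolding ennreal_of_nat_eq_real_of_nat by (intro ennreal_leI) simp
    then show ?case using sort_then_halve_bounds(2) sub order_trans by blast
  qed
qed

section \<open>Random cuts of a finite chain\<close>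

definition distinct_pairs :: "'b set \<Rightarrow> ('b \<times> 'b) set" where
  "distinct_pairs A = {p \<in> A \<times> A. fst p \<noteq> snd p}"

lemma finite_distinct_pairs [simp]: "finite A \<Longrightarrow> finite (distinct_pairs A)"
  by (simp add: distinct_pairs_def)

lemma card_distinct_pairs: "finite A \<Longrightarrow> card (distinct_pairs A) = card A * card A - card A"
proof -
  assume A: "finite A"
  have "distinct_pairs A = A \<times> A - (\<lambda>x. (x, x)) ` A" by (auto simp: distinct_pairs_def)
  moreover have "card ((\<lambda>x. (x, x)) ` A) = card A" by (simp add: card_image inj_on_def)
  ultimately show ?thesis using A by (simp add: card_Diff_subset card_cartesian_product image_subset_iff)
qed

text \<open>For the ranks of a pair: the elements up to the lower one or those from the upper one
  on, whichever are fewer. Either side of any cut between the two has at least that many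
  elements.\<close>

definition end_distance :: "nat \<Rightarrow> nat \<times> nat \<Rightarrow> nat" where
  "end_distance n p = min (min (fst p) (snd p)) (n + 1 - max (fst p) (snd p))"

text \<open>Passing from \<open>n\<close> to \<open>n + 2\<close> adds one at either end, which raises every summand by one.\<close>

lemma sum_end_distance:
  "n * n * n \<le> 6 * (\<Sum>p\<in>distinct_pairs {1..n}. end_distance n p) + n * n"
proof (induction n rule: nat_induct2)
  case (step n)
  let ?P = "distinct_pairs {1..n + 2}" and ?Q = "distinct_pairs {2..n + 1}"
  have QP: "?Q \<subseteq> ?P" by (auto simp: distinct_pairs_def)
  have "end_distance (n + 2) p = 1 + (if p \<in> ?Q then end_distance n (fst p - 1, snd p - 1) else 0)"
    if "p \<in> ?P" for p
    using that by (cases p) (auto simp: distinct_pairs_def end_distance_def min_def max_def)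
  then have "(\<Sum>p\<in>?P. end_distance (n + 2) p) =
      (\<Sum>p\<in>?P. 1 + (if p \<in> ?Q then end_distance n (fst p - 1, snd p - 1) else 0))"
    by (rule sum.cong[OF refl])
  also have "\<dots> = card ?P + (\<Sum>p\<in>?P. if p \<in> ?Q then end_distance n (fst p - 1, snd p - 1) else 0)"
    by (simp only: sum.distrib card_eq_sum)
  also have "(\<Sum>p\<in>?P. if p \<in> ?Q then end_distance n (fst p - 1, snd p - 1) else 0) =
      (\<Sum>p\<in>?Q. end_distance n (fst p - 1, snd p - 1))"
    using QP by (subst sum.inter_restrict[symmetric]) (auto simp: Int_absorb1)
  also have "\<dots> = (\<Sum>p\<in>distinct_pairs {1..n}. end_distance n p)"
    by (rule sum.reindex_bij_witness[of _ "map_prod Suc Suc" "\<lambda>p. (fst p - 1, snd p - 1)"])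
      (auto simp: distinct_pairs_def)
  finally have S: "(\<Sum>p\<in>?P. end_distance (n + 2) p) =
      (n + 2) * (n + 2) - (n + 2) + (\<Sum>p\<in>distinct_pairs {1..n}. end_distance n p)"
    by (simp add: card_distinct_pairs)
  have "(n + 2) * (n + 2) - (n + 2) = n * n + 3 * n + 2" by (simp add: algebra_simps)
  with S step show ?case by (simp add: algebra_simps)
qed (simp_all add: distinct_pairs_def)

text \<open>Neither the place of the cut between the pair nor the surviving side is controlled, so
  only the smaller end beyond the pair is guaranteed to go. A total of
  \<open>(n * n * n - n * n) / 6\<close> over \<open>n * n - n\<close> ordered pairs is an average
  of \<open>n / 6\<close>.\<close>

lemma random_cut_removes:
  fixes J :: "'b set" and le :: "'b \<Rightarrow> 'b \<Rightarrow> bool"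
  assumes fin: "finite J"
    and refl: "\<And>k. k \<in> J \<Longrightarrow> le k k"
    and anti: "\<And>k l. k \<in> J \<Longrightarrow> l \<in> J \<Longrightarrow> le k l \<Longrightarrow> le l k \<Longrightarrow> k = l"
    and trans: "\<And>k l m. k \<in> J \<Longrightarrow> l \<in> J \<Longrightarrow> m \<in> J \<Longrightarrow> le k l \<Longrightarrow> le l m \<Longrightarrow> le k m"
    and total: "\<And>k l. k \<in> J \<Longrightarrow> l \<in> J \<Longrightarrow> le k l \<or> le l k"
    and cut: "\<And>p. p \<in> distinct_pairs J \<Longrightarrow> (fst p \<in> C p) \<noteq> (snd p \<in> C p)"
    and down: "\<And>p k l. p \<in> distinct_pairs J \<Longrightarrow> k \<in> J \<Longrightarrow> k \<in> C p \<Longrightarrow> l \<in> J \<Longrightarrow> le l k \<Longrightarrow> l \<in> C p"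
    and s: "\<And>p. p \<in> distinct_pairs J \<Longrightarrow> s p = J \<inter> C p \<or> s p = J - C p"
  shows "card J * card J * card J \<le> 6 * (\<Sum>p\<in>distinct_pairs J. card (J - s p)) + card J * card J"
proof -
  define n where "n = card J"
  define rank where "rank k = card {l \<in> J. le l k}" for k
  have rank_less: "rank k < rank l" if "k \<in> J" "l \<in> J" "le k l" "k \<noteq> l" for k l
    unfolding rank_def
  proof (rule psubset_card_mono)
    have "l \<notin> {m \<in> J. le m k}" using that anti by blast
    moreover have "{m \<in> J. le m k} \<subseteq> {m \<in> J. le m l}" using that trans by blast
    ultimately show "{m \<in> J. le m k} \<subset> {m \<in> J. le m l}" using that refl by blast
  qed (use fin in simp)
  have inj: "inj_on rank J"
    by (rule inj_onI) (metis rank_less total less_irrefl)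
  have "rank k \<in> {1..n}" if "k \<in> J" for k
  proof -
    have "{l \<in> J. le l k} \<noteq> {}" using refl[OF that] that by blast
    then have "0 < rank k" unfolding rank_def using fin by (simp add: card_gt_0_iff)
    moreover have "rank k \<le> n" unfolding rank_def n_def using fin by (intro card_mono) auto
    ultimately show ?thesis by simp
  qed
  then have img: "rank ` J = {1..n}"
    using fin inj by (intro card_subset_eq) (auto simp: card_image n_def)
  have up: "card {l \<in> J. le k l} = n + 1 - rank k" if "k \<in> J" for k
  proof -
    have "{l \<in> J. le l k} \<union> {l \<in> J. le k l} = J" using total that by blast
    moreover have "{l \<in> J. le l k} \<inter> {l \<in> J. le k l} = {k}" using that anti refl by blast
    ultimately have "rank k + card {l \<in> J. le k l} = n + 1"
      using card_Un_Int[of "{l \<in> J. le l k}" "{l \<in> J. le k l}"] fin by (simp add: rank_def n_def)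
    then show ?thesis by simp
  qed
  have removed: "end_distance n (map_prod rank rank p) \<le> card (J - s p)" if p: "p \<in> distinct_pairs J" for p
  proof -
    have pJ: "fst p \<in> J" "snd p \<in> J" using p by (auto simp: distinct_pairs_def)
    obtain a b where ab: "a \<in> J" "b \<in> J" "a \<in> C p" "b \<notin> C p" "{a, b} = {fst p, snd p}"
    proof (cases "fst p \<in> C p")
      case True
      then show thesis using that[of "fst p" "snd p"] cut[OF p] pJ by auto
    next
      case False
      then show thesis using that[of "snd p" "fst p"] cut[OF p] pJ by auto
    qed
    have e: "end_distance n (map_prod rank rank p) \<le> rank a"
      "end_distance n (map_prod rank rank p) \<le> n + 1 - rank b"
      using ab(5) by (cases p; auto simp: end_distance_def doubleton_eq_iff)+
    have "{l \<in> J. le l a} \<subseteq> J \<inter> C p" using down[OF p ab(1,3)] by blast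
    then have A: "rank a \<le> card (J \<inter> C p)" unfolding rank_def using fin by (intro card_mono) auto
    have "{l \<in> J. le b l} \<subseteq> J - C p" using down[OF p _ _ ab(2)] ab(4) by blast
    then have B: "n + 1 - rank b \<le> card (J - C p)"
      unfolding up[OF ab(2), symmetric] using fin by (intro card_mono) auto
    from s[OF p] show ?thesis
    proof
      assume "s p = J \<inter> C p"
      then have "J - s p = J - C p" by blast
      then show ?thesis using e(2) B by simp
    next
      assume "s p = J - C p"
      then have "J - s p = J \<inter> C p" by blast
      then show ?thesis using e(1) A by simp
    qed
  qed
  have "bij_betw (map_prod rank rank) (distinct_pairs J) (distinct_pairs {1..n})"
    unfolding bij_betw_def
  proof
    show "inj_on (map_prod rank rank) (distinct_pairs J)"
      by (rule inj_on_subset[OF map_prod_inj_on[OF inj inj]]) (auto simp: distinct_pairs_def)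
    show "map_prod rank rank ` distinct_pairs J = distinct_pairs {1..n}"
      unfolding img[symmetric] distinct_pairs_def using inj by (force simp: inj_on_eq_iff)
  qed
  then have "(\<Sum>p\<in>distinct_pairs {1..n}. end_distance n p) =
      (\<Sum>p\<in>distinct_pairs J. end_distance n (map_prod rank rank p))"
    by (rule sum.reindex_bij_betw[symmetric])
  also have "\<dots> \<le> (\<Sum>p\<in>distinct_pairs J. card (J - s p))" by (intro sum_mono removed)
  finally show ?thesis using sum_end_distance[of n] unfolding n_def by linarith
qed

section \<open>The expected number of iterated cuts\<close>

fun iterations :: "('b set \<Rightarrow> 'b set) \<Rightarrow> nat \<Rightarrow> 'b set \<Rightarrow> nat" where
  "iterations f 0 J = 0"
| "iterations f (Suc n) J = (if card J < 2 then 0 else Suc (iterations f n (f J)))"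

text \<open>The fuel \<open>card J\<close> suffices since every step removes an element.\<close>

definition split_depth :: "('b set \<Rightarrow> 'b set) \<Rightarrow> 'b set \<Rightarrow> nat" where
  "split_depth f J = iterations f (card J) J"

definition shrinking :: "('b set \<Rightarrow> 'b set) \<Rightarrow> bool" where
  "shrinking f \<longleftrightarrow> (\<forall>J. 2 \<le> card J \<longrightarrow> f J \<subset> J)"

lemma shrinking_card:
  assumes "shrinking f" "2 \<le> card J"
  shows "f J \<subset> J" "card (f J) < card J" "finite J"
proof -
  show "f J \<subset> J" using assms by (simp add: shrinking_def)
  moreover show "finite J" using assms(2) by (intro card_ge_0_finite) simp
  ultimately show "card (f J) < card J" by (intro psubset_card_mono)
qed

lemma iterations_fuel:
  assumes "shrinking f" "card J \<le> n"
  shows "iterations f n J = split_depth f J"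
  using assms(2)
proof (induction n arbitrary: J rule: less_induct)
  case (less n)
  show ?case
  proof (cases "card J < 2")
    case True
    then show ?thesis by (cases n; cases "card J") (auto simp: split_depth_def)
  next
    case False
    then obtain m c where m: "n = Suc m" "card J = Suc c"
      using less.prems by (metis gr0_conv_Suc not_less_eq_eq le_zero_eq less_Suc_eq_0_disj not0_implies_Suc numeral_2_eq_2)
    have "card (f J) < card J" using shrinking_card[OF assms(1)] False by simp
    then have c: "card (f J) \<le> c" "card (f J) \<le> m" "c \<le> m" using m less.prems by auto
    have "iterations f m (f J) = split_depth f (f J)" using less.IH[of m "f J"] m c by simp
    moreover have "iterations f c (f J) = split_depth f (f J)" using less.IH[of c "f J"] m c by simp
    ultimately show ?thesis using False m by (simp add: split_depth_def)
  qed
qed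

lemma split_depth_small: "card J < 2 \<Longrightarrow> split_depth f J = 0"
  by (cases "card J") (auto simp: split_depth_def)

lemma split_depth_step:
  assumes "shrinking f" "2 \<le> card J"
  shows "split_depth f J = Suc (split_depth f (f J))"
proof -
  obtain c where c: "card J = Suc c" using assms(2) by (cases "card J") auto
  have "card (f J) \<le> c" using shrinking_card(2)[OF assms] c by simp
  then show ?thesis using iterations_fuel[OF assms(1), of "f J" c] c assms(2)
    by (simp add: split_depth_def)
qed

lemma split_depth_cong:
  assumes "shrinking f" "shrinking g" "\<And>J'. J' \<subseteq> J \<Longrightarrow> f J' = g J'"
  shows "split_depth f J = split_depth g J"
  using assms(3)
proof (induction "card J" arbitrary: J rule: less_induct)
  case less
  show ?case
  proof (cases "card J < 2")
    case False
    then have J: "2 \<le> card J" by simp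
    have "split_depth f (f J) = split_depth g (f J)"
      using less.hyps[OF shrinking_card(2)[OF assms(1) J]] shrinking_card(1)[OF assms(1) J] less.prems
      by blast
    then show ?thesis
      using split_depth_step[OF assms(1) J] split_depth_step[OF assms(2) J] less.prems[of J] by simp
  qed (simp add: split_depth_small)
qed

text \<open>The tangent bound \<open>ln x <= x - 1\<close> turns an average removal of
  \<open>n / 6\<close> elements into an average drop of the logarithm by \<open>1 / 6\<close>, so
  the factor 6 pays for one step.\<close>

lemma expected_log_decrease:
  fixes c :: "'p \<Rightarrow> nat"
  assumes "finite P" "P \<noteq> {}" "card P = n * n - n" "n \<ge> 2"
    and c: "\<And>p. p \<in> P \<Longrightarrow> 1 \<le> c p \<and> c p \<le> n"
    and sum: "n * n * n \<le> 6 * (\<Sum>p\<in>P. n - c p) + n * n"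
  shows "(\<Sum>p\<in>P. 1 + 6 * ln (real (c p))) \<le> real (card P) * (6 * ln (real n))"
proof -
  have n: "real n > 0" using assms(4) by simp
  have "1 + 6 * ln (real (c p)) \<le> 6 * ln (real n) + 1 - 6 / real n * real (n - c p)" if "p \<in> P" for p
  proof -
    have cp: "0 < real (c p)" "c p \<le> n" using c[OF that] by auto
    have "ln (real (c p) / real n) \<le> real (c p) / real n - 1"
      using cp n by (intro ln_le_minus_one) simp
    then have "ln (real (c p)) \<le> ln (real n) + real (c p) / real n - 1" using cp n by (simp add: ln_div)
    moreover have "6 / real n * real (n - c p) = 6 - 6 * (real (c p) / real n)"
      using cp n by (simp add: of_nat_diff field_simps)
    ultimately show ?thesis by linarith
  qed
  then have "(\<Sum>p\<in>P. 1 + 6 * ln (real (c p))) \<le>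
      (\<Sum>p\<in>P. 6 * ln (real n) + 1 - 6 / real n * real (n - c p))" by (rule sum_mono)
  also have "\<dots> = real (card P) * (6 * ln (real n)) + real (card P) - 6 / real n * real (\<Sum>p\<in>P. n - c p)"
    by (simp add: sum.distrib sum_subtractf sum_distrib_left algebra_simps)
  also have "\<dots> \<le> real (card P) * (6 * ln (real n))"
  proof -
    have "real (n * n * n) \<le> real (6 * (\<Sum>p\<in>P. n - c p) + n * n)" using sum by (rule of_nat_mono)
    then have "real n * (real n * real n - real n) \<le> 6 * real (\<Sum>p\<in>P. n - c p)"
      by (simp add: algebra_simps)
    then have "real n * real n - real n \<le> 6 / real n * real (\<Sum>p\<in>P. n - c p)"
      using n by (simp add: field_simps)
    moreover have "real (card P) = real n * real n - real n"
      unfolding assms(3) by (simp add: of_nat_diff)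
    ultimately show ?thesis by linarith
  qed
  finally show ?thesis .
qed

text \<open>The pairs for all sets are drawn in advance and independently. Since every step strictly
  shrinks the set, no set occurs twice, and the pair drawn for \<open>J\<close> is independent of
  everything used afterwards. The index set \<open>A\<close> is general because the induction
  removes \<open>J\<close> from it.\<close>

lemma expected_split_depth:
  fixes stp :: "nat set \<Rightarrow> nat \<times> nat \<Rightarrow> nat set"
  assumes fin0: "finite J0"
    and shr: "\<And>J p. 2 \<le> card J \<Longrightarrow> stp J p \<subset> J"
    and ne: "\<And>J p. J \<subseteq> J0 \<Longrightarrow> p \<in> distinct_pairs J \<Longrightarrow> stp J p \<noteq> {}"
    and rem: "\<And>J. J \<subseteq> J0 \<Longrightarrow> card J * card J * card J
        \<le> 6 * (\<Sum>p\<in>distinct_pairs J. card (J - stp J p)) + card J * card J"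
    and "J \<subseteq> J0" "J \<noteq> {}" "finite A" "\<And>J'. J' \<subseteq> J \<Longrightarrow> 2 \<le> card J' \<Longrightarrow> J' \<in> A"
  shows "(\<integral>\<^sup>+ pick. of_nat (split_depth (\<lambda>J. stp J (pick J)) J)
      \<partial>Pi_pmf A d (\<lambda>J. pmf_of_set (distinct_pairs J))) \<le> ennreal (6 * ln (real (card J)))"
  using assms(5-8)
proof (induction "card J" arbitrary: J A rule: less_induct)
  case less
  let ?Q = "\<lambda>J. pmf_of_set (distinct_pairs J)"
  have fJ: "finite J" using less.prems(1) fin0 finite_subset by blast
  have sh: "shrinking (\<lambda>J. stp J (pick J))" for pick using shr by (simp add: shrinking_def)
  show ?case
  proof (cases "card J < 2")
    case True
    then show ?thesis by (simp add: split_depth_small)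
  next
    case False
    then have J2: "2 \<le> card J" by simp
    define A' where "A' = A - {J}"
    have A: "A = insert J A'" "J \<notin> A'" "finite A'"
      using less.prems(3,4) J2 by (auto simp: A'_def)
    let ?P = "distinct_pairs J"
    have cP: "card ?P = card J * card J - card J" using fJ by (rule card_distinct_pairs)
    moreover have "card J < card J * card J" using J2 by simp
    ultimately have Ppos: "0 < card ?P" by simp
    then have P: "finite ?P" "?P \<noteq> {}" using fJ by auto
    have step: "split_depth (\<lambda>J'. stp J' ((pick(J := p)) J')) J =
        Suc (split_depth (\<lambda>J'. stp J' (pick J')) (stp J p))" for pick p
    proof -
      have "split_depth (\<lambda>J'. stp J' ((pick(J := p)) J')) J =
          Suc (split_depth (\<lambda>J'. stp J' ((pick(J := p)) J')) (stp J p))"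
        using split_depth_step[OF sh J2, of "pick(J := p)"] by simp
      also have "split_depth (\<lambda>J'. stp J' ((pick(J := p)) J')) (stp J p) =
          split_depth (\<lambda>J'. stp J' (pick J')) (stp J p)"
        by (rule split_depth_cong[OF sh sh]) (use shr[OF J2, of p] in auto)
      finally show ?thesis .
    qed
    have inner: "(\<integral>\<^sup>+ pick. of_nat (split_depth (\<lambda>J'. stp J' ((pick(J := p)) J')) J) \<partial>Pi_pmf A' d ?Q)
        \<le> ennreal (1 + 6 * ln (real (card (stp J p))))" if p: "p \<in> ?P" for p
    proof -
      have s: "stp J p \<subset> J" "stp J p \<noteq> {}" using shr[OF J2] ne[OF less.prems(1) p] by auto
      then have "1 \<le> card (stp J p)" using fJ finite_subset by (fastforce simp: Suc_le_eq card_gt_0_iff)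
      have "(\<integral>\<^sup>+ pick. of_nat (split_depth (\<lambda>J'. stp J' (pick J')) (stp J p)) \<partial>Pi_pmf A' d ?Q)
        \<le> ennreal (6 * ln (real (card (stp J p))))"
      proof (rule less.hyps)
        show "card (stp J p) < card J" using s(1) fJ by (intro psubset_card_mono)
        show "stp J p \<subseteq> J0" "stp J p \<noteq> {}" "finite A'" using s less.prems(1) A(3) by auto
        show "J' \<in> A'" if "J' \<subseteq> stp J p" "2 \<le> card J'" for J'
          using that s(1) less.prems(4)[of J'] by (auto simp: A'_def)
      qed
      then have "1 + (\<integral>\<^sup>+ pick. of_nat (split_depth (\<lambda>J'. stp J' (pick J')) (stp J p)) \<partial>Pi_pmf A' d ?Q)
        \<le> 1 + ennreal (6 * ln (real (card (stp J p))))" by (rule add_left_mono)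
      also have "\<dots> = ennreal (1 + 6 * ln (real (card (stp J p))))"
        using \<open>1 \<le> card (stp J p)\<close> by (subst ennreal_plus) auto
      finally show ?thesis unfolding step by (simp add: nn_integral_add)
    qed
    have "(\<integral>\<^sup>+ pick. of_nat (split_depth (\<lambda>J. stp J (pick J)) J) \<partial>Pi_pmf A d ?Q) =
        (\<integral>\<^sup>+ p. \<integral>\<^sup>+ pick. of_nat (split_depth (\<lambda>J'. stp J' ((pick(J := p)) J')) J) \<partial>Pi_pmf A' d ?Q \<partial>?Q J)"
      unfolding A(1) Pi_pmf_insert[OF A(3,2)] by (simp only: nn_integral_map_pmf nn_integral_pair_pmf' case_prod_conv)
    also have "\<dots> = (\<Sum>p\<in>?P. \<integral>\<^sup>+ pick. of_nat (split_depth (\<lambda>J'. stp J' ((pick(J := p)) J')) J) \<partial>Pi_pmf A' d ?Q)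
        / of_nat (card ?P)"
      by (subst nn_integral_pmf_of_set) (use P in auto)
    also have "\<dots> \<le> (\<Sum>p\<in>?P. ennreal (1 + 6 * ln (real (card (stp J p))))) / of_nat (card ?P)"
      by (intro divide_right_mono_ennreal sum_mono inner)
    also have "\<dots> = ennreal ((\<Sum>p\<in>?P. 1 + 6 * ln (real (card (stp J p)))) / real (card ?P))"
    proof -
      have "1 \<le> card (stp J p)" if "p \<in> ?P" for p
        using ne[OF less.prems(1) that] shr[OF J2, of p] fJ finite_subset
        by (fastforce simp: Suc_le_eq card_gt_0_iff)
      then have nn: "0 \<le> 1 + 6 * ln (real (card (stp J p)))" if "p \<in> ?P" for p
        using that by (intro add_nonneg_nonneg mult_nonneg_nonneg ln_ge_zero) auto
      then show ?thesis using Ppos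
        by (simp add: sum_ennreal divide_ennreal sum_nonneg ennreal_of_nat_eq_real_of_nat)
    qed
    also have "\<dots> \<le> ennreal (6 * ln (real (card J)))"
    proof (rule ennreal_leI)
      have "(\<Sum>p\<in>?P. 1 + 6 * ln (real (card (stp J p)))) \<le> real (card ?P) * (6 * ln (real (card J)))"
      proof (rule expected_log_decrease[OF P cP J2])
        fix p assume p: "p \<in> ?P"
        have "stp J p \<subseteq> J" "stp J p \<noteq> {}"
          using psubset_imp_subset[OF shr[OF J2]] ne[OF less.prems(1) p] by auto
        then show "1 \<le> card (stp J p) \<and> card (stp J p) \<le> card J"
          using fJ by (auto simp: Suc_le_eq card_gt_0_iff card_mono intro: finite_subset)
      next
        have "card (J - stp J p) = card J - card (stp J p)" for p
          using psubset_imp_subset[OF shr[OF J2]] fJ finite_subset by (intro card_Diff_subset) blast+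
        then show "card J * card J * card J \<le> 6 * (\<Sum>p\<in>?P. card J - card (stp J p)) + card J * card J"
          using rem[OF less.prems(1)] by simp
      qed
      then show "(\<Sum>p\<in>?P. 1 + 6 * ln (real (card (stp J p)))) / real (card ?P) \<le> 6 * ln (real (card J))"
        using Ppos by (simp add: field_simps)
    qed
    finally show ?thesis .
  qed
qed

section \<open>A randomized learner\<close>

datatype cut_status = Ask | Swap | Cut "nat set"

type_synonym split_state = "nat \<times> nat set \<times> nat set \<times> cut_status"

text \<open>Reduction modulo the length keeps every query inside the domain for arbitrary seeds,
  including those that code no valid pairs.\<close>

definition nth_mod :: "'a list \<Rightarrow> nat \<Rightarrow> 'a" where
  "nth_mod xs i = xs ! (i mod length xs)"

text \<open>A state \<open>(t, J, D, c)\<close> consists of the round, the undecided indices, the indices decided to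
  be positive, and the prefix currently used to predict on \<open>J\<close>.\<close>

fun split_action :: "'a list \<Rightarrow> (nat set \<Rightarrow> nat \<times> nat) \<Rightarrow> split_state \<Rightarrow> 'a action" where
  "split_action xs pick (t, J, D, c) =
     (if 2 \<le> card J then
        (case c of
           Ask \<Rightarrow> Query (sep_sample (map_prod (nth_mod xs) (nth_mod xs) (pick J)))
         | Swap \<Rightarrow> Query (sep_sample (prod.swap (map_prod (nth_mod xs) (nth_mod xs) (pick J))))
         | Cut C \<Rightarrow> Predict (t \<in> D \<or> t \<in> J \<inter> C))
      else Predict (t \<in> D))"

text \<open>A mistake tells on which side of the cut the target ends: a positive element outside the
  cut makes the whole cut positive, a negative element inside it makes the rest negative. Without a
  cut, a mistake occurs only when at most one index is undecided.\<close>

fun split_update :: "'a list \<Rightarrow> split_state \<Rightarrow> 'a event \<Rightarrow> split_state" where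
  "split_update xs (t, J, D, c) (Answered S None) = (t, J, D, Swap)"
| "split_update xs (t, J, D, c) (Answered S (Some g)) = (t, J, D, Cut {i. i < length xs \<and> g (xs ! i)})"
| "split_update xs (t, J, D, c) (Labelled p y) =
     (if p = y then (Suc t, J, D, c)
      else case c of
        Cut C \<Rightarrow> if y then (Suc t, J - C, D \<union> (J \<inter> C), Ask) else (Suc t, J \<inter> C, D, Ask)
      | _ \<Rightarrow> (Suc t, {}, D, Ask))"

definition split_state :: "'a list \<Rightarrow> 'a event list \<Rightarrow> split_state" where
  "split_state xs h = foldl (split_update xs) (0, {..<length xs}, {}, Ask) h"

definition split_learner :: "(nat set \<Rightarrow> nat \<times> nat) \<Rightarrow> 'a learner" where
  "split_learner pick xs h = split_action xs pick (split_state xs h)"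

lemma split_state_simps [simp]:
  "split_state xs [] = (0, {..<length xs}, {}, Ask)"
  "split_state xs (h @ [e]) = split_update xs (split_state xs h) e"
  by (simp_all add: split_state_def)

lemma det_learner_split:
  assumes "T \<ge> 1"
  shows "det_learner cv T (split_learner pick)"
  unfolding det_learner_def
proof (intro allI impI)
  fix xs h S
  assume ann: "announceable cv T xs" and S: "split_learner pick xs h = Query S"
  have "xs \<noteq> []" using ann assms by (auto simp: announceable_def)
  then have "nth_mod xs i \<in> set xs" for i by (simp add: nth_mod_def)
  moreover have "set xs \<subseteq> dom_of cv xs" by (cases cv) auto
  ultimately have n: "nth_mod xs i \<in> dom_of cv xs" for i by blast
  obtain t J D c where st: "split_state xs h = (t, J, D, c)" by (metis prod_cases4)
  show "S \<subseteq> dom_of cv xs \<times> UNIV"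
    using S n by (auto simp: split_learner_def st sep_sample_def split: if_splits cut_status.splits)
qed

locale split_play =
  fixes cv :: "'a convention" and T :: nat and xs r z R
  assumes inst: "(xs, r, z, R) \<in> all_instances cv T" and T: "T \<ge> 1"
begin

definition lab :: "nat \<Rightarrow> bool" where
  "lab i = concept r z (xs ! i)"

definition le :: "nat \<Rightarrow> nat \<Rightarrow> bool" where
  "le i j \<longleftrightarrow> (xs ! i, xs ! j) \<in> r"

definition pair_sample :: "nat \<times> nat \<Rightarrow> 'a sample" where
  "pair_sample p = sep_sample (map_prod (nth_mod xs) (nth_mod xs) p)"

definition cut_answer :: "nat \<times> nat \<Rightarrow> 'a answer" where
  "cut_answer p = (if R (pair_sample p) r = None then R (pair_sample (prod.swap p)) r
     else R (pair_sample p) r)"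

definition cut :: "nat \<times> nat \<Rightarrow> nat set" where
  "cut p = {i. i < T \<and> the (cut_answer p) (xs ! i)}"

text \<open>The side that stays undecided if the cut errs, read off from the true labels. The
  learner finds it out only at the mistake, but it does not depend on when the mistake happens. The
  default \<open>{}\<close> makes the step shrinking for arbitrary pairs.\<close>

definition stp :: "nat set \<Rightarrow> nat \<times> nat \<Rightarrow> nat set" where
  "stp J p = (if p \<in> distinct_pairs J \<and> J \<subseteq> {..<T}
     then if \<exists>k\<in>J \<inter> cut p. \<not> lab k then J \<inter> cut p else J - cut p else {})"

lemma basic: "length xs = T" "distinct xs" "Linear_order r" "legal_oracle r (\<lambda>S. R S r)"
  "i < T \<Longrightarrow> xs ! i \<in> Field r" "i < T \<Longrightarrow> nth_mod xs i = xs ! i"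
proof -
  have adm: "admissible cv xs r" and ann: "announceable cv T xs"
    using inst by (auto simp: instances_def)
  show "length xs = T" "distinct xs" using ann by (auto simp: announceable_def)
  show "Linear_order r" by (rule admissible_finite_Field[OF adm])
  show "legal_oracle r (\<lambda>S. R S r)" using inst adm by (auto simp: instances_def legal_rule_def)
  show "xs ! i \<in> Field r" if "i < T" for i
  proof -
    have "set xs \<subseteq> dom_of cv xs" by (cases cv) auto
    then show ?thesis using that \<open>length xs = T\<close> admissible_finite_Field(1)[OF adm] by auto
  qed
  show "nth_mod xs i = xs ! i" if "i < T" for i using that \<open>length xs = T\<close> by (simp add: nth_mod_def)
qed

lemma le_order:
  "i < T \<Longrightarrow> le i i"
  "i < T \<Longrightarrow> j < T \<Longrightarrow> le i j \<Longrightarrow> le j i \<Longrightarrow> i = j"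
  "le i j \<Longrightarrow> le j k \<Longrightarrow> le i k"
  "i < T \<Longrightarrow> j < T \<Longrightarrow> le i j \<or> le j i"
proof -
  have r: "refl_on (Field r) r" "antisym r" "trans r" "total_on (Field r) r"
    using basic(3) by (simp_all add: order_on_defs)
  show *: "le i i" if "i < T" for i using r(1) basic(5)[OF that] by (simp add: le_def refl_on_def)
  show "i = j" if "i < T" "j < T" "le i j" "le j i"
    using r(2) basic(1,2) that by (metis antisymD le_def nth_eq_iff_index_eq)
  show "le i j \<Longrightarrow> le j k \<Longrightarrow> le i k" using r(3) by (auto simp: le_def dest: transD)
  show "le i j \<or> le j i" if "i < T" "j < T"
  proof (cases "xs ! i = xs ! j")
    case True
    then show ?thesis using *[OF that(1)] by (simp add: le_def)
  next
    case False
    then show ?thesis using r(4) basic(5) that unfolding total_on_def le_def by blast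
  qed
qed

lemma lab_down: "le i j \<Longrightarrow> lab j \<Longrightarrow> lab i"
  using basic(3) by (auto simp: lab_def le_def concept_def order_on_defs dest: transD)

lemma pair_sample_legal:
  assumes "fst p < T" "snd p < T"
  shows "pair_sample p \<subseteq> Field r \<times> UNIV"
  using assms basic(5,6) by (auto simp: pair_sample_def sep_sample_def)

lemma cut_answer_Some:
  assumes p: "p \<in> distinct_pairs J" "J \<subseteq> {..<T}"
  obtains g where "cut_answer p = Some g" "g \<in> concepts r" "g (xs ! fst p) \<noteq> g (xs ! snd p)"
    "R (pair_sample p) r = Some g \<or> R (pair_sample p) r = None \<and> R (pair_sample (prod.swap p)) r = Some g"
proof -
  obtain i j where ij: "p = (i, j)" "i < T" "j < T" "i \<noteq> j"
    using p by (cases p) (auto simp: distinct_pairs_def)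
  have ne: "xs ! i \<noteq> xs ! j" using ij basic(1,2) by (simp add: nth_eq_iff_index_eq)
  have S: "pair_sample (i, j) = sep_sample (xs ! i, xs ! j)"
    "pair_sample (j, i) = sep_sample (xs ! j, xs ! i)"
    using ij basic(6) by (simp_all add: pair_sample_def)
  note leg = legal_oracleD[OF basic(4), of "pair_sample (i, j)"]
    legal_oracleD[OF basic(4), of "pair_sample (j, i)"]
  have sub: "pair_sample (i, j) \<subseteq> Field r \<times> UNIV" "pair_sample (j, i) \<subseteq> Field r \<times> UNIV"
    using ij pair_sample_legal[of "(i, j)"] pair_sample_legal[of "(j, i)"] by simp_all
  show thesis
  proof (cases "R (pair_sample (i, j)) r")
    case (Some g)
    then have "g \<in> concepts r" "consistent g (pair_sample (i, j))" using leg(2)[OF sub(1)] by auto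
    then show thesis using that[of g] Some ij(1)
      by (auto simp: cut_answer_def S consistent_def sep_sample_def)
  next
    case None
    then have "\<not> (\<exists>c\<in>concepts r. consistent c (sep_sample (xs ! i, xs ! j)))"
      using leg(1)[OF sub(1)] S by simp
    then have "\<exists>c\<in>concepts r. consistent c (sep_sample (xs ! j, xs ! i))"
      using ordered_pair_consistent[OF basic(3) basic(5)[OF ij(2)] basic(5)[OF ij(3)] ne] by blast
    then have "R (pair_sample (j, i)) r \<noteq> None" using leg(3)[OF sub(2)] S by auto
    then obtain g where g: "R (pair_sample (j, i)) r = Some g" by auto
    then have "g \<in> concepts r" "consistent g (pair_sample (j, i))" using leg(4)[OF sub(2)] by auto
    then show thesis using that[of g] None g ij(1)
      by (auto simp: cut_answer_def S consistent_def sep_sample_def)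
  qed
qed

lemma cut_props:
  assumes p: "p \<in> distinct_pairs J" "J \<subseteq> {..<T}"
  shows "(fst p \<in> cut p) \<noteq> (snd p \<in> cut p)"
    "k \<in> cut p \<Longrightarrow> l < T \<Longrightarrow> le l k \<Longrightarrow> l \<in> cut p"
proof -
  obtain g where g: "cut_answer p = Some g" "g \<in> concepts r" "g (xs ! fst p) \<noteq> g (xs ! snd p)"
    by (rule cut_answer_Some[OF p])
  have "fst p < T" "snd p < T" using p by (auto simp: distinct_pairs_def)
  then show "(fst p \<in> cut p) \<noteq> (snd p \<in> cut p)" using g by (auto simp: cut_def)
  obtain w where "g = concept r w" using g(2) by (auto simp: concepts_def)
  moreover have "trans r" using basic(3) by (simp add: order_on_defs)
  ultimately show "k \<in> cut p \<Longrightarrow> l < T \<Longrightarrow> le l k \<Longrightarrow> l \<in> cut p"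
    using g(1) by (auto simp: cut_def concept_def le_def dest: transD)
qed

lemma stp_props:
  assumes p: "p \<in> distinct_pairs J" "J \<subseteq> {..<T}"
  shows "stp J p \<subset> J" "stp J p \<noteq> {}" "stp J p = J \<inter> cut p \<or> stp J p = J - cut p"
proof -
  have "fst p \<in> J" "snd p \<in> J" using p by (auto simp: distinct_pairs_def)
  then show "stp J p \<subset> J" "stp J p \<noteq> {}" "stp J p = J \<inter> cut p \<or> stp J p = J - cut p"
    using cut_props(1)[OF p] p unfolding stp_def by auto
qed

lemma stp_subset: "2 \<le> card J \<Longrightarrow> stp J p \<subset> J"
  using stp_props(1)[of p J] by (cases "p \<in> distinct_pairs J \<and> J \<subseteq> {..<T}") (auto simp: stp_def)

lemma shrinking_stp: "shrinking (\<lambda>J. stp J (pick J))"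
  using stp_subset by (simp add: shrinking_def)

lemma stp_removes:
  assumes "J \<subseteq> {..<T}"
  shows "card J * card J * card J
    \<le> 6 * (\<Sum>p\<in>distinct_pairs J. card (J - stp J p)) + card J * card J"
proof (rule random_cut_removes[where le = le and C = cut])
  show "finite J" using assms finite_subset by blast
  have T: "k < T" if "k \<in> J" for k using that assms by auto
  show "le k k" if "k \<in> J" for k using that T le_order(1) by blast
  show "k = l" if "k \<in> J" "l \<in> J" "le k l" "le l k" for k l using that T le_order(2) by blast
  show "le k m" if "le k l" "le l m" for k l m using that by (rule le_order(3))
  show "le k l \<or> le l k" if "k \<in> J" "l \<in> J" for k l using that T le_order(4) by blast
  fix p assume p: "p \<in> distinct_pairs J"
  show "(fst p \<in> cut p) \<noteq> (snd p \<in> cut p)" by (rule cut_props(1)[OF p assms])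
  show "l \<in> cut p" if "k \<in> cut p" "l \<in> J" "le l k" for k l
    using cut_props(2)[OF p assms that(1) T[OF that(2)] that(3)] .
  show "stp J p = J \<inter> cut p \<or> stp J p = J - cut p" by (rule stp_props(3)[OF p assms])
qed

text \<open>The calls charged to the current cut, out of a budget of two; a cut found at the first
  call is still charged two.\<close>

definition cost :: "nat \<Rightarrow> cut_status \<Rightarrow> nat" where
  "cost m c = m + (case c of Ask \<Rightarrow> 0 | Swap \<Rightarrow> 1 | Cut C \<Rightarrow> 2)"

text \<open>Labels are tracked only from round \<open>t\<close> on, as earlier indices never return.
  \<open>split_depth\<close> counts the mistakes still possible on cuts, and the
  \<open>of_bool\<close> term reserves the single mistake on the last undecided index.\<close>

definition good_state :: "(nat set \<Rightarrow> nat \<times> nat) \<Rightarrow> 'a event list \<Rightarrow> split_state \<Rightarrow> bool" where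
  "good_state pick h st \<longleftrightarrow> (case st of (t, J, D, c) \<Rightarrow>
     t = rounds h \<and> J \<subseteq> {..<T} \<and>
     (\<forall>i. t \<le> i \<longrightarrow> i < T \<longrightarrow> (i \<in> D \<longrightarrow> lab i) \<and> (i \<notin> D \<longrightarrow> i \<notin> J \<longrightarrow> \<not> lab i)) \<and>
     (card J < 2 \<longrightarrow> c = Ask) \<and>
     (c = Swap \<longrightarrow> R (pair_sample (pick J)) r = None) \<and>
     (\<forall>C. c = Cut C \<longrightarrow> C = cut (pick J)) \<and>
     n_mistakes h + split_depth (\<lambda>J. stp J (pick J)) J + of_bool (J \<noteq> {})
       \<le> 1 + split_depth (\<lambda>J. stp J (pick J)) {..<T} \<and>
     n_calls h + 2 * split_depth (\<lambda>J. stp J (pick J)) J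
       \<le> cost (2 * split_depth (\<lambda>J. stp J (pick J)) {..<T}) c)"

lemma good_state_step:
  assumes pick: "\<And>J. J \<subseteq> {..<T} \<Longrightarrow> 2 \<le> card J \<Longrightarrow> pick J \<in> distinct_pairs J"
    and good: "good_state pick h st" and run: "rounds h < T"
  shows "\<And>S. split_action xs pick st = Query S \<Longrightarrow>
      good_state pick (h @ [Answered S (R S r)]) (split_update xs st (Answered S (R S r)))"
    and "\<And>p. split_action xs pick st = Predict p \<Longrightarrow>
      good_state pick (h @ [Labelled p (lab (rounds h))]) (split_update xs st (Labelled p (lab (rounds h))))"
proof -
  obtain t J D c where st: "st = (t, J, D, c)" by (metis prod_cases4)
  let ?d = "split_depth (\<lambda>J. stp J (pick J))"
  have t: "t = rounds h" and J: "J \<subseteq> {..<T}"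
    and lab: "\<And>i. t \<le> i \<Longrightarrow> i < T \<Longrightarrow> i \<in> D \<Longrightarrow> lab i"
      "\<And>i. t \<le> i \<Longrightarrow> i < T \<Longrightarrow> i \<notin> D \<Longrightarrow> i \<notin> J \<Longrightarrow> \<not> lab i"
    and small: "card J < 2 \<Longrightarrow> c = Ask"
    and swap: "c = Swap \<Longrightarrow> R (pair_sample (pick J)) r = None"
    and cutc: "\<And>C. c = Cut C \<Longrightarrow> C = cut (pick J)"
    and mis: "n_mistakes h + ?d J + of_bool (J \<noteq> {}) \<le> 1 + ?d {..<T}"
    and cal: "n_calls h + 2 * ?d J \<le> cost (2 * ?d {..<T}) c"
    using good unfolding good_state_def st by auto
  have fJ: "finite J" using J finite_subset by blast
  show "good_state pick (h @ [Answered S (R S r)]) (split_update xs st (Answered S (R S r)))"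
    if act: "split_action xs pick st = Query S" for S
  proof -
    have J2: "2 \<le> card J" using act by (auto simp: st split: if_splits)
    have pk: "pick J \<in> distinct_pairs J" by (rule pick[OF J J2])
    obtain g where g: "cut_answer (pick J) = Some g"
      "R (pair_sample (pick J)) r = Some g \<or>
       R (pair_sample (pick J)) r = None \<and> R (pair_sample (prod.swap (pick J))) r = Some g"
      by (rule cut_answer_Some[OF pk J])
    have cutg: "{i. i < length xs \<and> g (xs ! i)} = cut (pick J)" using g(1) basic(1) by (simp add: cut_def)
    have sw: "prod.swap (map_prod f f p) = map_prod f f (prod.swap p)" for f :: "nat \<Rightarrow> 'a" and p
      by (cases p) simp
    consider "c = Ask" "S = pair_sample (pick J)" | "c = Swap" "S = pair_sample (prod.swap (pick J))"
      using act J2 by (auto simp: st pair_sample_def sw split: cut_status.splits)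
    then show ?thesis
    proof cases
      case 1
      show ?thesis
      proof (cases "R S r")
        case None
        then show ?thesis unfolding good_state_def st
          using t J lab J2 mis cal 1 by (simp add: cost_def)
      next
        case (Some g')
        then have "g' = g" using g(2) 1(2) by simp
        then show ?thesis unfolding good_state_def st Some
          using t J lab J2 mis cal 1 cutg by (simp add: cost_def)
      qed
    next
      case 2
      then have "R S r = Some g" using g(2) swap by simp
      then show ?thesis unfolding good_state_def st
        using t J lab J2 mis cal 2 cutg by (simp add: cost_def)
    qed
  qed
  show "good_state pick (h @ [Labelled p (lab (rounds h))]) (split_update xs st (Labelled p (lab (rounds h))))"
    if act: "split_action xs pick st = Predict p" for p
  proof -
    define y where "y = lab t"
    have tT: "t < T" using run t by simp
    have upd: "n_mistakes (h @ [Labelled p y]) = n_mistakes h + of_bool (p \<noteq> y)"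
      "n_calls (h @ [Labelled p y]) = n_calls h" "rounds (h @ [Labelled p y]) = Suc t"
      using t by simp_all
    have "good_state pick (h @ [Labelled p y]) (split_update xs st (Labelled p y))"
    proof (cases "p = y")
      case True
      then have "split_update xs st (Labelled p y) = (Suc t, J, D, c)" by (simp add: st)
      then show ?thesis unfolding good_state_def upd
        using True J lab small swap cutc mis cal by simp
    next
      case wrong: False
      show ?thesis
      proof (cases "card J < 2")
        case True
        then have p: "p = (t \<in> D)" using act by (simp add: st)
        \<comment> \<open>With fewer than two undecided indices the prediction is negative outside
          \<open>D\<close>, so a mistake is on the last undecided index, which was positive.\<close>
        have "y" "t \<notin> D" using wrong lab(1)[of t] tT p by (auto simp: y_def)
        then have tJ: "t \<in> J" using lab(2)[of t] tT by (auto simp: y_def)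
        have "J = {t}"
        proof -
          have "0 < card J" using tJ fJ by (auto simp: card_gt_0_iff)
          then have "card J = 1" using True by linarith
          then show ?thesis using tJ by (metis card_1_singletonE singletonD)
        qed
        moreover have "split_update xs st (Labelled p y) = (Suc t, {}, D, Ask)"
          using wrong small[OF True] by (simp add: st)
        moreover have "?d J = 0" "?d {} = 0" using True by (simp_all add: split_depth_small)
        ultimately show ?thesis unfolding good_state_def upd
          using wrong lab mis cal small[OF True] by (simp add: cost_def)
      next
        case False
        then have J2: "2 \<le> card J" by simp
        have pk: "pick J \<in> distinct_pairs J" by (rule pick[OF J J2])
        obtain C where c: "c = Cut C" "p = (t \<in> D \<or> t \<in> J \<inter> C)"
          using act J2 by (auto simp: st split: cut_status.splits)
        have C: "C = cut (pick J)" by (rule cutc[OF c(1)])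
        have down: "l \<in> C" if "k \<in> C" "l < T" "le l k" for k l
          using cut_props(2)[OF pk J] that C by blast
        have tD: "t \<notin> D"
        proof
          assume "t \<in> D"
          then show False using lab(1)[of t] tT wrong c(2) by (simp add: y_def)
        qed
        define J' where "J' = stp J (pick J)"
        have dJ: "?d J = Suc (?d J')"
          unfolding J'_def by (rule split_depth_step[OF shrinking_stp J2])
        have J': "J' \<subset> J" "J' \<noteq> {}" unfolding J'_def using stp_props[OF pk J] by auto
        have sd: "J' = (if \<exists>k\<in>J \<inter> C. \<not> lab k then J \<inter> C else J - C)"
          using pk J by (simp add: J'_def stp_def C)
        have fin: "good_state pick (h @ [Labelled p y]) (Suc t, J', D', Ask)"
          if "\<And>i. Suc t \<le> i \<Longrightarrow> i < T \<Longrightarrow> i \<in> D' \<Longrightarrow> lab i"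
            "\<And>i. Suc t \<le> i \<Longrightarrow> i < T \<Longrightarrow> i \<notin> D' \<Longrightarrow> i \<notin> J' \<Longrightarrow> \<not> lab i" for D'
        proof -
          have "J \<noteq> {}" using J2 by auto
          then have "n_mistakes h + 1 + ?d J' + of_bool (J' \<noteq> {}) \<le> 1 + ?d {..<T}"
            using mis dJ J'(2) by simp
          moreover have "n_calls h + 2 * ?d J' \<le> cost (2 * ?d {..<T}) Ask"
            using cal dJ c(1) by (simp add: cost_def)
          moreover have "J' \<subseteq> {..<T}" using J J'(1) by blast
          ultimately show ?thesis unfolding good_state_def upd
            using that wrong by simp
        qed
        show ?thesis
        proof (cases y)
          case True
          then have "t \<notin> J \<inter> C" using c(2) wrong tD by simp
          moreover have "t \<in> J" using lab(2)[of t] tT tD True by (auto simp: y_def)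
          ultimately have tC: "t \<notin> C" by simp
          \<comment> \<open>\<open>t\<close> is positive and outside the cut, so everything in the
            cut lies below it.\<close>
          have pos: "lab k" if "k \<in> J \<inter> C" for k
          proof -
            have "k < T" using that J by auto
            then have "le k t" using le_order(4)[of k t] down[of k t] tC tT that by blast
            then show ?thesis using lab_down True by (auto simp: y_def)
          qed
          then have "J' = J - C" using sd by auto
          then have "split_update xs st (Labelled p y) = (Suc t, J', D \<union> (J \<inter> C), Ask)"
            using wrong True by (simp add: st c(1))
          moreover have "good_state pick (h @ [Labelled p y]) (Suc t, J', D \<union> (J \<inter> C), Ask)"
            by (rule fin) (use lab pos \<open>J' = J - C\<close> in auto)
          ultimately show ?thesis by simp
        next
          case False
          then have tC: "t \<in> J \<inter> C" using c(2) wrong tD by simp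
          then have "J' = J \<inter> C" using sd False by (auto simp: y_def)
          \<comment> \<open>\<open>t\<close> is negative and inside the cut, so everything outside
            the cut lies above it.\<close>
          have neg: "\<not> lab k" if "k \<in> J" "k \<notin> C" for k
          proof
            assume "lab k"
            have "k < T" using that J by auto
            then have "le t k" using le_order(4)[of k t] down[of t k] tC tT that by blast
            then show False using lab_down \<open>lab k\<close> False by (auto simp: y_def)
          qed
          have "split_update xs st (Labelled p y) = (Suc t, J', D, Ask)"
            using wrong False \<open>J' = J \<inter> C\<close> by (simp add: st c(1))
          moreover have "good_state pick (h @ [Labelled p y]) (Suc t, J', D, Ask)"
          proof (rule fin)
            show "lab i" if "Suc t \<le> i" "i < T" "i \<in> D" for i using lab(1)[of i] that by simp
            show "\<not> lab i" if "Suc t \<le> i" "i < T" "i \<notin> D" "i \<notin> J'" for i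
              using lab(2)[of i] neg[of i] that \<open>J' = J \<inter> C\<close> by (cases "i \<in> J") auto
          qed
          ultimately show ?thesis by simp
        qed
      qed
    qed
    then show ?thesis by (simp add: y_def t)
  qed
qed

lemma split_learner_bounds:
  assumes pick: "\<And>J. J \<subseteq> {..<T} \<Longrightarrow> 2 \<le> card J \<Longrightarrow> pick J \<in> distinct_pairs J"
  defines "d \<equiv> split_depth (\<lambda>J. stp J (pick J)) {..<T}"
  shows "mistakes (split_learner pick) (xs, r, z, R) \<le> 1 + of_nat d"
    "calls (split_learner pick) (xs, r, z, R) \<le> 2 + 2 * of_nat d"
proof -
  define H where "H = hist xs (concept r z) (\<lambda>S. R S r) (split_learner pick xs)"
  have good: "good_state pick (H n) (split_state xs (H n))" for n
  proof (induction n)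
    case 0
    show ?case using basic(1) T by (simp add: H_def good_state_def cost_def)
  next
    case (Suc n)
    show ?case
    proof (cases "rounds (H n) = length xs")
      case True
      then have "H (Suc n) = H n" by (simp add: H_def)
      then show ?thesis using Suc by simp
    next
      case False
      then have run: "rounds (H n) < T"
        using rounds_hist_le[of xs "concept r z" "\<lambda>S. R S r" "split_learner pick xs" n] basic(1)
        by (simp add: H_def)
      note step = good_state_step[OF pick Suc run]
      show ?thesis
      proof (cases "split_learner pick xs (H n)")
        case (Query S)
        then have "H (Suc n) = H n @ [Answered S (R S r)]" using False by (simp add: H_def)
        then show ?thesis using step(1)[of S] Query by (simp add: split_learner_def)
      next
        case (Predict p)
        then have "H (Suc n) = H n @ [Labelled p (lab (rounds (H n)))]"
          using False by (simp add: H_def lab_def Let_def)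
        then show ?thesis using step(2)[of p] Predict by (simp add: split_learner_def)
      qed
    qed
  qed
  have bounds: "n_mistakes (H n) \<le> 1 + d \<and> n_calls (H n) \<le> 2 + 2 * d" for n
  proof -
    obtain t J D c where st: "split_state xs (H n) = (t, J, D, c)" by (metis prod_cases4)
    have "cost (2 * d) c \<le> 2 * d + 2" by (auto simp: cost_def split: cut_status.split)
    then show ?thesis using good[of n] unfolding st good_state_def d_def[symmetric] by simp
  qed
  have "(of_nat (n_mistakes (H n)) :: ennreal) \<le> of_nat (1 + d)" for n
    using bounds[of n] by (simp only: of_nat_le_iff)
  then show "mistakes (split_learner pick) (xs, r, z, R) \<le> 1 + of_nat d"
    unfolding mistakes.simps H_def[symmetric] by (intro SUP_least) simp
  have "(of_nat (n_calls (H n)) :: ennreal) \<le> 2 + 2 * of_nat d" for n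
  proof -
    have "(of_nat (n_calls (H n)) :: ennreal) \<le> of_nat (2 + 2 * d)"
      using bounds[of n] by (simp only: of_nat_le_iff)
    also have "of_nat (2 + 2 * d) = (2 + 2 * of_nat d :: ennreal)"
      by (simp only: of_nat_add of_nat_mult of_nat_numeral)
    finally show ?thesis .
  qed
  then show "calls (split_learner pick) (xs, r, z, R) \<le> 2 + 2 * of_nat d"
    unfolding calls.simps H_def[symmetric] by (intro SUP_least)
qed

end

section \<open>Random pairs as a seed\<close>

definition splittable :: "nat \<Rightarrow> nat set set" where
  "splittable T = {J. J \<subseteq> {..<T} \<and> 2 \<le> card J}"

definition pick_pmf :: "nat \<Rightarrow> (nat set \<Rightarrow> nat \<times> nat) pmf" where
  "pick_pmf T = Pi_pmf (splittable T) (0, 0) (\<lambda>J. pmf_of_set (distinct_pairs J))"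

text \<open>One real number per finite set of indices, to match seeds of type
  \<open>nat \<Rightarrow> real\<close>.\<close>

definition encode_pick :: "(nat set \<Rightarrow> nat \<times> nat) \<Rightarrow> nat \<Rightarrow> real" where
  "encode_pick f n = real (prod_encode (f (set_decode n)))"

definition decode_pick :: "(nat \<Rightarrow> real) \<Rightarrow> nat set \<Rightarrow> nat \<times> nat" where
  "decode_pick \<omega> J = prod_decode (nat \<lfloor>\<omega> (set_encode J)\<rfloor>)"

text \<open>A discrete measure, so every set of seeds is measurable. Seeds with an invalid pair for
  some splittable set have probability 0.\<close>

definition seed_measure :: "nat \<Rightarrow> (nat \<Rightarrow> real) measure" where
  "seed_measure T = measure_pmf (map_pmf encode_pick (pick_pmf T))"

lemma finite_splittable [simp]: "finite (splittable T)"
  by (simp add: splittable_def)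

lemma decode_encode_pick: "finite J \<Longrightarrow> decode_pick (encode_pick f) J = f J"
  by (simp add: decode_pick_def encode_pick_def)

lemma rand_learner_split:
  assumes "T \<ge> 1"
  shows "rand_learner cv T (seed_measure T) (\<lambda>\<omega>. split_learner (decode_pick \<omega>))"
  unfolding rand_learner_def seed_measure_def
  using det_learner_split[OF assms] prob_space_measure_pmf by auto

lemma splittable_pairs:
  assumes "J \<in> splittable T"
  shows "finite (distinct_pairs J)" "distinct_pairs J \<noteq> {}"
proof -
  have J: "finite J" "2 \<le> card J" using assms finite_subset by (auto simp: splittable_def)
  then show "finite (distinct_pairs J)" by simp
  have "card J < card J * card J" using J(2) by simp
  then have "card (distinct_pairs J) \<noteq> 0" using card_distinct_pairs[OF J(1)] by simp
  then show "distinct_pairs J \<noteq> {}" by auto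
qed

text \<open>Almost every seed draws a valid pair for each splittable set, so the number of cuts
  bounds both counts seed by seed, and only then is the expectation taken. The instance is fixed
  before the seed, which allows \<open>stp\<close> to refer to the true labels.\<close>

lemma split_learner_expected:
  assumes i: "i \<in> all_instances cv T" and T: "T \<ge> 1"
  shows "(\<integral>\<^sup>+ \<omega>. mistakes (split_learner (decode_pick \<omega>)) i \<partial>seed_measure T) \<le> ennreal (1 + 6 * ln (real T))"
    "(\<integral>\<^sup>+ \<omega>. calls (split_learner (decode_pick \<omega>)) i \<partial>seed_measure T) \<le> ennreal (2 + 12 * ln (real T))"
proof -
  obtain xs r z R where ie: "i = (xs, r, z, R)" by (cases i)
  interpret split_play cv T xs r z R by unfold_locales (use i ie T in auto)
  define dp where "dp pick = split_depth (\<lambda>J. stp J (pick J)) {..<T}" for pick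
  have ae: "AE f in pick_pmf T.
      mistakes (split_learner (decode_pick (encode_pick f))) i \<le> 1 + of_nat (dp f) \<and>
      calls (split_learner (decode_pick (encode_pick f))) i \<le> 2 + 2 * of_nat (dp f)"
  proof (rule AE_pmfI)
    fix f assume f: "f \<in> set_pmf (pick_pmf T)"
    have fJ: "f J \<in> distinct_pairs J" if "J \<in> splittable T" for J
    proof -
      have "f J \<in> set_pmf (pmf_of_set (distinct_pairs J))"
        using f that by (auto simp: pick_pmf_def set_Pi_pmf PiE_dflt_def)
      then show ?thesis using splittable_pairs[OF that] by simp
    qed
    have eq: "decode_pick (encode_pick f) J = f J" if "J \<subseteq> {..<T}" for J
      using that finite_subset by (intro decode_encode_pick) blast
    have pk: "decode_pick (encode_pick f) J \<in> distinct_pairs J" if "J \<subseteq> {..<T}" "2 \<le> card J" for J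
      using fJ[of J] that by (simp add: eq splittable_def)
    have "split_depth (\<lambda>J. stp J (decode_pick (encode_pick f) J)) {..<T} = dp f"
      unfolding dp_def by (rule split_depth_cong[OF shrinking_stp shrinking_stp]) (simp add: eq)
    then show "mistakes (split_learner (decode_pick (encode_pick f))) i \<le> 1 + of_nat (dp f) \<and>
      calls (split_learner (decode_pick (encode_pick f))) i \<le> 2 + 2 * of_nat (dp f)"
      using split_learner_bounds[of "decode_pick (encode_pick f)", OF pk] unfolding ie by simp
  qed
  have E: "(\<integral>\<^sup>+ f. of_nat (dp f) \<partial>pick_pmf T) \<le> ennreal (6 * ln (real T))"
  proof -
    have "(\<integral>\<^sup>+ f. of_nat (split_depth (\<lambda>J. stp J (f J)) {..<T})
        \<partial>Pi_pmf (splittable T) (0, 0) (\<lambda>J. pmf_of_set (distinct_pairs J)))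
      \<le> ennreal (6 * ln (real (card {..<T})))"
      by (rule expected_split_depth[where ?J0.0 = "{..<T}"])
        (use T stp_subset stp_props(2) stp_removes in \<open>auto simp: splittable_def lessThan_empty_iff\<close>)
    then show ?thesis by (simp add: dp_def pick_pmf_def)
  qed
  have lnT: "0 \<le> ln (real T)" using T by simp
  have "(\<integral>\<^sup>+ \<omega>. mistakes (split_learner (decode_pick \<omega>)) i \<partial>seed_measure T) =
      (\<integral>\<^sup>+ f. mistakes (split_learner (decode_pick (encode_pick f))) i \<partial>pick_pmf T)"
    by (simp add: seed_measure_def)
  also have "\<dots> \<le> (\<integral>\<^sup>+ f. 1 + of_nat (dp f) \<partial>pick_pmf T)"
    by (rule nn_integral_mono_AE) (use ae in eventually_elim, blast)
  also have "\<dots> = 1 + (\<integral>\<^sup>+ f. of_nat (dp f) \<partial>pick_pmf T)" by (simp add: nn_integral_add)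
  also have "\<dots> \<le> 1 + ennreal (6 * ln (real T))" by (rule add_left_mono[OF E])
  also have "\<dots> = ennreal (1 + 6 * ln (real T))" using lnT by (subst ennreal_plus) auto
  finally show "(\<integral>\<^sup>+ \<omega>. mistakes (split_learner (decode_pick \<omega>)) i \<partial>seed_measure T)
    \<le> ennreal (1 + 6 * ln (real T))" .
  have "(\<integral>\<^sup>+ \<omega>. calls (split_learner (decode_pick \<omega>)) i \<partial>seed_measure T) =
      (\<integral>\<^sup>+ f. calls (split_learner (decode_pick (encode_pick f))) i \<partial>pick_pmf T)"
    by (simp add: seed_measure_def)
  also have "\<dots> \<le> (\<integral>\<^sup>+ f. 2 + 2 * of_nat (dp f) \<partial>pick_pmf T)"
    by (rule nn_integral_mono_AE) (use ae in eventually_elim, blast)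
  also have "\<dots> = 2 + 2 * (\<integral>\<^sup>+ f. of_nat (dp f) \<partial>pick_pmf T)"
    by (simp add: nn_integral_add nn_integral_cmult)
  also have "\<dots> \<le> 2 + 2 * ennreal (6 * ln (real T))" by (intro add_left_mono mult_left_mono E) simp
  also have "\<dots> = ennreal 2 + ennreal 2 * ennreal (6 * ln (real T))" by simp
  also have "\<dots> = ennreal (2 + 12 * ln (real T))"
    using lnT by (simp only: ennreal_mult[symmetric] ennreal_plus[symmetric]) (simp add: algebra_simps)
  finally show "(\<integral>\<^sup>+ \<omega>. calls (split_learner (decode_pick \<omega>)) i \<partial>seed_measure T)
    \<le> ennreal (2 + 12 * ln (real T))" .
qed

lemma rand_learner_exists:
  "\<exists>(M :: nat \<Rightarrow> (nat \<Rightarrow> real) measure) L.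
        (\<forall>T\<ge>1. rand_learner cv T (M T) L) \<and>
        ebigo (\<lambda>T. worst_mistakes cv T (M T) L) (\<lambda>T. ln (real T)) \<and>
        ebigo (\<lambda>T. worst_calls cv T (M T) L) (\<lambda>T. ln (real T))"
proof (intro exI[of _ seed_measure] exI[of _ "\<lambda>\<omega>. split_learner (decode_pick \<omega>)"] conjI allI impI)
  let ?L = "\<lambda>\<omega>. split_learner (decode_pick \<omega>)"
  show "rand_learner cv T (seed_measure T) ?L" if "T \<ge> 1" for T
    by (rule rand_learner_split[OF that])
  have T1: "\<forall>\<^sub>F T in sequentially. (1::nat) \<le> T" by (rule eventually_ge_at_top)
  have "\<forall>\<^sub>F T in sequentially. 1 + 6 * ln (real T) \<le> 7 * ln (real T)" by real_asymp
  then have "\<forall>\<^sub>F T in sequentially. worst_mistakes cv T (seed_measure T) ?L \<le> ennreal (7 * ln (real T))"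
    using T1
  proof eventually_elim
    case (elim T)
    show ?case unfolding worst_mistakes_def
      by (intro SUP_least order_trans[OF split_learner_expected(1)] elim(2) ennreal_leI elim(1))
  qed
  then show "ebigo (\<lambda>T. worst_mistakes cv T (seed_measure T) ?L) (\<lambda>T. ln (real T))"
    unfolding ebigo_def by blast
  have "\<forall>\<^sub>F T in sequentially. 2 + 12 * ln (real T) \<le> 13 * ln (real T)" by real_asymp
  then have "\<forall>\<^sub>F T in sequentially. worst_calls cv T (seed_measure T) ?L \<le> ennreal (13 * ln (real T))"
    using T1
  proof eventually_elim
    case (elim T)
    show ?case unfolding worst_calls_def
      by (intro SUP_least order_trans[OF split_learner_expected(2)] elim(2) ennreal_leI elim(1))
  qed
  then show "ebigo (\<lambda>T. worst_calls cv T (seed_measure T) ?L) (\<lambda>T. ln (real T))"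
    unfolding ebigo_def by blast
qed

section \<open>The query complexity\<close>

theorem corollary3p3:
  fixes cv :: "'a convention"
  assumes "infinite (UNIV :: 'a set)"
  shows
   "((\<forall>T (M :: 'r measure) L m.
        T \<ge> 1 \<longrightarrow> rand_learner cv T M L \<longrightarrow>
        0 \<le> m \<longrightarrow> worst_mistakes cv T M L = ennreal m \<longrightarrow>
        ennreal ((ln (real T + 1 - eps cv) - ln (2 * m + 1)) / (7 * ln 2))
          \<le> worst_calls cv T M L) \<and>
     (\<forall>(M :: nat \<Rightarrow> 'r measure) L (d :: real).
        (\<forall>T\<ge>1. rand_learner cv T (M T) L) \<longrightarrow>
        ebigo (\<lambda>T. worst_mistakes cv T (M T) L) (\<lambda>T. ln (real T) powr d) \<longrightarrow>
        ebigomega (\<lambda>T. worst_calls cv T (M T) L) (\<lambda>T. ln (real T))))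
    \<and>
    ((\<exists>(M :: nat \<Rightarrow> (nat \<Rightarrow> real) measure) L.
        (\<forall>T\<ge>1. rand_learner cv T (M T) L) \<and>
        ebigo (\<lambda>T. worst_mistakes cv T (M T) L) (\<lambda>T. ln (real T)) \<and>
        ebigo (\<lambda>T. worst_calls cv T (M T) L) (\<lambda>T. ln (real T))) \<and>
     (\<forall>(M :: nat \<Rightarrow> 'r measure) L.
        (\<forall>T\<ge>1. rand_learner cv T (M T) L) \<longrightarrow>
        ebigo (\<lambda>T. worst_mistakes cv T (M T) L) (\<lambda>T. ln (real T)) \<longrightarrow>
        ebigomega (\<lambda>T. worst_calls cv T (M T) L) (\<lambda>T. ln (real T))))
    \<and>
    (\<forall>Rs :: 'a list \<Rightarrow> 'a sel_rule set.
       (\<exists>R. (\<forall>xs. R xs \<in> extremal_rules) \<and> Rs = (\<lambda>xs. {R xs})) \<or> Rs = (\<lambda>_. UNIV) \<longrightarrow>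
       (\<exists>L. (\<forall>T\<ge>1. det_learner cv T L) \<and>
          (\<exists>C. \<forall>\<^sub>F T in sequentially. \<forall>i\<in>instances cv Rs T.
             mistakes L i \<le> ennreal (C * ln (real T))) \<and>
          (\<exists>C. \<forall>\<^sub>F T in sequentially. \<forall>i\<in>instances cv Rs T.
             calls L i \<le> ennreal (C * real T))) \<and>
       (\<forall>L. (\<forall>T\<ge>1. det_learner cv T L) \<longrightarrow>
          (\<exists>C. \<forall>\<^sub>F T in sequentially. \<forall>i\<in>instances cv Rs T.
             mistakes L i \<le> ennreal (C * ln (real T))) \<longrightarrow>
          (\<exists>c>0. \<forall>\<^sub>F T in sequentially. \<exists>i\<in>instances cv Rs T.
             ennreal (c * real T) \<le> calls L i)))"
proof (intro conjI allI impI)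
  show "ennreal ((ln (real T + 1 - eps cv) - ln (2 * m + 1)) / (7 * ln 2)) \<le> worst_calls cv T M L"
    if "T \<ge> 1" "rand_learner cv T M L" "0 \<le> m" "worst_mistakes cv T M L = ennreal m"
    for T and M :: "'r measure" and L m
    using rand_calls_lower[OF assms that(1-3)] that(4) by simp
next
  show "ebigomega (\<lambda>T. worst_calls cv T (M T) L) (\<lambda>T. ln (real T))"
    if "\<forall>T\<ge>1. rand_learner cv T (M T) L"
      "ebigo (\<lambda>T. worst_mistakes cv T (M T) L) (\<lambda>T. ln (real T) powr d)"
    for M :: "nat \<Rightarrow> 'r measure" and L d
    using rand_calls_Omega[OF assms _ that(2)] that(1) by simp
next
  show "\<exists>(M :: nat \<Rightarrow> (nat \<Rightarrow> real) measure) L.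
        (\<forall>T\<ge>1. rand_learner cv T (M T) L) \<and>
        ebigo (\<lambda>T. worst_mistakes cv T (M T) L) (\<lambda>T. ln (real T)) \<and>
        ebigo (\<lambda>T. worst_calls cv T (M T) L) (\<lambda>T. ln (real T))"
    by (rule rand_learner_exists)
next
  fix M :: "nat \<Rightarrow> 'r measure" and L
  assume L: "\<forall>T\<ge>1. rand_learner cv T (M T) L"
    and "ebigo (\<lambda>T. worst_mistakes cv T (M T) L) (\<lambda>T. ln (real T))"
  then obtain C where C: "\<forall>\<^sub>F T in sequentially. worst_mistakes cv T (M T) L \<le> ennreal (C * ln (real T))"
    by (auto simp: ebigo_def)
  \<comment> \<open>\<open>ln (real T) powr 1\<close> equals \<open>ln (real T)\<close> where the
    logarithm is nonnegative.\<close>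
  have "\<forall>\<^sub>F T in sequentially. (1::nat) \<le> T" by (rule eventually_ge_at_top)
  with C have "\<forall>\<^sub>F T in sequentially.
      worst_mistakes cv T (M T) L \<le> ennreal (C * ln (real T) powr 1)"
    by eventually_elim simp
  then have "ebigo (\<lambda>T. worst_mistakes cv T (M T) L) (\<lambda>T. ln (real T) powr 1)"
    unfolding ebigo_def by blast
  then show "ebigomega (\<lambda>T. worst_calls cv T (M T) L) (\<lambda>T. ln (real T))"
    by (rule rand_calls_Omega[OF assms, rotated]) (use L in simp)
next
  fix Rs :: "'a list \<Rightarrow> 'a sel_rule set"
  show "\<exists>L. (\<forall>T\<ge>1. det_learner cv T L) \<and>
    (\<exists>C. \<forall>\<^sub>F T in sequentially. \<forall>i\<in>instances cv Rs T. mistakes L i \<le> ennreal (C * ln (real T))) \<and>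
    (\<exists>C. \<forall>\<^sub>F T in sequentially. \<forall>i\<in>instances cv Rs T. calls L i \<le> ennreal (C * real T))"
    by (rule det_learner_exists)
next
  fix Rs :: "'a list \<Rightarrow> 'a sel_rule set" and L
  assume Rs: "(\<exists>R. (\<forall>xs. R xs \<in> extremal_rules) \<and> Rs = (\<lambda>xs. {R xs})) \<or> Rs = (\<lambda>_. UNIV)"
    and "\<exists>C. \<forall>\<^sub>F T in sequentially. \<forall>i\<in>instances cv Rs T. mistakes L i \<le> ennreal (C * ln (real T))"
  then obtain C where C:
    "\<forall>\<^sub>F T in sequentially. \<forall>i\<in>instances cv Rs T. mistakes L i \<le> ennreal (C * ln (real T))"
    by blast
  \<comment> \<open>If all legal rules are possible, the hard instances use \<open>min_rule\<close>;
    otherwise they use the declared rule.\<close>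
  have "min_rule \<in> extremal_rules" by (simp add: extremal_rules_def)
  then obtain R where R: "R xs \<in> extremal_rules" "R xs \<in> Rs xs" for xs
    using Rs by (metis UNIV_I singletonI)
  show "\<exists>c>0. \<forall>\<^sub>F T in sequentially. \<exists>i\<in>instances cv Rs T. ennreal (c * real T) \<le> calls L i"
    using det_calls_Omega[where R = R, OF assms R C] by (intro exI[of _ "1/4"]) simp
qed

end
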